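(* Let $T$ be an $n$-vertex tree with maximum degree $k$. Then $$r_{\mathrm{ind}}(T;q)\le \hat r_{\mathrm{ind}}(T;q)\le (kq)^{Cq^4k^3}n$$ for some absolute constant $C$. Furthermore, if $H$ is a $w$-blowup of $T$, then $$\hat r_{\mathrm{ind}}(H;q)\le (kq)^{Cq^4k^3w}n .$$
   Context: For graphs $G,H$, write $G\to_{\mathrm{ind}}(H)_q$ if for every coloring of $E(G)$ with $q$ colors there is some monochromatic copy of $H$ which is an induced subgraph of $G$. Define $r_{\mathrm{ind}}(H;q)$ (respectively $\hat r_{\mathrm{ind}}(H;q)$) to be the minimum number of vertices (respectively edges) that a graph $G$ with $G\to_{\mathrm{ind}}(H)_q$ can have. A graph $G'$ is an $s$-blowup of a graph $G$ if there is a homomorphism $\phi:V(G')\to V(G)$, so that $uv\in E(G')$ implies $\phi(u)\phi(v)\in E(G)$, and furthermore $|\phi^{-1}(v)|\le s$ for each vertex $v\in V(G)$. (In particular there are no edges inside the sets $\phi^{-1}(v)$.)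
   Formalization: r_ind(T;q) ≤ r̂_ind(T;q) is claimed only for q ≥ 2 and T not a star (it fails otherwise, e.g. T = K_2: 2 > 1); both upper bounds hold for all T. If k = q = 1, the blowup bound is claimed only for w ≤ 1, as K_{w,w} has w² > 2 edges for w ≥ 2. *)

theory Defs
  imports "HOL-Library.Extended_Nat"
begin

record 'a sgraph =
  verts :: "'a set"
  edges :: "'a set set"

definition fin_sgraph :: "'a sgraph \<Rightarrow> bool" where
  "fin_sgraph G \<longleftrightarrow> finite (verts G) \<and> (\<forall>e\<in>edges G. e \<subseteq> verts G \<and> card e = 2)"

definition degree :: "'a sgraph \<Rightarrow> 'a \<Rightarrow> nat" where
  "degree G v = card {e \<in> edges G. v \<in> e}"

text \<open>Only meaningful if the graph is finite and has at least one vertex, as every tree does.\<close>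

definition max_degree :: "'a sgraph \<Rightarrow> nat" where
  "max_degree G = Max (degree G ` verts G)"

definition walk :: "'a sgraph \<Rightarrow> 'a list \<Rightarrow> bool" where
  "walk G xs \<longleftrightarrow> xs \<noteq> [] \<and> set xs \<subseteq> verts G \<and> successively (\<lambda>u v. {u, v} \<in> edges G) xs"

definition is_connected :: "'a sgraph \<Rightarrow> bool" where
  "is_connected G \<longleftrightarrow> verts G \<noteq> {} \<and>
     (\<forall>u\<in>verts G. \<forall>v\<in>verts G. \<exists>xs. walk G xs \<and> hd xs = u \<and> last xs = v)"

definition is_cycle :: "'a sgraph \<Rightarrow> 'a list \<Rightarrow> bool" where
  "is_cycle G xs \<longleftrightarrow> walk G xs \<and> distinct xs \<and> length xs \<ge> 3 \<and> {last xs, hd xs} \<in> edges G"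

definition is_tree :: "'a sgraph \<Rightarrow> bool" where
  "is_tree G \<longleftrightarrow> fin_sgraph G \<and> is_connected G \<and> (\<nexists>xs. is_cycle G xs)"

text \<open>For trees, this singles out the stars \<open>K\<^sub>1\<^sub>,\<^sub>m\<close> with \<open>m \<ge> 0\<close>; the one-vertex and the
  one-edge tree are included.\<close>

definition is_star :: "'a sgraph \<Rightarrow> bool" where
  "is_star G \<longleftrightarrow> (\<exists>c\<in>verts G. \<forall>e\<in>edges G. c \<in> e)"

definition graph_iso :: "'a sgraph \<Rightarrow> 'b sgraph \<Rightarrow> bool" where
  "graph_iso G H \<longleftrightarrow> (\<exists>f. bij_betw f (verts G) (verts H) \<and>
     (\<forall>u\<in>verts G. \<forall>v\<in>verts G. {u, v} \<in> edges G \<longleftrightarrow> {f u, f v} \<in> edges H))"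

definition induced_subgraph :: "'a sgraph \<Rightarrow> 'a set \<Rightarrow> 'a sgraph" where
  "induced_subgraph G S = \<lparr>verts = S, edges = {e \<in> edges G. e \<subseteq> S}\<rparr>"

text \<open>The relation \<open>G \<rightarrow>\<^sub>i\<^sub>n\<^sub>d (H)\<^sub>q\<close>. Since the copy of \<open>H\<close> is an induced subgraph of \<open>G\<close>, it is
  determined by its vertex set \<open>S\<close>.\<close>

definition ind_arrows :: "'a sgraph \<Rightarrow> 'b sgraph \<Rightarrow> nat \<Rightarrow> bool" where
  "ind_arrows G H q \<longleftrightarrow>
     (\<forall>c :: 'a set \<Rightarrow> nat. c ` edges G \<subseteq> {..<q} \<longrightarrow>
        (\<exists>S \<subseteq> verts G. graph_iso H (induced_subgraph G S) \<and>
           (\<exists>i. \<forall>e \<in> edges (induced_subgraph G S). c e = i)))"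

text \<open>Every finite graph is isomorphic to one with vertices in \<open>nat\<close>, so it is enough to minimise
  over host graphs of that type. The value would be \<open>\<infinity>\<close> if there were no host graph at all;
  a finite upper bound therefore includes the existence of one.\<close>

definition r_ind :: "'b sgraph \<Rightarrow> nat \<Rightarrow> enat" where
  "r_ind H q = (INF G \<in> {G :: nat sgraph. fin_sgraph G \<and> ind_arrows G H q}. enat (card (verts G)))"

definition size_r_ind :: "'b sgraph \<Rightarrow> nat \<Rightarrow> enat" where
  "size_r_ind H q = (INF G \<in> {G :: nat sgraph. fin_sgraph G \<and> ind_arrows G H q}. enat (card (edges G)))"

definition is_blowup :: "nat \<Rightarrow> 'b sgraph \<Rightarrow> 'a sgraph \<Rightarrow> bool" where
  "is_blowup s G' G \<longleftrightarrow> (\<exists>\<phi>. \<phi> ` verts G' \<subseteq> verts G \<and>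
     (\<forall>u v. {u, v} \<in> edges G' \<longrightarrow> {\<phi> u, \<phi> v} \<in> edges G) \<and>
     (\<forall>v\<in>verts G. card {u \<in> verts G'. \<phi> u = v} \<le> s))"

end

theory Submission
  imports Defs Complex_Main "HOL-Library.FuncSet"
begin

text \<open>
  Only the second bound needs an idea, since a tree is a \<open>1\<close>-blowup of itself. Let \<open>H\<close> be a
  \<open>w\<close>-blowup of the tree \<open>T\<close>. The host is built from a bipartite incidence structure between
  points \<open>(r, p)\<close>, one part for each \<open>r < R\<close>, and hubs \<open>u\<close>, where the hub \<open>u\<close> is incident with
  one point \<open>(r, F u r)\<close> of each part. Every point is replaced by \<open>t\<close> vertices, and every hub by one
  vertex for each subset of the \<open>R * t\<close> vertices that replace its points; such a vertex is adjacent
  to the elements of its subset. So all adjacency patterns between a hub and its points are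
  present, at the price of \<open>2 ^ (R * t)\<close> vertices per hub.

  Fix a \<open>q\<close>-colouring. At a single hub, a variant of the Sauer-Shelah lemma (in Pajor's form,
  \<open>prod_shattered_ge\<close>) finds a colour \<open>i\<close>, a set \<open>J\<close> of \<open>d = 18 * (k + 2)\<close> of the \<open>R\<close> parts and a
  set \<open>A r\<close> of \<open>w\<close> vertices for each \<open>r \<in> J\<close> such that every subset of the union of these sets is
  cut out by some vertex of the hub all of whose edges into the subset have colour \<open>i\<close>. The sets
  \<open>A r\<close> found at different hubs of the same point may differ. There are only \<open>2 ^ t\<close> of them,
  however, and each point is on many more hubs on average, so after passing to the most popular colour
  and deleting hubs (\<open>dense_keys_subset\<close>) every remaining choice of a point with a set \<open>A\<close> occurs at
  \<open>d\<close> hubs at least. It therefore suffices to embed \<open>T\<close> into the incidence graph such that the sets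
  agree at every point that is used: the vertices of \<open>H\<close> over a point become the elements
  of the common set \<open>A\<close>, and those over a hub become the vertices that cut out the required
  neighbourhoods.

  For this to give an induced copy of \<open>H\<close>, the copy of \<open>T\<close> has to be induced in the incidence graph
  (edges of that graph between images of non-adjacent vertices of \<open>T\<close> would create
  unwanted edges). A random incidence structure is locally sparse: sets of at most \<open>6 * n\<close> vertices
  span at most \<open>5 / 4\<close> times as many edges (\<open>sparse_incidence_exists\<close>). In such a graph the tree is
  built vertex by vertex, in the manner of Friedman and Pippenger, keeping a potential function
  bounded from below for all small sets outside the current image (\<open>good_extend\<close>). The potential
  counts three units per vertex, pays two units for each edge that touches the set, and charges
  the set for every pending vertex that would lose its candidates. Its submodularity and integrality
  show that some continuation keeps the bound, and the bound itself leaves at most two vertices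
  of the whole graph with two neighbours in the image; avoiding these keeps the image
  induced.

  The comparison \<open>r_ind T q \<le> size_r_ind T q\<close> is elementary: a smallest induced subgraph that still
  has the arrow property is connected, and if it had fewer edges than vertices it would be a tree,
  whose edges can be coloured by the parity of their depth so that only stars are monochromatic.\<close>


section \<open>Trees, connectivity and cuts\<close>

text \<open>Connectivity in the form that is used below; unlike the definition by walks, it is directly
  inherited by isomorphic copies and directly contradicted by a partition of the vertex set.\<close>

definition cut_free :: "'a sgraph \<Rightarrow> bool" where
  "cut_free G \<longleftrightarrow> (\<forall>X. X \<noteq> {} \<longrightarrow> X \<subset> verts G \<longrightarrow>
     (\<exists>x\<in>X. \<exists>y\<in>verts G - X. {x, y} \<in> edges G))"

lemma fin_sgraph_no_loop: "fin_sgraph G \<Longrightarrow> {x, x} \<notin> edges G"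
  by (auto simp: fin_sgraph_def)

lemma fin_sgraph_edge_verts: "fin_sgraph G \<Longrightarrow> {x, y} \<in> edges G \<Longrightarrow> x \<in> verts G \<and> y \<in> verts G"
  by (auto simp: fin_sgraph_def)

lemma fin_sgraph_finite_edges:
  assumes "fin_sgraph G"
  shows "finite (edges G)"
proof -
  have "edges G \<subseteq> Pow (verts G)" using assms by (auto simp: fin_sgraph_def)
  then show ?thesis using assms by (auto simp: fin_sgraph_def intro: finite_subset)
qed

lemma successively_crossing:
  assumes "successively P xs" "xs \<noteq> []" "hd xs \<in> X" "last xs \<notin> X"
  shows "\<exists>x y. x \<in> X \<and> y \<in> set xs \<and> y \<notin> X \<and> P x y"
  using assms
proof (induction xs rule: induct_list012)
  case (3 a b xs)
  then show ?case by (cases "b \<in> X") auto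
qed auto

lemma connected_cut_free:
  assumes "is_connected G"
  shows "cut_free G"
  unfolding cut_free_def
proof (intro allI impI)
  fix X assume X: "X \<noteq> {}" "X \<subset> verts G"
  then obtain a b where ab: "a \<in> X" "b \<in> verts G" "b \<notin> X" "a \<in> verts G" by blast
  then obtain xs where "walk G xs" "hd xs = a" "last xs = b"
    using assms unfolding is_connected_def by blast
  then show "\<exists>x\<in>X. \<exists>y\<in>verts G - X. {x, y} \<in> edges G"
    using successively_crossing[of "\<lambda>u v. {u, v} \<in> edges G" xs X] ab by (auto simp: walk_def)
qed

text \<open>Maximal growth from a root reaches everything, because any proper part is left by some edge.\<close>

lemma cut_free_grow_induct:
  assumes "cut_free G" "finite (verts G)" "r \<in> verts G" "P {r}"
    and step: "\<And>X p t. X \<subseteq> verts G \<Longrightarrow> r \<in> X \<Longrightarrow> P X \<Longrightarrow> p \<in> X \<Longrightarrow> t \<in> verts G - X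
      \<Longrightarrow> {p, t} \<in> edges G \<Longrightarrow> P (insert t X)"
  shows "P (verts G)"
proof -
  have "X \<subseteq> verts G \<Longrightarrow> r \<in> X \<Longrightarrow> P X \<Longrightarrow> P (verts G)" for X
  proof (induction "card (verts G - X)" arbitrary: X rule: less_induct)
    case less
    show ?case
    proof (cases "X = verts G")
      case False
      then obtain p t where pt: "p \<in> X" "t \<in> verts G - X" "{p, t} \<in> edges G"
        using assms(1) less.prems unfolding cut_free_def by (metis empty_iff psubsetI)
      have "verts G - insert t X \<subset> verts G - X" using pt by auto
      then have "card (verts G - insert t X) < card (verts G - X)"
        using assms(2) by (intro psubset_card_mono) auto
      then show ?thesis using less.hyps[of "insert t X"] less.prems step[OF less.prems pt] pt by auto
    qed (use less in auto)
  qed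
  then show ?thesis using assms(3,4) by blast
qed

text \<open>A tree can be built by adding leaves. That the new vertex has a single neighbour in the part
  built so far holds because this part stays connected by paths inside it: a second neighbour would
  close a cycle. The induction therefore carries these paths along.\<close>

lemma tree_grow_induct:
  assumes T: "is_tree T" and r: "r \<in> verts T" and base: "P {r}"
    and step: "\<And>X p t. X \<subseteq> verts T \<Longrightarrow> P X \<Longrightarrow> p \<in> X \<Longrightarrow> t \<in> verts T - X
      \<Longrightarrow> {y \<in> X. {t, y} \<in> edges T} = {p} \<Longrightarrow> P (insert t X)"
  shows "P (verts T)"
proof -
  have fin: "fin_sgraph T" and conn: "is_connected T" and acyc: "\<And>xs. \<not> is_cycle T xs"
    using T by (auto simp: is_tree_def)
  define linked where "linked X \<longleftrightarrow> (\<forall>a\<in>X. \<forall>b\<in>X. \<exists>xs. walk T xs \<and> distinct xs \<and> set xs \<subseteq> X \<and>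
     hd xs = a \<and> last xs = b)" for X
  have "P (verts T) \<and> linked (verts T)"
  proof (rule cut_free_grow_induct[OF connected_cut_free[OF conn] _ r, where P = "\<lambda>X. P X \<and> linked X"])
    show "finite (verts T)" using fin by (simp add: fin_sgraph_def)
    have "walk T [r]" using r by (simp add: walk_def)
    then show "P {r} \<and> linked {r}" using base by (auto simp: linked_def intro!: exI[of _ "[r]"])
  next
    fix X p t
    assume X: "X \<subseteq> verts T" "P X \<and> linked X" and p: "p \<in> X" and t: "t \<in> verts T - X"
      and pt: "{p, t} \<in> edges T"
    have lk: "\<exists>xs. walk T xs \<and> distinct xs \<and> set xs \<subseteq> X \<and> hd xs = a \<and> last xs = b"
      if "a \<in> X" "b \<in> X" for a b using X(2) that by (auto simp: linked_def)
    have cons: "walk T (t # xs)" if "walk T xs" "hd xs = p" for xs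
      using that t pt by (cases xs) (auto simp: walk_def insert_commute)
    have uniq: "y = p" if y: "y \<in> X" "{t, y} \<in> edges T" for y
    proof (rule ccontr)
      assume "y \<noteq> p"
      obtain xs where xs: "walk T xs" "distinct xs" "set xs \<subseteq> X" "hd xs = p" "last xs = y"
        using lk[OF p y(1)] by blast
      have ne: "xs \<noteq> []" using xs by (auto simp: walk_def)
      have "length xs \<noteq> 1"
        using \<open>y \<noteq> p\<close> xs(4,5) by (cases xs) (auto simp: length_Suc_conv)
      then have "length xs \<ge> 2" using ne by (cases xs) (auto simp: Suc_le_eq)
      then have "is_cycle T (t # xs)"
        using cons[OF xs(1,4)] xs t y ne by (auto simp: is_cycle_def insert_commute)
      then show False using acyc by blast
    qed
    have tp: "{t, p} \<in> edges T" using pt by (simp add: insert_commute)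
    have "{y \<in> X. {t, y} \<in> edges T} = {p}" using tp p uniq by blast
    then have "P (insert t X)" using X p t by (intro step[of X p t]) auto
    moreover have "linked (insert t X)"
      unfolding linked_def
    proof (intro ballI)
      fix a b assume ab: "a \<in> insert t X" "b \<in> insert t X"
      have from_t: "\<exists>xs. walk T xs \<and> distinct xs \<and> set xs \<subseteq> insert t X \<and> hd xs = t \<and> last xs = b"
        if b: "b \<in> X" for b
      proof -
        obtain xs where xs: "walk T xs" "distinct xs" "set xs \<subseteq> X" "hd xs = p" "last xs = b"
          using lk[OF p b] by blast
        then show ?thesis using cons[OF xs(1,4)] t
          by (intro exI[of _ "t # xs"]) (auto simp: walk_def)
      qed
      have walk_rev: "walk T (rev xs)" if "walk T xs" for xs
        using that by (auto simp: walk_def insert_commute)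
      have to_t: "\<exists>xs. walk T xs \<and> distinct xs \<and> set xs \<subseteq> insert t X \<and> hd xs = a \<and> last xs = t"
        if a: "a \<in> X" for a
      proof -
        obtain xs where xs: "walk T xs" "distinct xs" "set xs \<subseteq> insert t X" "hd xs = t" "last xs = a"
          using from_t[OF a] by blast
        then show ?thesis using walk_rev[OF xs(1)]
          by (intro exI[of _ "rev xs"]) (auto simp: hd_rev last_rev)
      qed
      consider "a = t" "b = t" | "a = t" "b \<in> X" | "a \<in> X" "b = t" | "a \<in> X" "b \<in> X" using ab by auto
      then show "\<exists>xs. walk T xs \<and> distinct xs \<and> set xs \<subseteq> insert t X \<and> hd xs = a \<and> last xs = b"
      proof cases
        case 1
        then show ?thesis using t by (intro exI[of _ "[t]"]) (auto simp: walk_def)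
      next
        case 2
        then show ?thesis using from_t by blast
      next
        case 3
        then show ?thesis using to_t by blast
      next
        case 4
        then show ?thesis using lk[OF 4] by blast
      qed
    qed
    ultimately show "P (insert t X) \<and> linked (insert t X)" ..
  qed
  then show ?thesis ..
qed

lemma card_neighbours_le_max_degree:
  assumes G: "fin_sgraph G"
  shows "card {y \<in> verts G. {x, y} \<in> edges G} \<le> max_degree G"
proof (cases "x \<in> verts G")
  case True
  have "card {y \<in> verts G. {x, y} \<in> edges G} \<le> degree G x"
    unfolding degree_def
  proof (rule card_inj_on_le[where f = "\<lambda>y. {x, y}"])
    show "inj_on (\<lambda>y. {x, y}) {y \<in> verts G. {x, y} \<in> edges G}"
      by (auto simp: inj_on_def doubleton_eq_iff)
    show "finite {e \<in> edges G. x \<in> e}" using fin_sgraph_finite_edges[OF G] by simp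
  qed auto
  also have "\<dots> \<le> max_degree G"
    unfolding max_degree_def using G True by (intro Max_ge) (auto simp: fin_sgraph_def)
  finally show ?thesis .
next
  case False
  then have none: "{y \<in> verts G. {x, y} \<in> edges G} = {}" using fin_sgraph_edge_verts[OF G] by blast
  show ?thesis unfolding none by simp
qed

section \<open>Hosts with fewer vertices than edges\<close>

lemma induced_induced:
  "S \<subseteq> X \<Longrightarrow> induced_subgraph (induced_subgraph G X) S = induced_subgraph G S"
  by (auto simp: induced_subgraph_def)

lemma induced_verts: "verts (induced_subgraph G S) = S"
  by (simp add: induced_subgraph_def)

lemma induced_edges: "e \<in> edges (induced_subgraph G S) \<longleftrightarrow> e \<in> edges G \<and> e \<subseteq> S"
  by (simp add: induced_subgraph_def)

lemma fin_induced: "fin_sgraph G \<Longrightarrow> S \<subseteq> verts G \<Longrightarrow> fin_sgraph (induced_subgraph G S)"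
  by (auto simp: fin_sgraph_def induced_subgraph_def intro: finite_subset)

lemma induced_all:
  assumes "fin_sgraph G"
  shows "induced_subgraph G (verts G) = G"
proof -
  have "{e \<in> edges G. e \<subseteq> verts G} = edges G" using assms by (auto simp: fin_sgraph_def)
  then show ?thesis by (simp add: induced_subgraph_def)
qed

lemma cut_free_iso:
  assumes "graph_iso G K" "cut_free G"
  shows "cut_free K"
  unfolding cut_free_def
proof (intro allI impI)
  obtain f where f: "bij_betw f (verts G) (verts K)"
    "\<And>u v. u \<in> verts G \<Longrightarrow> v \<in> verts G \<Longrightarrow> {u, v} \<in> edges G \<longleftrightarrow> {f u, f v} \<in> edges K"
    using assms(1) unfolding graph_iso_def by blast
  have img: "f ` verts G = verts K" using f(1) by (simp add: bij_betw_def)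
  fix X assume X: "X \<noteq> {}" "X \<subset> verts K"
  define X' where "X' = {u \<in> verts G. f u \<in> X}"
  obtain a where a: "a \<in> X" using X(1) by blast
  then have "a \<in> f ` verts G" unfolding img using X(2) by blast
  then have "X' \<noteq> {}" using a unfolding X'_def by blast
  moreover have "X' \<subset> verts G"
  proof -
    obtain b where b: "b \<in> verts K" "b \<notin> X" using X(2) by blast
    then have "b \<in> f ` verts G" unfolding img by blast
    then obtain b' where "b' \<in> verts G" "f b' = b" by blast
    then have "b' \<in> verts G" "b' \<notin> X'" using b(2) by (simp_all add: X'_def)
    moreover have "X' \<subseteq> verts G" by (simp add: X'_def)
    ultimately show ?thesis by blast
  qed
  ultimately obtain x y where xy: "x \<in> X'" "y \<in> verts G - X'" "{x, y} \<in> edges G"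
    using assms(2)[unfolded cut_free_def, rule_format, of X'] by blast
  then have V: "x \<in> verts G" "y \<in> verts G" "f x \<in> X" "f y \<notin> X" by (simp_all add: X'_def)
  then have "f y \<in> verts K - X" unfolding img[symmetric] by simp
  moreover have "{f x, f y} \<in> edges K" using f(2)[OF V(1,2)] xy(3) by simp
  ultimately show "\<exists>x\<in>X. \<exists>y\<in>verts K - X. {x, y} \<in> edges K" using V(3) by blast
qed

lemma is_star_iso:
  assumes "graph_iso G K" "is_star K" "fin_sgraph G"
  shows "is_star G"
proof -
  obtain f where f: "bij_betw f (verts G) (verts K)"
    "\<And>u v. u \<in> verts G \<Longrightarrow> v \<in> verts G \<Longrightarrow> {u, v} \<in> edges G \<longleftrightarrow> {f u, f v} \<in> edges K"
    using assms(1) unfolding graph_iso_def by blast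
  obtain c where c: "c \<in> verts K" "\<And>e. e \<in> edges K \<Longrightarrow> c \<in> e" using assms(2) unfolding is_star_def by blast
  have "c \<in> f ` verts G" using c(1) f(1) by (simp add: bij_betw_def)
  then obtain x where x: "x \<in> verts G" "f x = c" by blast
  have "x \<in> e" if e: "e \<in> edges G" for e
  proof -
    have "card e = 2" using e assms(3) by (simp add: fin_sgraph_def)
    then obtain a b where ab: "e = {a, b}" by (meson card_2_iff)
    have abV: "a \<in> verts G" "b \<in> verts G" using e ab assms(3) by (auto simp: fin_sgraph_def)
    have "f x \<in> {f a, f b}" using c(2) f(2)[OF abV] e ab x by blast
    then show ?thesis using f(1) abV x(1) ab by (auto simp: bij_betw_def inj_on_def)
  qed
  then show ?thesis unfolding is_star_def using x(1) by blast
qed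

text \<open>A spanning tree, given by the parent \<open>p v\<close> and the depth \<open>d v\<close> of each vertex.\<close>

lemma rooted_spanning_parents:
  assumes "cut_free G" "finite (verts G)" "r \<in> verts G"
  obtains p :: "'a \<Rightarrow> 'a" and d :: "'a \<Rightarrow> nat"
  where "\<And>v. v \<in> verts G - {r} \<Longrightarrow> p v \<in> verts G \<and> {v, p v} \<in> edges (G :: 'a sgraph) \<and> d v = Suc (d (p v))"
proof -
  define P where "P X \<longleftrightarrow> (\<exists>p d. \<forall>v\<in>X - {r}. p v \<in> X \<and> {v, p v} \<in> edges G \<and> (d v :: nat) = Suc (d (p v)))" for X
  have "P (verts G)"
  proof (rule cut_free_grow_induct[OF assms])
    show "P {r}" by (simp add: P_def)
    fix X x t assume X: "P X" "x \<in> X" "t \<in> verts G - X" "{x, t} \<in> edges G"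
    obtain p d where pd: "\<And>v. v \<in> X - {r} \<Longrightarrow> p v \<in> X \<and> {v, p v} \<in> edges G \<and> (d v :: nat) = Suc (d (p v))"
      using X(1) unfolding P_def by blast
    have tx: "{t, x} \<in> edges G" using X(4) by (simp add: insert_commute)
    show "P (insert t X)"
      unfolding P_def
    proof (intro exI[of _ "p(t := x)"] exI[of _ "d(t := Suc (d x))"] ballI)
      fix v assume v: "v \<in> insert t X - {r}"
      show "(p(t := x)) v \<in> insert t X \<and> {v, (p(t := x)) v} \<in> edges G \<and>
          (d(t := Suc (d x))) v = Suc ((d(t := Suc (d x))) ((p(t := x)) v))"
      proof (cases "v = t")
        case True
        then show ?thesis using X tx by auto
      next
        case False
        then have "v \<in> X - {r}" using v by auto
        then show ?thesis using pd[of v] False X(3) by auto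
      qed
    qed
  qed
  then obtain p d where "\<And>v. v \<in> verts G - {r} \<Longrightarrow> p v \<in> verts G \<and> {v, p v} \<in> edges G \<and> (d v :: nat) = Suc (d (p v))"
    unfolding P_def by blast
  then show ?thesis by (rule that)
qed

text \<open>If there are fewer edges than vertices, the parent edges are all the edges. Colour such an edge by
  the parity of the depth of its lower end. Two edges of the same colour that share a
  vertex then share their upper end, so a connected monochromatic subgraph is a star. Two colours
  suffice for this, which is where \<open>q \<ge> 2\<close> enters.\<close>

lemma tree_host_star:
  fixes G :: "'a sgraph" and T :: "'b sgraph"
  assumes G: "fin_sgraph G" "cut_free G" "card (edges G) < card (verts G)"
    and arrows: "ind_arrows G T q" and q: "q \<ge> 2" and T: "fin_sgraph T" "is_connected T"
  shows "is_star T"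
proof -
  have finV: "finite (verts G)" using G(1) by (simp add: fin_sgraph_def)
  have finE: "finite (edges G)" by (rule fin_sgraph_finite_edges[OF G(1)])
  have "verts G \<noteq> {}" using G(3) by auto
  then obtain r where r: "r \<in> verts G" by blast
  obtain p :: "'a \<Rightarrow> 'a" and d :: "'a \<Rightarrow> nat"
    where pd: "\<And>v. v \<in> verts G - {r} \<Longrightarrow> p v \<in> verts G \<and> {v, p v} \<in> edges G \<and> d v = Suc (d (p v))"
    using rooted_spanning_parents[OF G(2) finV r] by blast
  have inj: "inj_on (\<lambda>v. {v, p v}) (verts G - {r})"
  proof (rule inj_onI)
    fix v v' assume v: "v \<in> verts G - {r}" "v' \<in> verts G - {r}" "{v, p v} = {v', p v'}"
    show "v = v'"
    proof (rule ccontr)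
      assume "v \<noteq> v'"
      then have "v = p v'" "v' = p v" using v(3) by (auto simp: doubleton_eq_iff)
      then show False using pd[OF v(1)] pd[OF v(2)] by simp
    qed
  qed
  have "(\<lambda>v. {v, p v}) ` (verts G - {r}) = edges G"
  proof (rule card_seteq[OF finE])
    show "(\<lambda>v. {v, p v}) ` (verts G - {r}) \<subseteq> edges G" using pd by blast
    show "card (edges G) \<le> card ((\<lambda>v. {v, p v}) ` (verts G - {r}))"
      using G(3) card_image[OF inj] r finV by simp
  qed
  then have edge: "\<exists>v\<in>verts G - {r}. e = {v, p v}" if "e \<in> edges G" for e using that by blast
  \<comment> \<open>The larger depth on an edge is that of its lower end.\<close>
  define c where "c e = Max (d ` e) mod 2" for e
  have c_edge: "c {v, p v} = d v mod 2" if "v \<in> verts G - {r}" for v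
    using pd[OF that] by (simp add: c_def)
  have "c e < q" for e
  proof -
    have "c e < 2" by (simp add: c_def)
    then show ?thesis using q by linarith
  qed
  then have "c ` edges G \<subseteq> {..<q}" by blast
  then obtain S i where S: "S \<subseteq> verts G" "graph_iso T (induced_subgraph G S)"
    and mono: "\<And>e. e \<in> edges (induced_subgraph G S) \<Longrightarrow> c e = i"
    using arrows[unfolded ind_arrows_def, rule_format, of c] by blast
  let ?K = "induced_subgraph G S"
  have cut: "cut_free ?K" using cut_free_iso[OF S(2)] connected_cut_free[OF T(2)] by blast
  have K_edge: "\<exists>v\<in>verts G - {r}. e = {v, p v} \<and> d v mod 2 = i" if e: "e \<in> edges ?K" for e
  proof -
    obtain v where v: "v \<in> verts G - {r}" "e = {v, p v}" using edge e by (auto simp: induced_edges)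
    then show ?thesis using mono[OF e] c_edge by auto
  qed
  have "is_star ?K"
  proof (cases "edges ?K = {}")
    case True
    have "verts T \<noteq> {}" using T(2) by (simp add: is_connected_def)
    then have "S \<noteq> {}" using S(2) unfolding graph_iso_def induced_verts by (metis bij_betw_empty2)
    then show ?thesis using True by (auto simp: is_star_def induced_verts)
  next
    case False
    then obtain e0 where e0: "e0 \<in> edges ?K" by blast
    then obtain v0 where v0: "v0 \<in> verts G - {r}" "e0 = {v0, p v0}" "d v0 mod 2 = i" using K_edge by blast
    define a where "a = p v0"
    have aS: "a \<in> S" using e0 v0(2) by (auto simp: induced_edges a_def)
    have parity: "d x mod 2 \<noteq> d y mod 2" if "d x = Suc (d y)" for x y using that by presburger
    have da: "d a mod 2 \<noteq> i" using parity[of v0 a] pd[OF v0(1)] v0(3) by (simp add: a_def)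
    \<comment> \<open>The star with centre \<open>a\<close>; no edge of the copy leaves it.\<close>
    define X where "X = insert a {z \<in> S. p z = a \<and> d z mod 2 = i}"
    have "X = S"
    proof (rule ccontr)
      assume "X \<noteq> S"
      then have "X \<subset> verts ?K" using aS by (auto simp: X_def induced_verts)
      moreover have "X \<noteq> {}" by (simp add: X_def)
      ultimately obtain x y where xy: "x \<in> X" "y \<in> S - X" "{x, y} \<in> edges ?K"
        using cut unfolding cut_free_def induced_verts by meson
      obtain v where v: "v \<in> verts G - {r}" "{x, y} = {v, p v}" "d v mod 2 = i" using K_edge[OF xy(3)] by blast
      consider "v = x" "p v = y" | "v = y" "p v = x" using v(2) by (auto simp: doubleton_eq_iff)
      then show False
      proof cases
        case 1
        then have "x \<noteq> a" using v(3) da by auto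
        then have "y = a" using xy(1) 1 by (auto simp: X_def)
        then show False using xy(2) by (simp add: X_def)
      next
        case 2
        then have "d x mod 2 \<noteq> i" using parity[of v x] pd[OF v(1)] v(3) by simp
        then have "x = a" using xy(1) by (auto simp: X_def)
        then show False using xy(2) 2 v(3) by (auto simp: X_def)
      qed
    qed
    have "a \<in> e" if e: "e \<in> edges ?K" for e
    proof -
      obtain v where v: "v \<in> verts G - {r}" "e = {v, p v}" "d v mod 2 = i" using K_edge[OF e] by blast
      have "v \<in> X" using e v(2) \<open>X = S\<close> by (auto simp: induced_edges)
      moreover have "v \<noteq> a" using v(3) da by auto
      ultimately show ?thesis using v(2) by (auto simp: X_def)
    qed
    then show ?thesis unfolding is_star_def using aS by (auto simp: induced_verts)
  qed
  then show ?thesis using is_star_iso[OF S(2) _ T(1)] by blast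
qed

lemma not_arrowsD:
  assumes "\<not> ind_arrows (induced_subgraph G X) T q"
  shows "\<exists>c. c ` edges (induced_subgraph G X) \<subseteq> {..<q} \<and>
    (\<forall>S i. S \<subseteq> X \<longrightarrow> graph_iso T (induced_subgraph G S) \<longrightarrow> (\<exists>e\<in>edges (induced_subgraph G S). c e \<noteq> i))"
proof -
  obtain c where c: "c ` edges (induced_subgraph G X) \<subseteq> {..<q}"
    and none: "\<not> (\<exists>S\<subseteq>X. graph_iso T (induced_subgraph (induced_subgraph G X) S) \<and>
       (\<exists>i. \<forall>e\<in>edges (induced_subgraph (induced_subgraph G X) S). c e = i))"
    using assms[unfolded ind_arrows_def induced_verts not_all not_imp] by (elim exE conjE) (rule that)
  have "\<exists>e\<in>edges (induced_subgraph G S). c e \<noteq> i"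
    if S: "S \<subseteq> X" "graph_iso T (induced_subgraph G S)" for S i
  proof (rule ccontr)
    assume "\<not> (\<exists>e\<in>edges (induced_subgraph G S). c e \<noteq> i)"
    then have all: "\<forall>e\<in>edges (induced_subgraph (induced_subgraph G X) S). c e = i"
      unfolding induced_induced[OF S(1)] by simp
    have iso: "graph_iso T (induced_subgraph (induced_subgraph G X) S)"
      unfolding induced_induced[OF S(1)] by (rule S(2))
    have ex: "\<exists>i. \<forall>e\<in>edges (induced_subgraph (induced_subgraph G X) S). c e = i"
      using all by (rule exI[where x = i])
    show False by (rule notE[OF none], rule exI[where x = S], intro conjI S(1) iso ex)
  qed
  then show ?thesis by (intro exI[of _ c] conjI allI impI c)
qed

text \<open>Suppose that no edge joins \<open>X\<close> to the rest of \<open>S\<close>. By minimality both sides have colourings without a monochromatic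
  copy, and together these form such a colouring of the whole, because a copy of the connected
  \<open>T\<close> lies on one side.\<close>

lemma minimal_host_cut_free:
  fixes G :: "'a sgraph" and T :: "'b sgraph"
  assumes G: "fin_sgraph G" and T: "is_connected T"
    and arrows: "ind_arrows (induced_subgraph G S) T q"
    and minimal: "\<And>X. X \<subset> S \<Longrightarrow> \<not> ind_arrows (induced_subgraph G X) T q"
  shows "cut_free (induced_subgraph G S)"
  unfolding cut_free_def induced_verts
proof (intro allI impI, rule ccontr)
  let ?G = "induced_subgraph G S"
  fix X assume X: "X \<noteq> {}" "X \<subset> S" and nc: "\<not> (\<exists>x\<in>X. \<exists>y\<in>S - X. {x, y} \<in> edges ?G)"
  have nocross: "{x, y} \<notin> edges ?G" if "x \<in> X" "y \<in> S - X" for x y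
  proof
    assume "{x, y} \<in> edges ?G"
    then have "\<exists>y\<in>S - X. {x, y} \<in> edges ?G" using that(2) by (rule bexI)
    then have "\<exists>x\<in>X. \<exists>y\<in>S - X. {x, y} \<in> edges ?G" using that(1) by (rule bexI)
    then show False using nc by (rule notE[rotated])
  qed
  have "S - X \<subset> S" using X by blast
  obtain c2 where c2: "c2 ` edges (induced_subgraph G (S - X)) \<subseteq> {..<q} \<and>
    (\<forall>S0 i. S0 \<subseteq> S - X \<longrightarrow> graph_iso T (induced_subgraph G S0) \<longrightarrow>
       (\<exists>e\<in>edges (induced_subgraph G S0). c2 e \<noteq> i))"
    using not_arrowsD[OF minimal[OF \<open>S - X \<subset> S\<close>]] by (elim exE)
  note c2 = c2[THEN conjunct1] c2[THEN conjunct2, rule_format]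
  obtain c1 where c1: "c1 ` edges (induced_subgraph G (X)) \<subseteq> {..<q} \<and>
    (\<forall>S0 i. S0 \<subseteq> X \<longrightarrow> graph_iso T (induced_subgraph G S0) \<longrightarrow>
       (\<exists>e\<in>edges (induced_subgraph G S0). c1 e \<noteq> i))"
    using not_arrowsD[OF minimal[OF X(2)]] by (elim exE)
  note c1 = c1[THEN conjunct1] c1[THEN conjunct2, rule_format]
  define c where "c e = (if e \<subseteq> X then c1 e else c2 e)" for e
  have split: "e \<subseteq> X \<or> e \<subseteq> S - X" if e: "e \<in> edges ?G" for e
  proof -
    have "card e = 2" "e \<subseteq> S" using e G by (auto simp: induced_edges fin_sgraph_def)
    then obtain x y where xy: "e = {x, y}" "x \<in> S" "y \<in> S" by (auto simp: card_2_iff)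
    have e': "{y, x} \<in> edges ?G" "{x, y} \<in> edges ?G" using e xy(1) by (auto simp: insert_commute)
    show ?thesis using nocross[of x y] nocross[of y x] e' xy by blast
  qed
  have "c ` edges ?G \<subseteq> {..<q}"
  proof
    fix k assume "k \<in> c ` edges ?G"
    then obtain e where e: "e \<in> edges ?G" "k = c e" by blast
    show "k \<in> {..<q}"
    proof (cases "e \<subseteq> X")
      case True
      then have "e \<in> edges (induced_subgraph G X)" using e(1) by (simp add: induced_edges)
      then show ?thesis using c1(1) True e(2) by (auto simp: c_def)
    next
      case False
      then have "e \<in> edges (induced_subgraph G (S - X))" using split[OF e(1)] e(1) by (simp add: induced_edges)
      then show ?thesis using c2(1) False e(2) by (auto simp: c_def)
    qed
  qed
  then obtain S0 i where S0: "S0 \<subseteq> S" "graph_iso T (induced_subgraph ?G S0)"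
    and mono: "\<And>e. e \<in> edges (induced_subgraph ?G S0) \<Longrightarrow> c e = i"
    using arrows[unfolded ind_arrows_def induced_verts, rule_format, of c] by blast
  note S0' = S0(2)[unfolded induced_induced[OF S0(1)]] and mono' = mono[unfolded induced_induced[OF S0(1)]]
  have cut: "cut_free (induced_subgraph G S0)" using cut_free_iso[OF S0'] connected_cut_free[OF T] by blast
  show False
  proof (cases "S0 \<subseteq> X")
    case True
    then obtain e where e: "e \<in> edges (induced_subgraph G S0)" "c1 e \<noteq> i" using c1(2)[OF True S0'] by blast
    then have "e \<subseteq> X" using True by (auto simp: induced_edges)
    then show False using mono'[OF e(1)] e(2) by (simp add: c_def)
  next
    case out: False
    show False
    proof (cases "S0 \<subseteq> S - X")
      case True
      then obtain e where e: "e \<in> edges (induced_subgraph G S0)" "c2 e \<noteq> i" using c2(2)[OF True S0'] by blast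
      have "card e = 2" using e(1) G by (simp add: induced_edges fin_sgraph_def)
      then have "e \<noteq> {}" by auto
      moreover have "e \<subseteq> S - X" using e(1) True by (auto simp: induced_edges)
      ultimately have "\<not> e \<subseteq> X" by blast
      then show False using mono'[OF e(1)] e(2) by (simp add: c_def)
    next
      case False
      have "S0 \<inter> X \<noteq> {}" "S0 \<inter> X \<subset> S0" using False out S0(1) by auto
      then obtain x y where xy: "x \<in> S0 \<inter> X" "y \<in> S0 - S0 \<inter> X" "{x, y} \<in> edges (induced_subgraph G S0)"
        using cut unfolding cut_free_def induced_verts by meson
      then have "{x, y} \<in> edges ?G" using S0(1) by (auto simp: induced_edges)
      then show False using nocross[of x y] xy S0(1) by auto
    qed
  qed
qed

lemma r_ind_le_size_r_ind:
  assumes T: "fin_sgraph T" "is_connected T" "\<not> is_star T" and q: "q \<ge> 2"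
  shows "r_ind T q \<le> size_r_ind T q"
  unfolding size_r_ind_def
proof (rule INF_greatest)
  fix G :: "nat sgraph" assume "G \<in> {G. fin_sgraph G \<and> ind_arrows G T q}"
  then have G: "fin_sgraph G" "ind_arrows G T q" by auto
  define P where "P S \<longleftrightarrow> S \<subseteq> verts G \<and> ind_arrows (induced_subgraph G S) T q" for S
  have "P (verts G)" using G induced_all[OF G(1)] by (simp add: P_def)
  then obtain S where S: "P S" "\<And>X. P X \<Longrightarrow> card S \<le> card X"
    using ex_has_least_nat[of P "verts G" card] by blast
  let ?G = "induced_subgraph G S"
  have SV: "S \<subseteq> verts G" "ind_arrows ?G T q" using S(1) by (auto simp: P_def)
  have finS: "finite S" using SV(1) G(1) by (auto simp: fin_sgraph_def intro: finite_subset)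
  have "\<not> ind_arrows (induced_subgraph G X) T q" if X: "X \<subset> S" for X
  proof
    assume "ind_arrows (induced_subgraph G X) T q"
    then have "P X" using X SV(1) by (auto simp: P_def)
    then show False using S(2)[of X] psubset_card_mono[OF finS X] by simp
  qed
  then have cut: "cut_free ?G" using minimal_host_cut_free[OF G(1) T(2) SV(2)] by blast
  have finG: "fin_sgraph ?G" by (rule fin_induced[OF G(1) SV(1)])
  have "\<not> card (edges ?G) < card (verts ?G)"
    using tree_host_star[OF finG cut _ SV(2) q T(1,2)] T(3) by blast
  then have "card (verts ?G) \<le> card (edges ?G)" by simp
  also have "\<dots> \<le> card (edges G)"
    using fin_sgraph_finite_edges[OF G(1)] by (intro card_mono) (auto simp: induced_edges)
  finally have le: "enat (card (verts ?G)) \<le> enat (card (edges G))" by simp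
  have "r_ind T q \<le> enat (card (verts ?G))"
    unfolding r_ind_def using finG SV(2) by (intro INF_lower) simp
  then show "r_ind T q \<le> enat (card (edges G))" using le by (rule order_trans)
qed

section \<open>Shattering in coloured cubes\<close>

text \<open>The sets of the family cut out all subsets \<open>Z\<close> of \<open>A\<close>, moreover with all elements of \<open>Z\<close> seen in
  colour \<open>i\<close>; nothing is required about the colours of elements outside \<open>A\<close>.\<close>

definition shattered :: "('y set \<Rightarrow> 'y \<Rightarrow> nat) \<Rightarrow> nat \<Rightarrow> 'y set set \<Rightarrow> 'y set \<Rightarrow> bool" where
  "shattered col i \<F> A \<longleftrightarrow> (\<forall>Z\<subseteq>A. \<exists>\<beta>\<in>\<F>. \<beta> \<inter> A = Z \<and> (\<forall>y\<in>Z. col \<beta> y = i))"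

lemma shattered_mono: "shattered col i \<F> A \<Longrightarrow> \<F> \<subseteq> \<G> \<Longrightarrow> shattered col i \<G> A"
  unfolding shattered_def by (meson subsetD)

lemma shattered_subset:
  assumes "shattered col i \<F> A" "B \<subseteq> A"
  shows "shattered col i \<F> B"
  unfolding shattered_def
proof (intro allI impI)
  fix Z assume "Z \<subseteq> B"
  then have "Z \<subseteq> A" using assms by auto
  then obtain \<beta> where "\<beta> \<in> \<F>" "\<beta> \<inter> A = Z" "\<forall>y\<in>Z. col \<beta> y = i"
    using assms(1) unfolding shattered_def by blast
  then show "\<exists>\<beta>\<in>\<F>. \<beta> \<inter> B = Z \<and> (\<forall>y\<in>Z. col \<beta> y = i)"
    using assms(2) \<open>Z \<subseteq> B\<close> by (intro bexI[of _ \<beta>]) auto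
qed

text \<open>The step that enlarges shattered sets in Pajor's argument: the new element is absent
  from the members of one family, and present in colour \<open>i\<close> in the members of the other.\<close>

lemma shattered_insert:
  assumes "shattered col i \<F>0 A" "shattered col i \<F>1 A" "y \<notin> A"
    and "\<And>\<beta>. \<beta> \<in> \<F>0 \<Longrightarrow> y \<notin> \<beta>" "\<And>\<beta>. \<beta> \<in> \<F>1 \<Longrightarrow> y \<in> \<beta> \<and> col \<beta> y = i"
  shows "shattered col i (\<F>0 \<union> \<F>1) (insert y A)"
  unfolding shattered_def
proof (intro allI impI)
  fix Z assume Z: "Z \<subseteq> insert y A"
  show "\<exists>\<beta>\<in>\<F>0 \<union> \<F>1. \<beta> \<inter> insert y A = Z \<and> (\<forall>y\<in>Z. col \<beta> y = i)"
  proof (cases "y \<in> Z")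
    case True
    obtain \<beta> where \<beta>: "\<beta> \<in> \<F>1" "\<beta> \<inter> A = Z - {y}" "\<forall>z\<in>Z - {y}. col \<beta> z = i"
      using assms(2) Z unfolding shattered_def by (metis Diff_subset_conv insert_is_Un)
    then show ?thesis using assms(5)[OF \<beta>(1)] True by (intro bexI[of _ \<beta>]) auto
  next
    case False
    obtain \<beta> where \<beta>: "\<beta> \<in> \<F>0" "\<beta> \<inter> A = Z" "\<forall>z\<in>Z. col \<beta> z = i"
      using assms(1) Z False unfolding shattered_def by (metis subset_insert)
    then show ?thesis using assms(4)[OF \<beta>(1)] by (intro bexI[of _ \<beta>]) auto
  qed
qed

text \<open>Pajor's strengthening of the Sauer-Shelah lemma says that a family shatters at least as many sets as
  it has members. Here the members come with colourings of their elements, and one gets a lower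
  bound for the product of the numbers of shattered sets over all colours. Split the family by an
  element \<open>y\<close>: the members that avoid it, and for each colour \<open>j\<close> those that contain it in colour
  \<open>j\<close>. For fixed \<open>j\<close> the counts for the two parts add up in the factor of colour \<open>j\<close>, and they are
  dominated in the other factors. Only one \<open>j\<close> can be used at a time; averaging over the \<open>q\<close> choices
  is paid for by the weight \<open>1 / q\<close> per element.\<close>

lemma prod_shattered_ge:
  fixes col :: "'y set \<Rightarrow> 'y \<Rightarrow> nat"
  assumes "finite Y" "finite \<F>" "inj_on (\<lambda>\<beta>. \<beta> \<inter> Y) \<F>" "q \<ge> 1"
    and "\<And>\<beta> y. \<beta> \<in> \<F> \<Longrightarrow> y \<in> \<beta> \<Longrightarrow> y \<in> Y \<Longrightarrow> col \<beta> y < q"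
  shows "(\<Sum>\<beta>\<in>\<F>. (1 / real q) ^ card (\<beta> \<inter> Y))
    \<le> (\<Prod>i<q. real (card {A. A \<subseteq> Y \<and> shattered col i \<F> A}))"
  using assms(1,2,3,5)
proof (induction Y arbitrary: \<F> rule: finite_induct)
  case empty
  then have "card \<F> \<le> 1"
    by (intro card_le_Suc0_iff_eq[THEN iffD2, simplified One_nat_def[symmetric]]) (auto simp: inj_on_def)
  show ?case
  proof (cases "\<F> = {}")
    case True
    then show ?thesis by (simp add: prod_nonneg)
  next
    case False
    then have "{A. A \<subseteq> {} \<and> shattered col i \<F> A} = {{}}" for i
      by (auto simp: shattered_def)
    then show ?thesis using \<open>card \<F> \<le> 1\<close> by simp
  qed
next
  case (insert y Y)
  define Sh where "Sh G i = {A. A \<subseteq> Y \<and> shattered col i G A}" for G i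
  define Sh' where "Sh' i = {A. A \<subseteq> insert y Y \<and> shattered col i \<F> A}" for i
  define F0 where "F0 = {\<beta>\<in>\<F>. y \<notin> \<beta>}"
  define F where "F j = {\<beta>\<in>\<F>. y \<in> \<beta> \<and> col \<beta> y = j}" for j
  define W where "W G = (\<Sum>\<beta>\<in>G. (1 / real q) ^ card (\<beta> \<inter> Y))" for G
  have fin: "finite F0" "finite (F j)" for j
    using insert.prems by (auto simp: F0_def F_def)
  have finSh: "finite (Sh G i)" for G i
    using insert.hyps by (auto simp: Sh_def)
  have finSh': "finite (Sh' i)" for i
    using insert.hyps by (auto simp: Sh'_def)
  have IH0: "W F0 \<le> (\<Prod>i<q. real (card (Sh F0 i)))"
    unfolding W_def Sh_def
  proof (intro insert.IH fin)
    show "inj_on (\<lambda>\<beta>. \<beta> \<inter> Y) F0"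
    proof (rule inj_onI)
      fix a b assume "a \<in> F0" "b \<in> F0" "a \<inter> Y = b \<inter> Y"
      then show "a = b" using insert.prems(2) by (auto simp: F0_def inj_on_def)
    qed
  qed (use insert.prems in \<open>auto simp: F0_def\<close>)
  have IH1: "W (F j) \<le> (\<Prod>i<q. real (card (Sh (F j) i)))" for j
    unfolding W_def Sh_def
  proof (intro insert.IH fin)
    show "inj_on (\<lambda>\<beta>. \<beta> \<inter> Y) (F j)"
    proof (rule inj_onI)
      fix a b assume "a \<in> F j" "b \<in> F j" "a \<inter> Y = b \<inter> Y"
      then show "a = b" using insert.prems(2) by (auto simp: F_def inj_on_def)
    qed
  qed (use insert.prems in \<open>auto simp: F_def\<close>)
  have Wnn: "W G \<ge> 0" for G by (auto simp: W_def intro: sum_nonneg)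
  have sub0: "Sh F0 i \<subseteq> Sh' i" for i
    by (auto simp: Sh_def Sh'_def F0_def elim: shattered_mono)
  have sub1: "Sh (F j) i \<subseteq> Sh' i" for i j
    by (auto simp: Sh_def Sh'_def F_def elim: shattered_mono)
  have step: "W F0 + W (F j) \<le> (\<Prod>i<q. real (card (Sh' i)))" if j: "j < q" for j
  proof -
    have ins: "insert y ` (Sh F0 j \<inter> Sh (F j) j) \<subseteq> Sh' j"
    proof
      fix A assume "A \<in> insert y ` (Sh F0 j \<inter> Sh (F j) j)"
      then obtain B where B: "A = insert y B" "B \<in> Sh F0 j" "B \<in> Sh (F j) j" by auto
      have "shattered col j (F0 \<union> F j) (insert y B)"
        using B insert.hyps by (intro shattered_insert) (auto simp: Sh_def F0_def F_def)
      then have "shattered col j \<F> (insert y B)"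
        by (rule shattered_mono) (auto simp: F0_def F_def)
      then show "A \<in> Sh' j" using B by (auto simp: Sh_def Sh'_def)
    qed
    have "card (Sh F0 j) + card (Sh (F j) j)
        = card (Sh F0 j \<union> Sh (F j) j) + card (Sh F0 j \<inter> Sh (F j) j)"
      by (rule card_Un_Int[OF finSh finSh])
    also have "card (Sh F0 j \<inter> Sh (F j) j) = card (insert y ` (Sh F0 j \<inter> Sh (F j) j))"
      using insert.hyps by (intro card_image[symmetric]) (auto simp: inj_on_def Sh_def)
    also have "card (Sh F0 j \<union> Sh (F j) j) + \<dots>
        = card ((Sh F0 j \<union> Sh (F j) j) \<union> insert y ` (Sh F0 j \<inter> Sh (F j) j))"
      using insert.hyps finSh by (intro card_Un_disjoint[symmetric]) (auto simp: Sh_def)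
    also have "\<dots> \<le> card (Sh' j)"
      using sub0 sub1 ins finSh' by (intro card_mono) auto
    finally have main: "real (card (Sh F0 j)) + real (card (Sh (F j) j)) \<le> real (card (Sh' j))"
      by linarith
    define P where "P = (\<Prod>i\<in>{..<q} - {j}. real (card (Sh' i)))"
    have split: "(\<Prod>i<q. f i) = f j * (\<Prod>i\<in>{..<q} - {j}. f i)" for f :: "nat \<Rightarrow> real"
      using j by (intro prod.remove) auto
    have "W F0 \<le> real (card (Sh F0 j)) * P"
      using IH0 unfolding split P_def
      by (elim order_trans) (intro mult_left_mono prod_mono, use sub0 finSh' in \<open>auto intro!: card_mono\<close>)
    moreover have "W (F j) \<le> real (card (Sh (F j) j)) * P"
      using IH1[of j] unfolding split P_def
      by (elim order_trans) (intro mult_left_mono prod_mono, use sub1 finSh' in \<open>auto intro!: card_mono\<close>)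
    ultimately have "W F0 + W (F j) \<le> (real (card (Sh F0 j)) + real (card (Sh (F j) j))) * P"
      by (simp add: distrib_right)
    also have "\<dots> \<le> real (card (Sh' j)) * P"
      using main by (intro mult_right_mono) (auto simp: P_def intro: prod_nonneg)
    finally show ?thesis unfolding split P_def .
  qed
  have part: "\<F> = F0 \<union> (\<Union>j<q. F j)"
    using insert.prems(3) by (auto simp: F0_def F_def)
  have "(\<Sum>\<beta>\<in>\<F>. (1 / real q) ^ card (\<beta> \<inter> insert y Y))
      = (\<Sum>\<beta>\<in>F0. (1 / real q) ^ card (\<beta> \<inter> insert y Y))
        + (\<Sum>j<q. \<Sum>\<beta>\<in>F j. (1 / real q) ^ card (\<beta> \<inter> insert y Y))"
  proof -
    have "(\<Sum>\<beta>\<in>(\<Union>j<q. F j). (1 / real q) ^ card (\<beta> \<inter> insert y Y))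
      = (\<Sum>j<q. \<Sum>\<beta>\<in>F j. (1 / real q) ^ card (\<beta> \<inter> insert y Y))"
      using fin by (intro sum.UNION_disjoint) (auto simp: F_def)
    then show ?thesis
      using fin by (subst part, subst sum.union_disjoint) (auto simp: F_def F0_def)
  qed
  also have "(\<Sum>\<beta>\<in>F0. (1 / real q) ^ card (\<beta> \<inter> insert y Y)) = W F0"
    unfolding W_def by (intro sum.cong) (auto simp: F0_def)
  also have "(\<Sum>j<q. \<Sum>\<beta>\<in>F j. (1 / real q) ^ card (\<beta> \<inter> insert y Y)) = (\<Sum>j<q. W (F j) / real q)"
  proof (intro sum.cong refl)
    fix j
    have "card (\<beta> \<inter> insert y Y) = Suc (card (\<beta> \<inter> Y))" if "\<beta> \<in> F j" for \<beta>
      using that insert.hyps by (auto simp: F_def)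
    then show "(\<Sum>\<beta>\<in>F j. (1 / real q) ^ card (\<beta> \<inter> insert y Y)) = W (F j) / real q"
      unfolding W_def sum_divide_distrib by (intro sum.cong) auto
  qed
  also have "W F0 + (\<Sum>j<q. W (F j) / real q) = (\<Sum>j<q. (W F0 + W (F j)) / real q)"
    using \<open>q \<ge> 1\<close> by (simp add: add_divide_distrib sum.distrib)
  also have "\<dots> \<le> (\<Sum>j<q. (\<Prod>i<q. real (card (Sh' i))) / real q)"
    using step by (intro sum_mono divide_right_mono) auto
  also have "\<dots> = (\<Prod>i<q. real (card (Sh' i)))" using \<open>q \<ge> 1\<close> by simp
  finally show ?case unfolding Sh'_def .
qed

lemma sum_Pow_power_card:
  fixes x :: real
  assumes "finite Y"
  shows "(\<Sum>\<beta>\<in>Pow Y. x ^ card \<beta>) = (1 + x) ^ card Y"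
  using assms
proof (induction Y rule: finite_induct)
  case (insert y Y)
  have "(\<Sum>\<beta>\<in>Pow (insert y Y). x ^ card \<beta>)
    = (\<Sum>\<beta>\<in>Pow Y. x ^ card \<beta>) + (\<Sum>\<beta>\<in>insert y ` Pow Y. x ^ card \<beta>)"
    unfolding Pow_insert using insert by (subst sum.union_disjoint) auto
  also have "(\<Sum>\<beta>\<in>insert y ` Pow Y. x ^ card \<beta>) = (\<Sum>\<beta>\<in>Pow Y. x ^ card (insert y \<beta>))"
    using insert by (subst sum.reindex) (auto simp: inj_on_def)
  also have "\<dots> = (\<Sum>\<beta>\<in>Pow Y. x * x ^ card \<beta>)"
  proof (intro sum.cong refl)
    fix \<beta> assume "\<beta> \<in> Pow Y"
    then have "finite \<beta>" "y \<notin> \<beta>" using insert finite_subset by auto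
    then show "x ^ card (insert y \<beta>) = x * x ^ card \<beta>" by simp
  qed
  finally show ?case using insert by (simp add: sum_distrib_left[symmetric] algebra_simps)
qed simp

lemma exists_many_shattered:
  fixes col :: "'y set \<Rightarrow> 'y \<Rightarrow> nat"
  assumes "finite Y" "q \<ge> 1" "\<And>\<beta> y. \<beta> \<subseteq> Y \<Longrightarrow> y \<in> \<beta> \<Longrightarrow> col \<beta> y < q"
  shows "\<exists>i<q. (1 + 1 / real q) ^ card Y \<le> real (card {A. A \<subseteq> Y \<and> shattered col i (Pow Y) A}) ^ q"
proof (rule ccontr)
  assume contra: "\<not> ?thesis"
  define s where "s i = real (card {A. A \<subseteq> Y \<and> shattered col i (Pow Y) A})" for i
  have lt: "s i ^ q < (1 + 1 / real q) ^ card Y" if "i < q" for i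
    using contra that by (auto simp: s_def not_le)
  have "(\<Sum>\<beta>\<in>Pow Y. (1 / real q) ^ card (\<beta> \<inter> Y)) \<le> (\<Prod>i<q. s i)"
    unfolding s_def using assms by (intro prod_shattered_ge) (auto simp: inj_on_def)
  also have "(\<Sum>\<beta>\<in>Pow Y. (1 / real q) ^ card (\<beta> \<inter> Y)) = (\<Sum>\<beta>\<in>Pow Y. (1 / real q) ^ card \<beta>)"
    by (intro sum.cong) (auto simp: Int_absorb2)
  also have "\<dots> = (1 + 1 / real q) ^ card Y" by (rule sum_Pow_power_card[OF assms(1)])
  finally have ge: "(1 + 1 / real q) ^ card Y \<le> (\<Prod>i<q. s i)" .
  have pos: "(0::real) < (1 + 1 / real q) ^ card Y" by (intro zero_less_power) (simp add: add_pos_nonneg)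
  have "((1 + 1 / real q) ^ card Y) ^ q \<le> (\<Prod>i<q. s i) ^ q"
    using ge pos by (intro power_mono) auto
  also have "\<dots> = (\<Prod>i<q. s i ^ q)" by (rule prod_power_distrib)
  also have "\<dots> < (\<Prod>i<q. (1 + 1 / real q) ^ card Y)"
    using lt assms(2) pos by (intro prod_mono_strict) (auto simp: s_def less_imp_le)
  also have "\<dots> = ((1 + 1 / real q) ^ card Y) ^ q" by simp
  finally show False by simp
qed

text \<open>Such a set is determined by the set of its large rows and the contents of all rows.\<close>

lemma card_few_large_rows:
  fixes R t w d :: nat
  assumes w: "w \<ge> 1"
  defines "small \<equiv> {B. B \<subseteq> {..<t} \<and> card B < w}"
  shows "card {A. A \<subseteq> {..<R} \<times> {..<t} \<and> card {r\<in>{..<R}. w \<le> card (A `` {r})} < d}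
    \<le> 2 ^ (R + t * d) * card small ^ R"
proof -
  define big where "big A = {r\<in>{..<R}. w \<le> card (A `` {r})}" for A :: "(nat \<times> nat) set"
  define Fam where "Fam = {A. A \<subseteq> {..<R} \<times> {..<t} \<and> card (big A) < d}"
  define Js where "Js = {J. J \<subseteq> {..<R} \<and> card J < d}"
  define S where "S J = PiE {..<R} (\<lambda>r. if r \<in> J then Pow {..<t} else small)" for J
  define f where "f A = (big A, \<lambda>r\<in>{..<R}. A `` {r})" for A :: "(nat \<times> nat) set"
  have fin: "finite small" "finite Js" by (auto simp: small_def Js_def)
  have "small \<noteq> {}" using w by (auto simp: small_def intro!: exI[of _ "{}"])
  then have s1: "card small \<ge> 1" using fin by (simp add: Suc_leI card_gt_0_iff)
  have finS: "finite (S J)" for J using fin by (auto simp: S_def intro!: finite_PiE)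
  have "inj_on f Fam"
  proof (rule inj_onI)
    fix A B assume AB: "A \<in> Fam" "B \<in> Fam" "f A = f B"
    have "A `` {r} = B `` {r}" if "r < R" for r
    proof -
      have "(\<lambda>r\<in>{..<R}. A `` {r}) r = (\<lambda>r\<in>{..<R}. B `` {r}) r" using AB(3) by (simp only: f_def prod.inject)
      then show ?thesis using that by simp
    qed
    then have *: "(r, s) \<in> A \<longleftrightarrow> (r, s) \<in> B" if "r < R" for r s using that by (auto simp: Image_def)
    show "A = B"
    proof (rule set_eqI)
      fix p show "p \<in> A \<longleftrightarrow> p \<in> B" using * AB(1,2) by (cases p) (auto simp: Fam_def)
    qed
  qed
  moreover have "f ` Fam \<subseteq> (SIGMA J:Js. S J)"
    by (fastforce simp: f_def Fam_def Js_def S_def big_def small_def not_le)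
  ultimately have "card Fam \<le> card (SIGMA J:Js. S J)"
    using fin finS by (intro card_inj_on_le[of f]) auto
  also have "\<dots> = (\<Sum>J\<in>Js. card (S J))" using fin finS by simp
  also have "\<dots> \<le> (\<Sum>J\<in>Js. 2 ^ (t * d) * card small ^ R)"
  proof (intro sum_mono)
    fix J assume J: "J \<in> Js"
    have JR: "J \<subseteq> {..<R}" "card J \<le> d" using J by (auto simp: Js_def)
    have "card (S J) = (\<Prod>r<R. if r \<in> J then 2 ^ t else card small)"
      unfolding S_def by (subst card_PiE) (auto simp: card_Pow intro!: prod.cong)
    also have "\<dots> \<le> (\<Prod>r<R. (if r \<in> J then 2 ^ t else 1) * card small)"
      using s1 by (intro prod_mono) auto
    also have "\<dots> = (\<Prod>r<R. (if r \<in> J then 2 ^ t else 1)) * card small ^ R"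
      by (simp add: prod.distrib)
    also have "(\<Prod>r<R. (if r \<in> J then 2 ^ t else 1 :: nat)) = (\<Prod>r\<in>J. 2 ^ t)"
      using JR by (subst prod.If_cases) (auto simp: Int_absorb1)
    also have "\<dots> = 2 ^ (t * card J)" by (simp add: power_mult)
    also have "\<dots> * card small ^ R \<le> 2 ^ (t * d) * card small ^ R"
      using JR by (intro mult_right_mono power_increasing) auto
    finally show "card (S J) \<le> 2 ^ (t * d) * card small ^ R" .
  qed
  also have "\<dots> = card Js * (2 ^ (t * d) * card small ^ R)" by simp
  also have "\<dots> \<le> 2 ^ R * (2 ^ (t * d) * card small ^ R)"
  proof -
    have "card Js \<le> card (Pow {..<R})" by (intro card_mono) (auto simp: Js_def)
    then show ?thesis by (intro mult_right_mono) (auto simp: card_Pow)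
  qed
  also have "\<dots> = 2 ^ (R + t * d) * card small ^ R" by (simp add: power_add)
  finally show ?thesis by (simp add: Fam_def big_def)
qed

text \<open>The usual estimate of a binomial tail: give the weight \<open>x\<close> to the power \<open>- card B\<close> to every
  set \<open>B\<close> and compare with \<open>(1 + 1 / x) ^ (x * w) \<le> 3 ^ w\<close>.\<close>

lemma card_small_subsets:
  fixes x w :: nat
  assumes "x \<ge> 1"
  shows "card {B. B \<subseteq> {..<x * w} \<and> card B < w} \<le> (3 * x) ^ w"
proof -
  let ?S = "{B. B \<subseteq> {..<x * w} \<and> card B < w}"
  have "real (card ?S) * (1 / real x) ^ w = (\<Sum>B\<in>?S. (1 / real x) ^ w)" by simp
  also have "\<dots> \<le> (\<Sum>B\<in>?S. (1 / real x) ^ card B)"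
    using assms by (intro sum_mono power_decreasing) auto
  also have "\<dots> \<le> (\<Sum>B\<in>Pow {..<x * w}. (1 / real x) ^ card B)"
    by (intro sum_mono2) auto
  also have "\<dots> = (1 + 1 / real x) ^ (x * w)" by (subst sum_Pow_power_card) auto
  also have "\<dots> \<le> exp (1 / real x) ^ (x * w)"
    by (intro power_mono exp_ge_add_one_self) (simp add: add_nonneg_nonneg)
  also have "\<dots> = exp 1 ^ w"
    using assms by (simp add: power_mult exp_of_nat_mult[symmetric])
  also have "\<dots> \<le> 3 ^ w" by (intro power_mono exp_le) auto
  finally have "real (card ?S) * (1 / real x) ^ w * real x ^ w \<le> 3 ^ w * real x ^ w"
    by (intro mult_right_mono) auto
  then have "real (card ?S) \<le> (3 * real x) ^ w"
    using assms by (simp add: power_mult_distrib power_divide)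
  then have "real (card ?S) \<le> real ((3 * x) ^ w)" by simp
  then show ?thesis by (simp only: of_nat_le_iff)
qed

text \<open>The ground set consists of \<open>R\<close> rows of length \<open>t\<close>. Some colour shatters at least
  \<open>(1 + 1 / q) ^ (R * t / q)\<close> sets, which exceeds the number of sets that have fewer than \<open>d\<close> rows with
  \<open>w\<close> or more elements. The parameters are chosen for this comparison. Both
  \<open>R\<close> and \<open>t\<close> have to be of order \<open>q\<^sup>2\<close>, and only \<open>t\<close> carries the factor \<open>l \<approx> log 2 q\<close>, which turns
  \<open>2 ^ (R * t)\<close> into a power of \<open>q\<close>.\<close>

lemma exists_joint_shattering:
  fixes R t w d q l :: nat and col :: "(nat \<times> nat) set \<Rightarrow> nat \<times> nat \<Rightarrow> nat"
  assumes pos: "q \<ge> 1" "w \<ge> 1" "l \<ge> 1" "d \<ge> 1" and ql: "q \<le> 2 ^ l"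
    and R: "R = 4 * d * q\<^sup>2" and t: "t = 32 * q\<^sup>2 * l * w"
    and col: "\<And>\<beta> y. \<beta> \<subseteq> {..<R} \<times> {..<t} \<Longrightarrow> y \<in> \<beta> \<Longrightarrow> col \<beta> y < q"
  shows "\<exists>i<q. \<exists>J A. J \<subseteq> {..<R} \<and> card J = d \<and> (\<forall>r. A r \<subseteq> {..<t}) \<and> (\<forall>r\<in>J. card (A r) = w)
     \<and> shattered col i (Pow ({..<R} \<times> {..<t})) (SIGMA r:J. A r)"
proof -
  define Y where "Y = {..<R} \<times> {..<t}"
  define \<sigma> where "\<sigma> = card {B. B \<subseteq> {..<t} \<and> card B < w}"
  obtain i where i: "i < q"
    and many: "(1 + 1 / real q) ^ card Y \<le> real (card {A. A \<subseteq> Y \<and> shattered col i (Pow Y) A}) ^ q"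
    using exists_many_shattered[of Y q col] col pos by (auto simp: Y_def)
  define few where "few = {A. A \<subseteq> Y \<and> card {r\<in>{..<R}. w \<le> card (A `` {r})} < d}"
  have "\<sigma> \<le> 2 ^ (10 * l * w)"
  proof -
    have "\<sigma> \<le> (3 * (32 * q\<^sup>2 * l)) ^ w"
      unfolding \<sigma>_def t using pos by (intro card_small_subsets) auto
    also have "\<dots> \<le> (2 ^ (10 * l)) ^ w"
    proof (intro power_mono)
      have "3 * (32 * q\<^sup>2 * l) = 96 * q\<^sup>2 * l" by simp
      also have "\<dots> \<le> 2 ^ (7 * l) * (2 ^ l)\<^sup>2 * 2 ^ l"
      proof (intro mult_mono power_mono ql)
        have "(2::nat) ^ (7 * 1) \<le> 2 ^ (7 * l)" using pos by (intro power_increasing) auto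
        then show "(96::nat) \<le> 2 ^ (7 * l)" by simp
        show "l \<le> 2 ^ l" by (simp add: less_imp_le)
      qed auto
      also have "\<dots> = 2 ^ (10 * l)" by (simp add: power_add[symmetric] power_mult[symmetric])
      finally show "3 * (32 * q\<^sup>2 * l) \<le> 2 ^ (10 * l)" .
    qed auto
    finally show ?thesis by (simp add: power_mult)
  qed
  then have "2 ^ (R + t * d) * \<sigma> ^ R \<le> 2 ^ (R + t * d) * (2 ^ (10 * l * w)) ^ R"
    by (intro mult_left_mono power_mono) auto
  also have "\<dots> = 2 ^ (R + t * d + 10 * l * w * R)" by (simp add: power_add power_mult)
  finally have "card few \<le> 2 ^ (R + t * d + 10 * l * w * R)"
    using card_few_large_rows[OF pos(2), of R t d] by (simp add: few_def Y_def \<sigma>_def)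
  then have "card few ^ q \<le> (2 ^ (R + t * d + 10 * l * w * R)) ^ q" by (rule power_mono) auto
  also have "\<dots> = 2 ^ ((R + t * d + 10 * l * w * R) * q)" by (simp add: power_mult)
  also have "\<dots> < 2 ^ (4 * d * q * t)"
  proof (intro power_strict_increasing)
    have "1 \<le> l * w" using pos by simp
    then have "q\<^sup>2 * 1 \<le> q\<^sup>2 * (l * w)" by (intro mult_left_mono) auto
    moreover have "q\<^sup>2 > 0" using pos by simp
    ultimately have "4 * q\<^sup>2 + 32 * (q\<^sup>2 * (l * w)) + 40 * (q\<^sup>2 * (l * w)) < 128 * (q\<^sup>2 * (l * w))" by linarith
    then have "(4 * q\<^sup>2 + 32 * (q\<^sup>2 * (l * w)) + 40 * (q\<^sup>2 * (l * w))) * (d * q) < 128 * (q\<^sup>2 * (l * w)) * (d * q)"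
      using pos by (intro mult_strict_right_mono) auto
    then show "(R + t * d + 10 * l * w * R) * q < 4 * d * q * t" unfolding R t by (simp add: algebra_simps)
  qed simp
  finally have "card few ^ q < 2 ^ (4 * d * q * t)" .
  then have few: "real (card few) ^ q < 2 ^ (4 * d * q * t)"
    by (metis of_nat_less_iff of_nat_power of_nat_numeral)
  have "1 + real q * (1 / real q) \<le> (1 + 1 / real q) ^ q"
    by (intro Bernoulli_inequality) (rule order_trans[of _ 0], auto)
  then have "(2::real) ^ (4 * d * q * t) \<le> ((1 + 1 / real q) ^ q) ^ (4 * d * q * t)"
    using pos by (intro power_mono) auto
  also have "\<dots> = (1 + 1 / real q) ^ card Y"
    unfolding Y_def card_cartesian_product R by (simp add: power_mult[symmetric] power2_eq_square algebra_simps)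
  also note many
  finally have "real (card few) ^ q < real (card {A. A \<subseteq> Y \<and> shattered col i (Pow Y) A}) ^ q"
    using few by linarith
  then have "card few < card {A. A \<subseteq> Y \<and> shattered col i (Pow Y) A}"
    using power_less_imp_less_base[of "real (card few)" q "real (card {A. A \<subseteq> Y \<and> shattered col i (Pow Y) A})"] by simp
  moreover have "finite few" by (auto simp: few_def Y_def)
  ultimately obtain B where B: "B \<subseteq> Y" "shattered col i (Pow Y) B" "B \<notin> few"
    by (metis (mono_tags, lifting) card_mono linorder_not_less mem_Collect_eq subsetI)
  then have "d \<le> card {r\<in>{..<R}. w \<le> card (B `` {r})}" by (simp add: few_def)
  then obtain J where J: "J \<subseteq> {r\<in>{..<R}. w \<le> card (B `` {r})}" "card J = d"
    by (rule obtain_subset_with_card_n)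
  have "\<exists>C. C \<subseteq> B `` {r} \<and> card C = w" if "r \<in> J" for r
  proof -
    have "w \<le> card (B `` {r})" using J that by auto
    then obtain C where "C \<subseteq> B `` {r}" "card C = w" by (rule obtain_subset_with_card_n)
    then show ?thesis by blast
  qed
  then obtain A0 where A0: "\<And>r. r \<in> J \<Longrightarrow> A0 r \<subseteq> B `` {r} \<and> card (A0 r) = w" by metis
  define A where "A r = (if r \<in> J then A0 r else {})" for r
  have "(SIGMA r:J. A r) \<subseteq> B" using A0 by (fastforce simp: A_def)
  then have "shattered col i (Pow Y) (SIGMA r:J. A r)" using B shattered_subset by metis
  moreover have "A r \<subseteq> {..<t}" for r using A0[of r] B(1) by (auto simp: A_def Y_def dest!: subsetD)
  ultimately show ?thesis using i J A0 unfolding Y_def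
    by (intro exI[of _ i] exI[of _ J] exI[of _ A] conjI) (auto simp: A_def)
qed

section \<open>Locally sparse incidence structures\<close>

lemma power_self_le_fact: "real x ^ x \<le> 3 ^ x * fact x"
proof -
  have "(\<Sum>k\<in>{x}. real x ^ k /\<^sub>R fact k) \<le> (\<Sum>k. real x ^ k /\<^sub>R fact k)"
    by (intro sum_le_suminf summable_exp_generic) auto
  then have "real x ^ x / fact x \<le> exp (real x)" by (simp add: exp_def divide_inverse mult.commute)
  also have "\<dots> = exp 1 ^ x" by (simp add: exp_of_nat_mult[symmetric])
  also have "\<dots> \<le> 3 ^ x" by (intro power_mono exp_le) auto
  finally show ?thesis by (simp add: field_simps)
qed

text \<open>The contribution of the sets of size \<open>x\<close>. The factor \<open>(x / N) ^ x\<close> compensates the number of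
  sets up to \<open>(3 * (R + c)) ^ x\<close>, and the surplus of \<open>x / 4\<close> incidences yields
  the factor that makes the sum converge.\<close>

lemma sparse_union_bound_term:
  fixes n R c x :: nat
  assumes pos: "n \<ge> 1" "R \<ge> 1" and x: "x \<ge> 1" "x \<le> 6 * n"
  defines "B \<equiv> 9 * (R + c) * 2 ^ R"
  defines "N \<equiv> 6 * n * B ^ 4"
  shows "real (((R + c) * N) choose x) * 2 ^ (R * x) * (real x / real N) ^ (5 * x div 4 + 1) \<le> (1 / 3) ^ x"
proof -
  define e where "e = 5 * x div 4 + 1 - x"
  have e: "5 * x div 4 + 1 = x + e" "x \<le> 4 * e" unfolding e_def by linarith+
  have "B \<ge> 1" using pos by (auto simp: B_def)
  then have B: "real B \<ge> 1" by linarith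
  have N: "real N > 0" using pos B by (auto simp: N_def)
  have xN: "real x / real N \<le> (1 / real B) ^ 4"
  proof -
    have "real x * real B ^ 4 \<le> real (6 * n) * real B ^ 4" using x by (intro mult_right_mono) auto
    then have "real x * real B ^ 4 \<le> real N" by (simp add: N_def)
    then show ?thesis using N B by (simp add: field_simps power_divide)
  qed
  have "(real x / real N) ^ e \<le> ((1 / real B) ^ 4) ^ e"
    using xN N by (intro power_mono) auto
  also have "\<dots> = (1 / real B) ^ (4 * e)" by (simp add: power_mult)
  also have "\<dots> \<le> (1 / real B) ^ x" using e B by (intro power_decreasing) auto
  finally have 1: "(real x / real N) ^ e \<le> (1 / real B) ^ x" .
  have "real (((R + c) * N) choose x) * fact x \<le> (real ((R + c) * N)) ^ x"
    using binomial_fact_pow[of "(R + c) * N" x] by (metis of_nat_fact of_nat_le_iff of_nat_mult of_nat_power)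
  then have M1: "real (((R + c) * N) choose x) * fact x * 3 ^ x \<le> (real ((R + c) * N)) ^ x * 3 ^ x"
    by (rule mult_right_mono) simp
  have "real (((R + c) * N) choose x) * real x ^ x \<le> real (((R + c) * N) choose x) * (3 ^ x * fact x)"
    by (intro mult_left_mono power_self_le_fact) auto
  also have "\<dots> = real (((R + c) * N) choose x) * fact x * 3 ^ x" by (simp only: mult_ac)
  also note M1
  finally have "real (((R + c) * N) choose x) * real x ^ x \<le> (real ((R + c) * N)) ^ x * 3 ^ x" .
  also have "\<dots> = (3 * real (R + c)) ^ x * real N ^ x"
    by (simp only: power_mult_distrib of_nat_mult mult_ac)
  finally have "real (((R + c) * N) choose x) * real x ^ x \<le> (3 * real (R + c)) ^ x * real N ^ x" .
  then have 2: "real (((R + c) * N) choose x) * (real x / real N) ^ x \<le> (3 * real (R + c)) ^ x"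
    using N by (simp add: power_divide pos_divide_le_eq)
  have "real (((R + c) * N) choose x) * 2 ^ (R * x) * (real x / real N) ^ (5 * x div 4 + 1)
      = 2 ^ (R * x) * ((real (((R + c) * N) choose x) * (real x / real N) ^ x) * (real x / real N) ^ e)"
    unfolding e by (simp add: power_add mult_ac)
  also have "\<dots> \<le> 2 ^ (R * x) * ((3 * real (R + c)) ^ x * (1 / real B) ^ x)"
    using 1 2 N by (intro mult_left_mono mult_mono) auto
  also have "\<dots> = (2 ^ R * (3 * real (R + c)) * (1 / real B)) ^ x"
    by (simp only: power_mult power_mult_distrib mult.assoc)
  also have "2 ^ R * (3 * real (R + c)) * (1 / real B) = 1 / 3"
  proof -
    have "real B = 9 * real (R + c) * 2 ^ R" by (simp add: B_def)
    moreover have "real (R + c) \<noteq> 0" using pos by simp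
    ultimately show ?thesis by (simp add: divide_simps del: of_nat_add)
  qed
  finally show ?thesis .
qed

text \<open>Points \<open>Inl (r, p)\<close> and hubs \<open>Inr u\<close>; the set of pairs consists of the incidences inside \<open>A\<close>.\<close>

definition sparse_incidence :: "nat \<Rightarrow> nat \<Rightarrow> nat \<Rightarrow> nat \<Rightarrow> (nat \<Rightarrow> nat \<Rightarrow> nat) \<Rightarrow> bool" where
  "sparse_incidence n R N M F \<longleftrightarrow> (\<forall>u<M. \<forall>r<R. F u r < N) \<and>
    (\<forall>A. A \<subseteq> Inl ` ({..<R} \<times> {..<N}) \<union> Inr ` {..<M} \<longrightarrow> card A \<le> 6 * n \<longrightarrow>
      4 * card {(u, r). r < R \<and> Inr u \<in> A \<and> Inl (r, F u r) \<in> A} \<le> 5 * card A)"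

text \<open>A random \<open>F\<close> works, by a union bound over all vertex sets \<open>A\<close> and all sets of more than
  \<open>5 / 4 * card A\<close> incidences inside \<open>A\<close>. An incidence set of size \<open>e\<close> lies inside a set of
  size \<open>x\<close> with probability at most \<open>(x / N) ^ e\<close>; with \<open>e > 5 / 4 * x\<close> this beats the number of
  choices as soon as \<open>N / x\<close> exceeds a constant that depends on \<open>R\<close> and \<open>c\<close> only. Hence \<open>N\<close> is linear in \<open>n\<close>.\<close>

lemma sparse_incidence_exists:
  fixes n R c :: nat
  assumes pos: "n \<ge> 1" "R \<ge> 1"
  defines "N \<equiv> 6 * n * (9 * (R + c) * 2 ^ R) ^ 4"
  shows "\<exists>F. sparse_incidence n R N (c * N) F"
proof -
  define D :: "(nat \<times> nat + nat) set" where "D = Inl ` ({..<R} \<times> {..<N}) \<union> Inr ` {..<c * N}"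
  define dom where "dom = {..<c * N} \<times> {..<R}"
  define \<Omega> where "\<Omega> = PiE dom (\<lambda>_. {..<N})"
  \<comment> \<open>The least number of incidences that violates sparsity for sets of size \<open>x\<close>.\<close>
  define e0 where "e0 x = 5 * x div 4 + 1" for x :: nat
  define As where "As x = {A. A \<subseteq> D \<and> card A = x}" for x
  define Es where "Es A = {E. E \<subseteq> {(u, r). r < R \<and> Inr u \<in> A} \<and> card E = e0 (card A)}"
    for A :: "(nat \<times> nat + nat) set"
  define Bad where "Bad A E = {F \<in> \<Omega>. \<forall>(u, r)\<in>E. Inl (r, F (u, r)) \<in> A}"
    for A :: "(nat \<times> nat + nat) set" and E
  have N: "N > 0" using pos by (auto simp: N_def)
  have fD: "finite D" by (simp add: D_def)
  have cD: "card D = (R + c) * N"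
  proof -
    have "card D = card (Inl ` ({..<R} \<times> {..<N}) :: (nat \<times> nat + nat) set) + card (Inr ` {..<c * N} :: (nat \<times> nat + nat) set)"
      unfolding D_def by (intro card_Un_disjoint) auto
    then show ?thesis by (simp add: card_image algebra_simps)
  qed
  have fdom: "finite dom" by (simp add: dom_def)
  have c\<Omega>: "card \<Omega> = N ^ card dom" unfolding \<Omega>_def using fdom by (simp add: card_PiE)
  have f\<Omega>: "finite \<Omega>" unfolding \<Omega>_def using fdom by (intro finite_PiE) auto
  have fAs: "finite (As x)" for x using fD by (auto simp: As_def)
  have pairs: "finite {(u, r). r < R \<and> Inr u \<in> A}" "card {(u, r). r < R \<and> Inr u \<in> A} \<le> R * card A"
    if "finite A" for A :: "(nat \<times> nat + nat) set"
  proof -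
    have eq: "{(u, r). r < R \<and> Inr u \<in> A} = Inr -` A \<times> {..<R}" by auto
    have f: "finite (Inr -` A)" using that by (intro finite_vimageI) auto
    show "finite {(u, r). r < R \<and> Inr u \<in> A}" unfolding eq using f by simp
    have "card (Inr -` A) \<le> card A"
      using that by (intro card_inj_on_le[of Inr]) auto
    then show "card {(u, r). r < R \<and> Inr u \<in> A} \<le> R * card A"
      unfolding eq by (simp add: card_cartesian_product)
  qed
  have fEs: "finite (Es A)" "card (Es A) \<le> 2 ^ (R * card A)" if "finite A" for A
  proof -
    have sub: "Es A \<subseteq> Pow {(u, r). r < R \<and> Inr u \<in> A}" by (auto simp: Es_def)
    show "finite (Es A)" using sub pairs(1)[OF that] by (meson finite_Pow_iff finite_subset)
    have "card (Es A) \<le> card (Pow {(u, r). r < R \<and> Inr u \<in> A})"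
      using sub pairs(1)[OF that] by (intro card_mono) auto
    also have "\<dots> = 2 ^ card {(u, r). r < R \<and> Inr u \<in> A}" using pairs(1)[OF that] by (simp add: card_Pow)
    also have "\<dots> \<le> 2 ^ (R * card A)" using pairs(2)[OF that] by (intro power_increasing) auto
    finally show "card (Es A) \<le> 2 ^ (R * card A)" .
  qed
  have cBad: "real (card (Bad A E)) \<le> real N ^ card dom * (real x / real N) ^ e0 x"
    if A: "A \<in> As x" and E: "E \<in> Es A" for x A E
  proof -
    have fA: "finite A" using A fD by (auto simp: As_def intro: finite_subset)
    have Ed: "E \<subseteq> dom" using A E by (auto simp: Es_def As_def dom_def D_def)
    have fE: "finite E" using Ed fdom finite_subset by auto
    have cE: "card E = e0 x" using A E by (auto simp: Es_def As_def)
    define T where "T p = (if p \<in> E then {v. v < N \<and> Inl (snd p, v) \<in> A} else {..<N})" for p :: "nat \<times> nat"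
    have "Bad A E \<subseteq> PiE dom T"
    proof
      fix F assume F: "F \<in> Bad A E"
      have "F p \<in> T p" if "p \<in> dom" for p
      proof -
        have "F p < N" using F that by (auto simp: Bad_def \<Omega>_def)
        moreover have "Inl (snd p, F p) \<in> A" if "p \<in> E"
          using F that by (cases p) (auto simp: Bad_def)
        ultimately show ?thesis by (simp add: T_def)
      qed
      then show "F \<in> PiE dom T" using F by (auto simp: Bad_def \<Omega>_def PiE_iff)
    qed
    then have "card (Bad A E) \<le> card (PiE dom T)"
      using fdom by (intro card_mono finite_PiE) (auto simp: T_def)
    also have "\<dots> = (\<Prod>p\<in>dom. card (T p))" using fdom by (simp add: card_PiE)
    also have "\<dots> \<le> (\<Prod>p\<in>dom. if p \<in> E then x else N)"
    proof (intro prod_mono conjI)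
      fix p assume "p \<in> dom"
      have "card {v. v < N \<and> Inl (snd p, v) \<in> A} \<le> card A"
        using fA by (intro card_inj_on_le[of "\<lambda>v. Inl (snd p, v)"]) (auto simp: inj_on_def)
      then show "card (T p) \<le> (if p \<in> E then x else N)" using A by (auto simp: T_def As_def)
    qed auto
    also have "\<dots> = x ^ card E * N ^ card (dom - E)"
      using Ed fdom by (subst prod.If_cases) (auto simp: Int_absorb1 Diff_eq)
    also have "card (dom - E) = card dom - e0 x" using Ed fE cE by (simp add: card_Diff_subset)
    finally have "real (card (Bad A E)) \<le> real x ^ e0 x * real N ^ (card dom - e0 x)"
      unfolding cE by (metis of_nat_le_iff of_nat_mult of_nat_power)
    moreover have "e0 x \<le> card dom" using card_mono[OF fdom Ed] cE by simp
    ultimately show ?thesis using N by (simp add: power_divide power_diff field_simps)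
  qed
  have "\<not> \<Omega> \<subseteq> (\<Union>x\<in>{1..6 * n}. \<Union>A\<in>As x. \<Union>E\<in>Es A. Bad A E)"
  proof
    assume cover: "\<Omega> \<subseteq> (\<Union>x\<in>{1..6 * n}. \<Union>A\<in>As x. \<Union>E\<in>Es A. Bad A E)"
    have fA: "finite A" if "A \<in> As x" for A x using that fD by (auto simp: As_def intro: finite_subset)
    have fB: "finite (Bad A E)" for A E using f\<Omega> by (auto simp: Bad_def)
    have "card \<Omega> \<le> card (\<Union>x\<in>{1..6 * n}. \<Union>A\<in>As x. \<Union>E\<in>Es A. Bad A E)"
      using cover fAs fA fEs fB by (intro card_mono) auto
    also have "\<dots> \<le> (\<Sum>x\<in>{1..6 * n}. card (\<Union>A\<in>As x. \<Union>E\<in>Es A. Bad A E))"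
      by (intro card_UN_le) auto
    also have "\<dots> \<le> (\<Sum>x\<in>{1..6 * n}. \<Sum>A\<in>As x. card (\<Union>E\<in>Es A. Bad A E))"
      using fAs by (intro sum_mono card_UN_le)
    also have "\<dots> \<le> (\<Sum>x\<in>{1..6 * n}. \<Sum>A\<in>As x. \<Sum>E\<in>Es A. card (Bad A E))"
      using fA fEs by (intro sum_mono card_UN_le) auto
    finally have "real (card \<Omega>) \<le> real (\<Sum>x\<in>{1..6 * n}. \<Sum>A\<in>As x. \<Sum>E\<in>Es A. card (Bad A E))"
      by (rule of_nat_mono)
    also have "\<dots> = (\<Sum>x\<in>{1..6 * n}. \<Sum>A\<in>As x. \<Sum>E\<in>Es A. real (card (Bad A E)))" by simp
    also have "\<dots> \<le> (\<Sum>x\<in>{1..6 * n}. real N ^ card dom * (1 / 3) ^ x)"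
    proof (intro sum_mono)
      fix x assume x: "x \<in> {1..6 * n}"
      let ?t = "real N ^ card dom * (real x / real N) ^ e0 x"
      have "(\<Sum>A\<in>As x. \<Sum>E\<in>Es A. real (card (Bad A E))) \<le> (\<Sum>A\<in>As x. \<Sum>E\<in>Es A. ?t)"
        using cBad by (intro sum_mono) auto
      also have "\<dots> = (\<Sum>A\<in>As x. real (card (Es A)) * ?t)" by simp
      also have "\<dots> \<le> (\<Sum>A\<in>As x. 2 ^ (R * x) * ?t)"
      proof (intro sum_mono mult_right_mono)
        fix A assume A: "A \<in> As x"
        then have "card (Es A) \<le> 2 ^ (R * x)" using fEs(2)[OF fA[OF A]] by (auto simp: As_def)
        then show "real (card (Es A)) \<le> 2 ^ (R * x)"
          by (metis of_nat_le_iff of_nat_numeral of_nat_power)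
      qed auto
      also have "\<dots> = real (((R + c) * N) choose x) * (2 ^ (R * x) * ?t)"
        unfolding As_def using fD by (simp add: n_subsets cD)
      also have "\<dots> = real N ^ card dom * (real (((R + c) * N) choose x) * 2 ^ (R * x) * (real x / real N) ^ e0 x)"
        by (simp add: mult_ac)
      also have "\<dots> \<le> real N ^ card dom * (1 / 3) ^ x"
        using sparse_union_bound_term[OF pos, of x c] x unfolding e0_def N_def
        by (intro mult_left_mono) auto
      finally show "(\<Sum>A\<in>As x. \<Sum>E\<in>Es A. real (card (Bad A E))) \<le> real N ^ card dom * (1 / 3) ^ x" .
    qed
    also have "\<dots> = real N ^ card dom * (\<Sum>x\<in>{1..6 * n}. (1 / 3) ^ x)"
      by (simp add: sum_distrib_left)
    also have "\<dots> < real N ^ card dom * 1"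
    proof (intro mult_strict_left_mono)
      have "(\<Sum>x\<in>{1..m}. (1 / 3 :: real) ^ x) = 1 / 2 - (1 / 3) ^ m / 2" for m
        by (induction m) auto
      moreover have "0 \<le> (1 / 3 :: real) ^ (6 * n)" by simp
      ultimately show "(\<Sum>x\<in>{1..6 * n}. (1 / 3 :: real) ^ x) < 1" by (smt (verit) field_sum_of_halves)
    qed (use N in auto)
    finally show False using c\<Omega> by simp
  qed
  then obtain F where F: "F \<in> \<Omega>" and notbad:
    "\<And>x A E. x \<in> {1..6 * n} \<Longrightarrow> A \<in> As x \<Longrightarrow> E \<in> Es A \<Longrightarrow> F \<notin> Bad A E" by blast
  show ?thesis
    unfolding sparse_incidence_def
  proof (intro exI[of _ "\<lambda>u r. F (u, r)"] conjI allI impI)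
    fix u r assume "u < c * N" "r < R"
    then show "F (u, r) < N" using F by (auto simp: \<Omega>_def dom_def)
  next
    fix A :: "(nat \<times> nat + nat) set"
    assume A: "A \<subseteq> Inl ` ({..<R} \<times> {..<N}) \<union> Inr ` {..<c * N}" "card A \<le> 6 * n"
    have fA: "finite A" using A(1) by (rule finite_subset) auto
    let ?P = "{(u, r). r < R \<and> Inr u \<in> A \<and> Inl (r, F (u, r)) \<in> A}"
    show "4 * card ?P \<le> 5 * card A"
    proof (rule ccontr)
      assume "\<not> 4 * card ?P \<le> 5 * card A"
      then have "e0 (card A) \<le> card ?P" unfolding e0_def by linarith
      then obtain E where E: "E \<subseteq> ?P" "card E = e0 (card A)" by (rule obtain_subset_with_card_n)
      have "card A \<noteq> 0"
      proof
        assume "card A = 0"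
        then have "A = {}" using fA by simp
        then show False using E by (auto simp: e0_def)
      qed
      then have "card A \<in> {1..6 * n}" using A by auto
      moreover have "A \<in> As (card A)" using A by (auto simp: As_def D_def)
      moreover have "E \<in> Es A" using E by (auto simp: Es_def)
      moreover have "F \<in> Bad A E" using E F by (auto simp: Bad_def)
      ultimately show False using notbad by blast
    qed
  qed
qed

section \<open>Induced embedding of trees in locally sparse graphs\<close>

text \<open>A vertex with \<open>u \<ge> 18 * (k + 2)\<close> candidates that is short of available ones has lost at least
  sixteen times its shortage to the set under consideration.\<close>

lemma shortage_le:
  fixes d k a b c u m :: nat
  assumes "18 * (k + 2) \<le> u" "u \<le> a + b + c" "a \<le> k" "b \<le> m" "d \<le> k"
  shows "16 * int (d + 2 - c) \<le> int m"
proof (cases "c \<le> d + 2")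
  case True
  then have "16 * (d + 2 - c) \<le> m" using assms by auto
  then show ?thesis by linarith
qed simp

lemma card_Un3_le: "card (A \<union> B \<union> C) \<le> card A + card B + card C"
  using card_Un_le[of "A \<union> B" C] card_Un_le[of A B] by linarith

text \<open>A host graph \<open>adj\<close>, locally sparse, in which only the edges in \<open>sel\<close> may be used. At each vertex \<open>x\<close>
  these are classified by the label \<open>lab x y\<close>, and an embedded tree has to stay within one class at
  every vertex; equivalently, the vertices of the selected graph have been split according to their
  labels. Every class is large. The sums in \<open>sparse\<close> count ordered pairs, so that this
  says that \<open>A\<close> spans at most \<open>5 / 4 * card A\<close> edges.\<close>

locale split_host =
  fixes V :: "'v set" and adj sel :: "'v \<Rightarrow> 'v \<Rightarrow> bool" and lab :: "'v \<Rightarrow> 'v \<Rightarrow> 'l" and n k :: nat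
  assumes fin_V: "finite V"
    and adj_V: "adj x y \<Longrightarrow> x \<in> V"
    and adj_sym: "adj x y \<Longrightarrow> adj y x"
    and adj_irrefl: "\<not> adj x x"
    and sel_adj: "sel x y \<Longrightarrow> adj x y"
    and sel_sym: "sel x y \<Longrightarrow> sel y x"
    and n_pos: "n \<ge> 1"
    and sparse: "A \<subseteq> V \<Longrightarrow> card A \<le> 6 * n \<Longrightarrow>
      2 * (\<Sum>x\<in>A. \<Sum>y\<in>A. of_bool (adj x y) :: int) \<le> 5 * int (card A)"
    and rich: "sel x y \<Longrightarrow> 18 * (k + 2) \<le> card {z. sel x z \<and> lab x z = lab x y}"
begin

definition arcs :: "'v set \<Rightarrow> 'v set \<Rightarrow> int" where
  "arcs A B = (\<Sum>x\<in>A. \<Sum>y\<in>B. of_bool (adj x y))"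

definition link :: "'v \<Rightarrow> 'l \<Rightarrow> 'v set" where
  "link x l = {z. sel x z \<and> lab x z = l}"

definition labels :: "'v \<Rightarrow> 'l set" where
  "labels x = lab x ` {z. sel x z}"

text \<open>The potential of a set \<open>Z\<close> outside the current image \<open>S\<close>: three units for each vertex minus two for
  each edge that touches \<open>Z\<close> within \<open>Z \<union> S\<close>. In addition \<open>Z\<close> is charged for the candidates it takes away. A vertex
  \<open>x\<close> of the image has label \<open>lb x\<close>, still needs \<open>dm x\<close> children, and should
  keep two spare candidates (those that are excluded because they would not give an induced
  copy). A vertex of \<open>Z\<close> is charged for all of its labels, because
  it is not known yet with which label it will be used; the classes of different labels are disjoint, so
  that the total charge stays small. The sum over the image has its own index set \<open>I\<close>, so that the
  charge of one vertex can be left out.\<close>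

definition slack :: "'v set \<Rightarrow> 'v set \<Rightarrow> ('v \<Rightarrow> nat) \<Rightarrow> ('v \<Rightarrow> 'l) \<Rightarrow> 'v set \<Rightarrow> int" where
  "slack I S dm lb Z = 3 * int (card Z) - arcs Z Z - 2 * arcs Z S
     - (\<Sum>x\<in>I. int (dm x + 2 - card (link x (lb x) - S - Z)))
     - (\<Sum>x\<in>Z. \<Sum>l\<in>labels x. int (k + 2 - card (link x l - S - Z)))"

lemma adj_V_right: "adj x y \<Longrightarrow> y \<in> V"
  using adj_V adj_sym by blast

lemma link_subset: "link x l \<subseteq> V"
  using adj_V_right sel_adj by (auto simp: link_def)

lemma finite_link: "finite (link x l)"
  using link_subset fin_V by (rule finite_subset)

lemma finite_labels: "finite (labels x)"
proof -
  have "{z. sel x z} \<subseteq> V" using adj_V_right sel_adj by auto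
  then show ?thesis unfolding labels_def using fin_V by (meson finite_imageI finite_subset)
qed

lemma card_link: "l \<in> labels x \<Longrightarrow> 18 * (k + 2) \<le> card (link x l)"
  using rich by (auto simp: link_def labels_def)

lemma arcs_sym: "arcs A B = arcs B A"
proof -
  have "adj x y = adj y x" for x y using adj_sym by blast
  then show ?thesis unfolding arcs_def by (subst sum.swap) simp
qed

lemma arcs_Un:
  assumes "finite A" "finite B" "A \<inter> B = {}"
  shows "arcs (A \<union> B) C = arcs A C + arcs B C"
  unfolding arcs_def using assms by (simp add: sum.union_disjoint)

lemma arcs_Un_right:
  assumes "finite A" "finite B" "A \<inter> B = {}"
  shows "arcs C (A \<union> B) = arcs C A + arcs C B"
  using arcs_Un[OF assms] by (simp add: arcs_sym)

lemma arcs_nonneg: "arcs A B \<ge> 0"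
  unfolding arcs_def by (intro sum_nonneg) auto

lemma arcs_eq_card: "finite B \<Longrightarrow> (\<Sum>y\<in>B. of_bool (adj x y) :: int) = int (card {y \<in> B. adj x y})"
  by (simp add: Int_def)

lemma arcs_supermodular:
  assumes "finite A" "finite B"
  shows "arcs A A + arcs B B \<le> arcs (A \<union> B) (A \<union> B) + arcs (A \<inter> B) (A \<inter> B)"
proof -
  define D where "D = A \<union> B"
  have D: "finite D" "A \<subseteq> D" "B \<subseteq> D" "A \<union> B \<subseteq> D" "A \<inter> B \<subseteq> D"
    using assms by (auto simp: D_def)
  have *: "arcs X X = (\<Sum>x\<in>D. \<Sum>y\<in>D. of_bool (x \<in> X \<and> y \<in> X \<and> adj x y))" if "X \<subseteq> D" for X
  proof -
    have "arcs X X = (\<Sum>x\<in>X. \<Sum>y\<in>D. of_bool (y \<in> X \<and> adj x y))"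
      unfolding arcs_def using D(1) that
      by (intro sum.cong refl sum.mono_neutral_cong_left) auto
    also have "\<dots> = (\<Sum>x\<in>D. \<Sum>y\<in>D. of_bool (x \<in> X \<and> y \<in> X \<and> adj x y))"
      using D(1) that by (intro sum.mono_neutral_cong_left) auto
    finally show ?thesis .
  qed
  show ?thesis
    unfolding *[OF D(2)] *[OF D(3)] *[OF D(4)] *[OF D(5)] sum.distrib[symmetric]
    by (intro sum_mono) auto
qed

lemma arcs_modular:
  assumes "finite A" "finite B"
  shows "arcs A S + arcs B S = arcs (A \<union> B) S + arcs (A \<inter> B) S"
  unfolding arcs_def using assms by (simp add: sum.union_inter)

lemma short_convex:
  assumes "finite W" "A \<subseteq> C" "B \<subseteq> C"
  shows "int (d - card (W - S - A)) + int (d - card (W - S - B))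
       \<le> int (d - card (W - S - (A \<union> B))) + int (d - card (W - S - (A \<inter> B)))"
proof -
  let ?a = "W - S - A" and ?b = "W - S - B"
  have eq: "W - S - (A \<union> B) = ?a \<inter> ?b" "W - S - (A \<inter> B) = ?a \<union> ?b" by auto
  have fin: "finite ?a" "finite ?b" using assms by auto
  have 1: "card ?a + card ?b = card (?a \<union> ?b) + card (?a \<inter> ?b)"
    using card_Un_Int[OF fin] .
  have 2: "card (?a \<inter> ?b) \<le> card ?a" "card (?a \<inter> ?b) \<le> card ?b"
    using fin by (auto intro!: card_mono)
  show ?thesis unfolding eq using 1 2 by linarith
qed

lemma short_mono:
  assumes "finite W" "A \<subseteq> B"
  shows "int (d - card (W - S - A)) \<le> int (d - card (W - S - B))"
proof -
  have "card (W - S - B) \<le> card (W - S - A)" using assms by (intro card_mono) auto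
  then show ?thesis by linarith
qed

text \<open>Edge counts are supermodular, and a shortage is a convex function of the number of candidates that \<open>Z\<close>
  takes away.\<close>

lemma slack_submodular:
  assumes "finite A" "finite B"
  shows "slack I S dm lb (A \<union> B) + slack I S dm lb (A \<inter> B) \<le> slack I S dm lb A + slack I S dm lb B"
proof -
  define p where "p Z x l = int (k + 2 - card (link x l - S - Z))" for Z x l
  define P where "P Z = (\<Sum>x\<in>Z. \<Sum>l\<in>labels x. p Z x l)" for Z
  define Q where "Q Z = (\<Sum>x\<in>I. int (dm x + 2 - card (link x (lb x) - S - Z)))" for Z
  have card: "int (card A) + int (card B) = int (card (A \<union> B)) + int (card (A \<inter> B))"
    using card_Un_Int[OF assms] by linarith
  have Q: "Q A + Q B \<le> Q (A \<union> B) + Q (A \<inter> B)"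
    unfolding Q_def sum.distrib[symmetric]
    by (intro sum_mono short_convex[where C = "A \<union> B"]) (auto simp: finite_link)
  have P: "P A + P B \<le> P (A \<union> B) + P (A \<inter> B)"
  proof -
    define D where "D = A \<union> B"
    have D: "finite D" "A \<subseteq> D" "B \<subseteq> D" "A \<union> B \<subseteq> D" "A \<inter> B \<subseteq> D"
      using assms by (auto simp: D_def)
    have *: "P X = (\<Sum>x\<in>D. \<Sum>l\<in>labels x. of_bool (x \<in> X) * p X x l)" if "X \<subseteq> D" for X
      unfolding P_def using D(1) that finite_labels by (intro sum.mono_neutral_cong_left) auto
    have mono: "p X x l \<le> p Y x l" if "X \<subseteq> Y" for X Y x l
      unfolding p_def using short_mono[OF finite_link that] .
    have conv: "p A x l + p B x l \<le> p (A \<union> B) x l + p (A \<inter> B) x l" for x l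
      unfolding p_def by (rule short_convex[where C = "A \<union> B"]) (auto simp: finite_link)
    have nn: "p X x l \<ge> 0" for X x l by (simp add: p_def)
    show ?thesis
      unfolding *[OF D(2)] *[OF D(3)] *[OF D(4)] *[OF D(5)] sum.distrib[symmetric]
    proof (intro sum_mono)
      fix x l
      show "of_bool (x \<in> A) * p A x l + of_bool (x \<in> B) * p B x l
        \<le> of_bool (x \<in> A \<union> B) * p (A \<union> B) x l + of_bool (x \<in> A \<inter> B) * p (A \<inter> B) x l"
        using conv[of x l] mono[of A "A \<union> B" x l] mono[of B "A \<union> B" x l] nn[of "A \<union> B" x l]
        by (cases "x \<in> A"; cases "x \<in> B") auto
    qed
  qed
  show ?thesis
    using card Q P arcs_supermodular[OF assms] arcs_modular[OF assms, of S]
    unfolding slack_def P_def[symmetric] Q_def[symmetric] p_def[symmetric] by linarith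
qed

text \<open>This is where the disjointness of the classes at a vertex is used.\<close>

lemma sum_link_le:
  assumes "finite W"
  shows "(\<Sum>l\<in>labels x. int (card (link x l \<inter> W))) \<le> (\<Sum>y\<in>W. of_bool (adj x y))"
proof -
  have "(\<Sum>l\<in>labels x. card (link x l \<inter> W)) = card (\<Union>l\<in>labels x. link x l \<inter> W)"
    using assms finite_labels by (intro card_UN_disjoint[symmetric]) (auto simp: link_def)
  also have "\<dots> \<le> card {y \<in> W. adj x y}"
    using assms sel_adj by (intro card_mono) (auto simp: link_def)
  finally show ?thesis
    unfolding arcs_eq_card[OF assms] of_nat_sum[symmetric] by linarith
qed

text \<open>The image of a subtree spans at least \<open>card S - 1\<close> edges; both sides of this bound are doubled, since
  \<open>arcs\<close> counts ordered pairs.\<close>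

definition state :: "'v set \<Rightarrow> ('v \<Rightarrow> nat) \<Rightarrow> ('v \<Rightarrow> 'l) \<Rightarrow> bool" where
  "state S dm lb \<longleftrightarrow> S \<subseteq> V \<and> card S \<le> n \<and> 2 * int (card S) - 2 \<le> arcs S S \<and>
     (\<forall>x\<in>S. card {y \<in> S. adj x y} \<le> k \<and> dm x \<le> k \<and> lb x \<in> labels x)"

text \<open>By local sparsity there are about \<open>5 / 4 * card Z\<close> edges that touch \<open>Z\<close>, up to an error of order \<open>card S\<close>,
  and the charges amount to at most an eighth of the number of these edges. Hence sets with more than \<open>2 * n\<close>
  elements have a potential above the threshold without further assumptions. In particular the
  sets that attain the threshold are so small that unions of two of them are still covered.\<close>

lemma slack_lower:
  assumes st: "state S dm lb" and Z: "Z \<subseteq> V - S" "card Z \<le> 4 * n + 1"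
  shows "32 * slack S S dm lb Z \<ge> 11 * int (card Z) - 17 * int (card S) - 68"
proof -
  have SV: "S \<subseteq> V" "card S \<le> n" using st by (auto simp: state_def)
  have fin: "finite S" "finite Z" using SV Z fin_V by (auto intro: finite_subset)
  have disj: "Z \<inter> S = {}" using Z by auto
  have E: "2 * (arcs Z Z + 2 * arcs Z S) \<le> 5 * int (card Z) + int (card S) + 4"
  proof -
  have "card (Z \<union> S) \<le> 6 * n"
    using card_Un_le[of Z S] Z(2) SV(2) n_pos by linarith
  then have "2 * arcs (Z \<union> S) (Z \<union> S) \<le> 5 * int (card (Z \<union> S))"
    unfolding arcs_def using sparse[of "Z \<union> S"] Z SV by blast
  moreover have "int (card (Z \<union> S)) = int (card Z) + int (card S)" using fin disj by (simp add: card_Un_disjoint)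
  moreover have "arcs (Z \<union> S) (Z \<union> S) = arcs Z Z + 2 * arcs Z S + arcs S S"
    using fin disj by (simp add: arcs_Un arcs_Un_right arcs_sym[of S Z])
  moreover have "2 * int (card S) - 2 \<le> arcs S S" using st by (simp add: state_def)
  ultimately show E: "2 * (arcs Z Z + 2 * arcs Z S) \<le> 5 * int (card Z) + int (card S) + 4"
    by (smt (verit))
  qed
  have "16 * (\<Sum>x\<in>S. int (dm x + 2 - card (link x (lb x) - S - Z))) \<le> arcs S Z"
    unfolding arcs_def sum_distrib_left
  proof (intro sum_mono)
    fix x assume x: "x \<in> S"
    have c: "18 * (k + 2) \<le> card (link x (lb x))" using st x card_link[of "lb x" x] by (auto simp: state_def)
    have "card (link x (lb x) \<inter> S) \<le> card {y \<in> S. adj x y}"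
      using fin sel_adj by (intro card_mono) (auto simp: link_def)
    also have "\<dots> \<le> k" using st x by (auto simp: state_def)
    finally have 1: "card (link x (lb x) \<inter> S) \<le> k" .
    have 2: "card (link x (lb x)) \<le> card (link x (lb x) \<inter> S) + card (link x (lb x) \<inter> Z) + card (link x (lb x) - S - Z)"
    proof -
      have "link x (lb x) = (link x (lb x) \<inter> S) \<union> (link x (lb x) \<inter> Z) \<union> (link x (lb x) - S - Z)" by auto
      then show ?thesis using card_Un3_le[of "link x (lb x) \<inter> S" "link x (lb x) \<inter> Z" "link x (lb x) - S - Z"] by simp
    qed
    have 3: "card (link x (lb x) \<inter> Z) \<le> card {y \<in> Z. adj x y}"
      using fin sel_adj by (intro card_mono) (auto simp: link_def)
    have "dm x \<le> k" using st x by (auto simp: state_def)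
    then show "16 * int (dm x + 2 - card (link x (lb x) - S - Z)) \<le> (\<Sum>y\<in>Z. of_bool (adj x y))"
      unfolding arcs_eq_card[OF fin(2)] using shortage_le[OF c 2 1 3] by blast
  qed
  note paidS = this[unfolded arcs_sym[of S Z]]
  have "16 * (\<Sum>x\<in>Z. \<Sum>l\<in>labels x. int (k + 2 - card (link x l - S - Z))) \<le> arcs Z (Z \<union> S)"
    unfolding arcs_def sum_distrib_left
  proof (intro sum_mono)
    fix x assume x: "x \<in> Z"
    have "(\<Sum>l\<in>labels x. 16 * int (k + 2 - card (link x l - S - Z))) \<le> (\<Sum>l\<in>labels x. int (card (link x l \<inter> (Z \<union> S))))"
    proof (intro sum_mono)
      fix l assume "l \<in> labels x"
      then have c: "18 * (k + 2) \<le> card (link x l)" by (rule card_link)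
      have "card (link x l) \<le> card (link x l \<inter> (Z \<union> S)) + card (link x l - S - Z)"
      proof -
        have "link x l = (link x l \<inter> (Z \<union> S)) \<union> (link x l - S - Z)" by auto
        then show ?thesis using card_Un_le[of "link x l \<inter> (Z \<union> S)" "link x l - S - Z"] by simp
      qed
      then show "16 * int (k + 2 - card (link x l - S - Z)) \<le> int (card (link x l \<inter> (Z \<union> S)))"
        using shortage_le[OF c, of 0 "card (link x l \<inter> (Z \<union> S))" "card (link x l - S - Z)" "card (link x l \<inter> (Z \<union> S))" k]
        by simp
    qed
    also have "\<dots> \<le> (\<Sum>y\<in>Z \<union> S. of_bool (adj x y))" using fin by (intro sum_link_le) auto
    finally show "(\<Sum>l\<in>labels x. 16 * int (k + 2 - card (link x l - S - Z))) \<le> (\<Sum>y\<in>Z \<union> S. of_bool (adj x y))" .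
  qed
  also have "arcs Z (Z \<union> S) = arcs Z Z + arcs Z S" using fin disj by (intro arcs_Un_right) auto
  finally have paidZ: "16 * (\<Sum>x\<in>Z. \<Sum>l\<in>labels x. int (k + 2 - card (link x l - S - Z))) \<le> arcs Z Z + arcs Z S" .
  have arith: "11 * z - 17 * s - 68 \<le> 32 * (3 * z - a - 2 * b - p - r)"
    if "2 * (a + 2 * b) \<le> 5 * z + s + 4" "16 * p \<le> b" "16 * r \<le> a + b" for a b p r s z :: int
    using that by (smt (verit))
  show ?thesis unfolding slack_def by (rule arith[OF E paidS paidZ])
qed

text \<open>The threshold \<open>-2\<close> is what the single-vertex image satisfies. It is harmless that it is negative: it permits
  at most two vertices with two neighbours in the image.\<close>

definition good :: "'v set \<Rightarrow> ('v \<Rightarrow> nat) \<Rightarrow> ('v \<Rightarrow> 'l) \<Rightarrow> bool" where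
  "good S dm lb \<longleftrightarrow> (\<forall>Z. Z \<subseteq> V - S \<longrightarrow> card Z \<le> 4 * n \<longrightarrow> slack S S dm lb Z \<ge> -2)"

lemma good_root:
  assumes "state {r} dm lb"
  shows "good {r} dm lb"
  unfolding good_def
proof (intro allI impI)
  fix Z assume "Z \<subseteq> V - {r}" "card Z \<le> 4 * n"
  then have "32 * slack {r} {r} dm lb Z \<ge> 11 * int (card Z) - 17 * int (card {r}) - 68"
    by (intro slack_lower assms) auto
  then show "slack {r} {r} dm lb Z \<ge> -2" by simp
qed

text \<open>Moving a vertex \<open>z\<close> with a single neighbour \<open>u\<close> in the image from \<open>Z\<close> to the image costs three units
  for the vertex and returns two for the edge; the charge for the class of \<open>z\<close> was already present.
  If \<open>u\<close> was charged at all, its charge drops by one, because it needs one child fewer, and then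
  nothing is lost.\<close>

lemma slack_step:
  assumes S: "finite S" and Z: "finite Z" "z \<notin> S" "z \<notin> Z" "Z \<inter> S = {}"
    and u: "u \<in> S" "sel z u" and nb: "{y \<in> S. adj z y} = {u}" and dm: "dm u \<ge> 1" and k: "k \<ge> 1"
  shows "slack S S dm lb (insert z Z)
      + of_bool (card (link u (lb u) - S - insert z Z) < dm u + 2) - 1
    \<le> slack (insert z S) (insert z S) (dm(u := dm u - 1, z := k - 1)) (lb(z := lab z u)) Z"
proof -
  let ?S = "insert z S" and ?Z = "insert z Z" and ?dm = "dm(u := dm u - 1, z := k - 1)"
    and ?lb = "lb(z := lab z u)"
  have eqW: "W - ?S - Z = W - S - ?Z" for W :: "'v set" by auto
  have "arcs {z} S = int (card {y \<in> S. adj z y})" unfolding arcs_def by (simp add: Int_def S)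
  then have zS: "arcs {z} S = 1" using nb by simp
  have zz: "arcs {z} {z} = 0" using adj_irrefl by (simp add: arcs_def)
  have Zi: "?Z = Z \<union> {z}" "?S = S \<union> {z}" by auto
  have d: "Z \<inter> {z} = {}" "S \<inter> {z} = {}" using Z by auto
  have e1: "arcs ?Z ?Z = arcs Z Z + 2 * arcs Z {z}"
    using arcs_Un[of Z "{z}" "Z \<union> {z}"] arcs_Un_right[of Z "{z}" Z] arcs_Un_right[of Z "{z}" "{z}"]
      Z(1) d(1) zz arcs_sym[of "{z}" Z] unfolding Zi by simp
  have e2: "arcs ?Z S = arcs Z S + 1" using arcs_Un[of Z "{z}" S] Z(1) d(1) zS unfolding Zi by simp
  have e3: "arcs Z ?S = arcs Z S + arcs Z {z}" using arcs_Un_right[of S "{z}" Z] S d(2) unfolding Zi by simp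
  have uz: "u \<noteq> z" using u Z by auto
  let ?f = "\<lambda>x. int (dm x + 2 - card (link x (lb x) - S - ?Z))"
  let ?g = "\<lambda>x. int (?dm x + 2 - card (link x (?lb x) - ?S - Z))"
  have "(\<Sum>x\<in>?S. ?g x) = ?g z + (?g u + (\<Sum>x\<in>S - {u}. ?g x))"
    using S Z u by (simp add: sum.remove)
  also have "(\<Sum>x\<in>S - {u}. ?g x) = (\<Sum>x\<in>S - {u}. ?f x)"
    using Z by (intro sum.cong) (auto simp: eqW)
  also have "?g u + (\<Sum>x\<in>S - {u}. ?f x) = (\<Sum>x\<in>S. ?f x) + (?g u - ?f u)"
    using S u by (simp add: sum.remove)
  also have "?g u - ?f u = - of_bool (card (link u (lb u) - S - ?Z) < dm u + 2)"
    using uz dm unfolding eqW by auto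
  finally have s1: "(\<Sum>x\<in>?S. ?g x) = ?g z + ((\<Sum>x\<in>S. ?f x)
     - of_bool (card (link u (lb u) - S - ?Z) < dm u + 2))" by linarith
  let ?h = "\<lambda>x l. int (k + 2 - card (link x l - S - ?Z))"
  have lz: "lab z u \<in> labels z" using u by (auto simp: labels_def)
  have "?g z \<le> ?h z (lab z u)" unfolding eqW by auto
  also have "\<dots> \<le> (\<Sum>l\<in>labels z. ?h z l)" using lz finite_labels by (intro member_le_sum) auto
  finally have s2: "?g z \<le> (\<Sum>l\<in>labels z. ?h z l)" .
  have s3: "(\<Sum>x\<in>?Z. \<Sum>l\<in>labels x. ?h x l) = (\<Sum>l\<in>labels z. ?h z l) + (\<Sum>x\<in>Z. \<Sum>l\<in>labels x. ?h x l)"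
    using Z by simp
  have s4: "(\<Sum>x\<in>Z. \<Sum>l\<in>labels x. int (k + 2 - card (link x l - ?S - Z))) = (\<Sum>x\<in>Z. \<Sum>l\<in>labels x. ?h x l)"
    unfolding eqW ..
  have c: "card ?Z = card Z + 1" using Z by simp
  show ?thesis unfolding slack_def s1 s3 s4 e1 e2 e3 c using s2 by simp
qed

text \<open>Suppose that every candidate of \<open>u\<close> with a single neighbour in \<open>S\<close> fails. Each of them then lies
  in a set whose potential equals the threshold and which is not charged for \<open>u\<close>, by
  \<open>slack_step\<close> and integrality. By submodularity the union of these sets, with the charge for \<open>u\<close> left
  out, has potential at most the threshold as well. However, the union takes away all
  candidates of \<open>u\<close> but two, hence it is charged for \<open>u\<close>, and its potential falls below the
  threshold.\<close>

lemma good_extend: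
  assumes st: "state S dm lb" and gd: "good S dm lb" and u: "u \<in> S" "dm u \<ge> 1" and k: "k \<ge> 1"
  shows "\<exists>z. z \<in> V - S \<and> sel u z \<and> lab u z = lb u \<and> {y \<in> S. adj z y} = {u} \<and>
    good (insert z S) (dm(u := dm u - 1, z := k - 1)) (lb(z := lab z u))"
proof (rule ccontr)
  assume contra: "\<not> ?thesis"
  have SV: "S \<subseteq> V" "card S \<le> n" using st by (auto simp: state_def)
  have fS: "finite S" using SV fin_V finite_subset by auto
  let ?W = "link u (lb u)"
  define slack_u where "slack_u = slack (S - {u}) S dm lb"
  have slack_u: "slack S S dm lb Z = slack_u Z - int (dm u + 2 - card (?W - S - Z))" for Z
    unfolding slack_u_def slack_def using fS u by (simp add: sum.remove)
  have ge: "slack S S dm lb Z \<ge> -2" if "Z \<subseteq> V - S" "card Z \<le> 4 * n" for Z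
    using gd that unfolding good_def by blast
  have small: "card Z \<le> 2 * n" if "Z \<subseteq> V - S" "card Z \<le> 4 * n + 1" "slack S S dm lb Z \<le> -2" for Z
    using slack_lower[OF st that(1,2)] that(3) SV(2) by linarith
  \<comment> \<open>Candidates with a second neighbour in the image; three of them would have potential \<open>-3\<close>.\<close>
  define B where "B = {z \<in> ?W - S. {y \<in> S. adj z y} \<noteq> {u}}"
  define F where "F = {z \<in> ?W - S. {y \<in> S. adj z y} = {u}}"
  have BV: "B \<subseteq> V - S" using link_subset by (auto simp: B_def)
  have finB: "finite B" using BV fin_V finite_subset by auto
  have "card B \<le> 2"
  proof (rule ccontr)
    assume "\<not> card B \<le> 2"
    then obtain Z where Z: "Z \<subseteq> B" "card Z = 3"
      using obtain_subset_with_card_n[of 3 B] by auto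
    have fZ: "finite Z" using Z finB finite_subset by auto
    have "(\<Sum>x\<in>Z. (2::int)) \<le> arcs Z S" unfolding arcs_def
    proof (intro sum_mono)
      fix x assume "x \<in> Z"
      then have x: "x \<in> B" using Z by auto
      have "u \<in> {y \<in> S. adj x y}" using x u sel_adj adj_sym by (auto simp: B_def link_def)
      moreover have "{y \<in> S. adj x y} \<noteq> {u}" using x unfolding B_def by blast
      ultimately have "{u} \<subset> {y \<in> S. adj x y}" by blast
      then have "1 < card {y \<in> S. adj x y}" using psubset_card_mono[of "{y \<in> S. adj x y}" "{u}"] fS by simp
      then show "2 \<le> (\<Sum>y\<in>S. of_bool (adj x y) :: int)" unfolding arcs_eq_card[OF fS] by linarith
    qed
    then have "6 \<le> arcs Z S" using Z by simp
    moreover have "arcs Z Z \<ge> 0" by (rule arcs_nonneg)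
    moreover have "slack S S dm lb Z \<le> 3 * int (card Z) - arcs Z Z - 2 * arcs Z S"
    proof -
      have "0 \<le> (\<Sum>x\<in>S. int (dm x + 2 - card (link x (lb x) - S - Z)))"
        "0 \<le> (\<Sum>x\<in>Z. \<Sum>l\<in>labels x. int (k + 2 - card (link x l - S - Z)))"
        by (intro sum_nonneg; simp)+
      then show ?thesis unfolding slack_def by linarith
    qed
    ultimately have "slack S S dm lb Z \<le> -3" using Z by simp
    moreover have "slack S S dm lb Z \<ge> -2" using Z BV n_pos by (intro ge) auto
    ultimately show False by simp
  qed
  have crit: "\<exists>Z. Z \<subseteq> V - S \<and> card Z \<le> 2 * n \<and> z \<in> Z \<and> slack_u Z \<le> -2" if z: "z \<in> F" for z
  proof -
    have zV: "z \<in> V - S" and nb: "{y \<in> S. adj z y} = {u}" and su: "sel u z" and la: "lab u z = lb u"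
      using z link_subset by (auto simp: F_def link_def)
    have su': "sel z u" using su by (rule sel_sym)
    have "\<not> good (insert z S) (dm(u := dm u - 1, z := k - 1)) (lb(z := lab z u))"
      using contra zV nb su la by blast
    then obtain Z where Z: "Z \<subseteq> V - insert z S" "card Z \<le> 4 * n"
      and bad': "\<not> slack (insert z S) (insert z S) (dm(u := dm u - 1, z := k - 1)) (lb(z := lab z u)) Z \<ge> -2"
      unfolding good_def by blast
    have bad: "slack (insert z S) (insert z S) (dm(u := dm u - 1, z := k - 1)) (lb(z := lab z u)) Z \<le> -3"
      using bad' by linarith
    have fZ: "finite Z" using Z fin_V finite_subset by auto
    have nz: "z \<notin> Z" "Z \<inter> S = {}" using Z by auto
    have st1: "slack S S dm lb (insert z Z) + of_bool (card (?W - S - insert z Z) < dm u + 2) \<le> -2"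
    proof -
      have arith: "a + b \<le> -2" if "a + b - 1 \<le> c" "c \<le> -3" for a b c :: int
        using that by linarith
      have "z \<notin> S" using zV by simp
      then show ?thesis by (rule arith[OF slack_step[where dm = dm, OF fS fZ _ nz u(1) su' nb u(2) k] bad])
    qed
    have iZ: "insert z Z \<subseteq> V - S" "card (insert z Z) \<le> 4 * n + 1"
      using Z zV fZ nz by auto
    have st2: "slack S S dm lb (insert z Z) \<le> -2"
      using st1 by (cases "card (?W - S - insert z Z) < dm u + 2") auto
    have sm: "card (insert z Z) \<le> 2 * n" by (intro small iZ st2)
    then have "slack S S dm lb (insert z Z) \<ge> -2" using iZ by (intro ge) auto
    then have "\<not> card (?W - S - insert z Z) < dm u + 2"
      using st1 by (cases "card (?W - S - insert z Z) < dm u + 2") auto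
    then have "slack_u (insert z Z) \<le> -2" using slack_u[of "insert z Z"] st2 by simp
    then show ?thesis using iZ sm by blast
  qed
  have FV: "F \<subseteq> V - S" using link_subset by (auto simp: F_def)
  have finF: "finite F" using FV fin_V finite_subset by auto
  have union: "\<exists>Z. Z \<subseteq> V - S \<and> card Z \<le> 2 * n \<and> F' \<subseteq> Z \<and> slack_u Z \<le> -2" if "F' \<subseteq> F" "F' \<noteq> {}" for F'
  proof -
    have "finite F'" using that finF finite_subset by auto
    then show ?thesis using that(2,1)
    proof (induction F' rule: finite_ne_induct)
      case (singleton z)
      then show ?case using crit[of z] by auto
    next
      case (insert z F')
      then obtain Z1 where Z1: "Z1 \<subseteq> V - S" "card Z1 \<le> 2 * n" "F' \<subseteq> Z1" "slack_u Z1 \<le> -2" by auto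
      obtain Z2 where Z2: "Z2 \<subseteq> V - S" "card Z2 \<le> 2 * n" "z \<in> Z2" "slack_u Z2 \<le> -2"
        using crit[of z] insert by auto
      have f: "finite Z1" "finite Z2" using Z1 Z2 fin_V by (auto intro: finite_subset)
      have c: "card (Z1 \<union> Z2) \<le> 4 * n" using card_Un_le[of Z1 Z2] Z1 Z2 by linarith
      have "card (Z1 \<inter> Z2) \<le> card Z1" using f by (intro card_mono) auto
      then have "slack S S dm lb (Z1 \<inter> Z2) \<ge> -2" using Z1 by (intro ge) auto
      then have "slack_u (Z1 \<inter> Z2) \<ge> -2" using slack_u[of "Z1 \<inter> Z2"] by linarith
      moreover have "slack_u (Z1 \<union> Z2) + slack_u (Z1 \<inter> Z2) \<le> slack_u Z1 + slack_u Z2"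
        unfolding slack_u_def by (rule slack_submodular[OF f])
      ultimately have p: "slack_u (Z1 \<union> Z2) \<le> -2" using Z1 Z2 by linarith
      then have "slack S S dm lb (Z1 \<union> Z2) \<le> -2" using slack_u[of "Z1 \<union> Z2"] by linarith
      then have "card (Z1 \<union> Z2) \<le> 2 * n" using Z1 Z2 c by (intro small) auto
      then show ?case using p Z1 Z2 by (intro exI[of _ "Z1 \<union> Z2"]) auto
    qed
  qed
  have WS: "card (?W \<inter> S) \<le> k"
  proof -
    have "card (?W \<inter> S) \<le> card {y \<in> S. adj u y}"
      using fS sel_adj by (intro card_mono) (auto simp: link_def)
    also have "\<dots> \<le> k" using st u by (auto simp: state_def)
    finally show ?thesis .
  qed
  have "card ?W \<le> card (?W \<inter> S) + card B + card F"
  proof -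
    have "?W = (?W \<inter> S) \<union> B \<union> F" by (auto simp: B_def F_def)
    then show ?thesis using card_Un3_le[of "?W \<inter> S" B F] by simp
  qed
  moreover have "18 * (k + 2) \<le> card ?W" using st u card_link[of "lb u" u] by (auto simp: state_def)
  ultimately have "18 * (k + 2) \<le> k + 2 + card F" using WS \<open>card B \<le> 2\<close> by linarith
  then have "card F > 0" by auto
  then have "F \<noteq> {}" by auto
  then obtain Z where Z: "Z \<subseteq> V - S" "card Z \<le> 2 * n" "F \<subseteq> Z" "slack_u Z \<le> -2" using union by blast
  have sub: "?W - S - Z \<subseteq> B" using Z by (auto simp: B_def F_def)
  have "card (?W - S - Z) \<le> 2" by (rule order_trans[OF card_mono[OF finB sub] \<open>card B \<le> 2\<close>])
  then have "slack S S dm lb Z \<le> -3" using slack_u[of Z] Z u by linarith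
  moreover have "slack S S dm lb Z \<ge> -2" using Z by (intro ge) auto
  ultimately show False by simp
qed

end

context split_host begin

lemma sel_label: "sel x y \<Longrightarrow> lab x y \<in> labels x"
  by (auto simp: labels_def)

lemma induced_tree_embedding:
  fixes T :: "'t sgraph"
  assumes T: "is_tree T" and card_T: "card (verts T) \<le> n" and deg: "max_degree T \<le> k" and k: "k \<ge> 1"
    and root: "sel x0 y0"
  shows "\<exists>f lb. inj_on f (verts T) \<and> f ` verts T \<subseteq> V \<and>
    (\<forall>s\<in>verts T. \<forall>t\<in>verts T. {s, t} \<in> edges T \<longleftrightarrow> adj (f s) (f t)) \<and>
    (\<forall>s\<in>verts T. \<forall>t\<in>verts T. {s, t} \<in> edges T \<longrightarrow> sel (f s) (f t) \<and> lab (f s) (f t) = lb s)"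
proof -
  have finT: "fin_sgraph T" using T by (simp add: is_tree_def)
  have fv: "finite (verts T)" using finT by (simp add: fin_sgraph_def)
  obtain r where r: "r \<in> verts T" using T by (auto simp: is_tree_def is_connected_def)
  define Nb where "Nb X t = {y \<in> X. {t, y} \<in> edges T}" for X t
  have Nb_le: "card (Nb X t) \<le> k" if "X \<subseteq> verts T" for X t
  proof -
    have "card (Nb X t) \<le> card {y \<in> verts T. {t, y} \<in> edges T}"
      unfolding Nb_def using that fv by (intro card_mono) auto
    then show ?thesis using card_neighbours_le_max_degree[OF finT, of t] deg by linarith
  qed
  define emb where "emb X f \<longleftrightarrow> inj_on f X \<and> f ` X \<subseteq> V \<and>
    (\<forall>s\<in>X. \<forall>t\<in>X. {s, t} \<in> edges T \<longleftrightarrow> adj (f s) (f t))" for X f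
  define sels where "sels X f lb \<longleftrightarrow> (\<forall>s\<in>X. \<forall>t\<in>X. {s, t} \<in> edges T \<longrightarrow>
    sel (f s) (f t) \<and> lab (f s) (f t) = lb (f s))" for X f lb
  define P where "P X \<longleftrightarrow> (\<exists>f lb dm. emb X f \<and> sels X f lb \<and>
    (\<forall>s\<in>X. dm (f s) = k - card (Nb X s)) \<and> (\<forall>s\<in>X. lb (f s) \<in> labels (f s)) \<and>
    2 * int (card X) - 2 \<le> arcs (f ` X) (f ` X) \<and> good (f ` X) dm lb)" for X
  have stateI: "state (f ` X) dm lb"
    if "X \<subseteq> verts T" "emb X f" "\<forall>s\<in>X. dm (f s) = k - card (Nb X s)" "\<forall>s\<in>X. lb (f s) \<in> labels (f s)"
      "2 * int (card X) - 2 \<le> arcs (f ` X) (f ` X)" for X f dm lb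
  proof -
    have inj: "inj_on f X" using that by (simp add: emb_def)
    have "card (f ` X) = card X" using inj by (rule card_image)
    moreover have "card X \<le> n" using that(1) fv card_T card_mono[of "verts T" X] by linarith
    moreover have "card {y \<in> f ` X. adj (f s) y} \<le> k" if s: "s \<in> X" for s
    proof -
      have "{y \<in> f ` X. adj (f s) y} = f ` Nb X s"
        using that \<open>emb X f\<close> by (auto simp: Nb_def emb_def)
      moreover have "finite (Nb X s)" using \<open>X \<subseteq> verts T\<close> fv by (auto simp: Nb_def intro: finite_subset)
      ultimately have "card {y \<in> f ` X. adj (f s) y} \<le> card (Nb X s)" by (simp add: card_image_le)
      then show ?thesis using Nb_le[OF \<open>X \<subseteq> verts T\<close>, of s] by linarith
    qed
    ultimately show ?thesis unfolding state_def using that by (auto simp: emb_def)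
  qed
  have PI: "P X" if "emb X f" "sels X f lb" "\<forall>s\<in>X. dm (f s) = k - card (Nb X s)"
      "\<forall>s\<in>X. lb (f s) \<in> labels (f s)" "2 * int (card X) - 2 \<le> arcs (f ` X) (f ` X)" "good (f ` X) dm lb"
    for X f lb dm
    unfolding P_def using that by (intro exI[of _ f] exI[of _ lb] exI[of _ dm]) simp
  have "P (verts T)"
  proof (rule tree_grow_induct[OF T r])
    have x0: "x0 \<in> V" using root sel_adj adj_V by blast
    let ?f = "\<lambda>_. x0" and ?lb = "\<lambda>_. lab x0 y0" and ?dm = "\<lambda>_. k"
    have "Nb {r} r = {}" using fin_sgraph_no_loop[OF finT, of r] by (auto simp: Nb_def)
    then have 1: "\<forall>s\<in>{r}. ?dm (?f s) = k - card (Nb {r} s)" by simp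
    have 2: "emb {r} ?f" using x0 adj_irrefl fin_sgraph_no_loop[OF finT, of r] by (auto simp: emb_def)
    have 3: "sels {r} ?f ?lb" using fin_sgraph_no_loop[OF finT, of r] by (auto simp: sels_def)
    have 4: "\<forall>s\<in>{r}. ?lb (?f s) \<in> labels (?f s)" using root by (auto intro: sel_label)
    have 5: "2 * int (card {r}) - 2 \<le> arcs (?f ` {r}) (?f ` {r})" using arcs_nonneg by simp
    have "state {x0} ?dm ?lb" using stateI[where X = "{r}" and f = ?f and dm = ?dm and lb = ?lb] 1 2 4 5 r by simp
    then have "good (?f ` {r}) ?dm ?lb" using good_root by simp
    then show "P {r}" using 1 2 3 4 5 by (intro PI[where f = ?f and lb = ?lb and dm = ?dm])
  next
    fix X p t
    assume X: "X \<subseteq> verts T" and PX: "P X" and p: "p \<in> X" and t: "t \<in> verts T - X"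
      and nb: "{y \<in> X. {t, y} \<in> edges T} = {p}"
    obtain f lb dm where f: "emb X f" "sels X f lb" "\<forall>s\<in>X. dm (f s) = k - card (Nb X s)"
      "\<forall>s\<in>X. lb (f s) \<in> labels (f s)" "2 * int (card X) - 2 \<le> arcs (f ` X) (f ` X)" "good (f ` X) dm lb"
      using PX unfolding P_def by blast
    have inj: "inj_on f X" using f by (simp add: emb_def)
    have fX: "finite X" using X fv finite_subset by auto
    have st: "state (f ` X) dm lb" by (rule stateI[where dm = dm and lb = lb, OF X f(1,3,4,5)])
    have NbX: "finite (Nb X s)" for s using fX by (simp add: Nb_def)
    have ptE: "{p, t} \<in> edges T" "{t, p} \<in> edges T" using nb by (auto simp: insert_commute)
    have Nb_p: "Nb (insert t X) p = insert t (Nb X p)" using ptE by (auto simp: Nb_def)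
    have t_out: "t \<notin> Nb X s" for s using t by (auto simp: Nb_def)
    have E_t: "{t, s} \<in> edges T \<longleftrightarrow> s = p" if "s \<in> X" for s using nb that by blast
    have E_t': "{s, t} \<in> edges T \<longleftrightarrow> s = p" if "s \<in> X" for s
      using E_t[OF that] by (simp add: insert_commute)
    have Nb_t: "Nb (insert t X) t = {p}"
      unfolding Nb_def nb[symmetric] using fin_sgraph_no_loop[OF finT, of t] by blast
    have Nb_s: "Nb (insert t X) s = Nb X s" if "s \<in> X" "s \<noteq> p" for s
      unfolding Nb_def using E_t'[OF that(1)] that(2) by blast
    have "card (insert t (Nb X p)) \<le> k" using Nb_le[of "insert t X" p] X t Nb_p by auto
    then have cp: "Suc (card (Nb X p)) \<le> k" using t_out NbX by simp
    then have "dm (f p) \<ge> 1" using f(3) p by simp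
    then obtain z where z: "z \<in> V - f ` X" "sel (f p) z" "lab (f p) z = lb (f p)"
        "{y \<in> f ` X. adj z y} = {f p}"
        "good (insert z (f ` X)) (dm(f p := dm (f p) - 1, z := k - 1)) (lb(z := lab z (f p)))"
      using good_extend[OF st f(6), of "f p"] p k by auto
    let ?g = "f(t := z)" and ?dm = "dm(f p := dm (f p) - 1, z := k - 1)" and ?lb = "lb(z := lab z (f p))"
    have gX: "?g ` insert t X = insert z (f ` X)" "?g ` X = f ` X" "\<And>s. s \<in> X \<Longrightarrow> ?g s = f s"
      using t by auto
    have zX: "f s \<noteq> z" if "s \<in> X" for s using z(1) that by auto
    have adj_z: "adj z (f s) \<longleftrightarrow> s = p" if "s \<in> X" for s
    proof -
      have "adj z (f s) \<longleftrightarrow> f s = f p" using z(4) that by blast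
      then show ?thesis using inj_on_eq_iff[OF inj that p] by simp
    qed
    have adj_z': "adj (f s) z \<longleftrightarrow> s = p" if "s \<in> X" for s
      using adj_z[OF that] adj_sym by blast
    have 1: "emb (insert t X) ?g"
      unfolding emb_def
    proof (intro conjI ballI)
      show "inj_on ?g (insert t X)"
        using inj zX t by (auto simp: inj_on_def)
      show "?g ` insert t X \<subseteq> V" unfolding gX using f(1) z by (auto simp: emb_def)
      fix a b assume ab: "a \<in> insert t X" "b \<in> insert t X"
      have old: "{a, b} \<in> edges T \<longleftrightarrow> adj (f a) (f b)" if "a \<in> X" "b \<in> X"
        using f(1) that by (simp add: emb_def)
      show "{a, b} \<in> edges T \<longleftrightarrow> adj (?g a) (?g b)"
        using ab t old adj_z adj_z' E_t E_t' adj_irrefl[of z] fin_sgraph_no_loop[OF finT, of t]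
        by (cases "a = t"; cases "b = t") auto
    qed
    have 2: "sels (insert t X) ?g ?lb"
      unfolding sels_def
    proof (intro ballI impI)
      fix a b assume ab: "a \<in> insert t X" "b \<in> insert t X" "{a, b} \<in> edges T"
      have old: "sel (f a) (f b) \<and> lab (f a) (f b) = lb (f a)" if "a \<in> X" "b \<in> X"
        using f(2) that ab by (simp add: sels_def)
      have "a \<noteq> b" using ab fin_sgraph_no_loop[OF finT, of a] by auto
      then consider "a = t" "b \<in> X" | "a \<in> X" "b = t" | "a \<in> X" "b \<in> X" using ab by auto
      then show "sel (?g a) (?g b) \<and> lab (?g a) (?g b) = ?lb (?g a)"
      proof cases
        case 1
        then have "b = p" using ab E_t by auto
        then show ?thesis using 1 t z(2) sel_sym gX(3)[of p] p by auto
      next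
        case 2
        then have "a = p" using ab E_t' by auto
        then show ?thesis using 2 t z(2,3) gX(3)[of p] p zX[of p] by auto
      next
        case 3
        then show ?thesis using old t zX by auto
      qed
    qed
    have 3: "\<forall>s\<in>insert t X. ?dm (?g s) = k - card (Nb (insert t X) s)"
    proof
      fix s assume s: "s \<in> insert t X"
      show "?dm (?g s) = k - card (Nb (insert t X) s)"
      proof (cases "s = t")
        case True
        then show ?thesis using Nb_t zX[OF p] by simp
      next
        case False
        then have sX: "s \<in> X" using s by auto
        show ?thesis
        proof (cases "s = p")
          case True
          then show ?thesis using Nb_p t_out NbX f(3) p False zX[OF p] by simp
        next
          case sp: False
          then have "f s \<noteq> f p" using inj sX p by (auto simp: inj_on_def)
          then show ?thesis using Nb_s[OF sX sp] f(3) sX False zX[OF sX] by simp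
        qed
      qed
    qed
    have 4: "\<forall>s\<in>insert t X. ?lb (?g s) \<in> labels (?g s)"
      using f(4) zX t z(2) by (auto intro: sel_label sel_sym)
    have 5: "2 * int (card (insert t X)) - 2 \<le> arcs (?g ` insert t X) (?g ` insert t X)"
    proof -
      let ?S = "f ` X"
      have fS: "finite ?S" using fX by simp
      have d: "?S \<inter> {z} = {}" using z(1) by auto
      have "arcs {z} ?S = int (card {y \<in> ?S. adj z y})" unfolding arcs_def using arcs_eq_card[OF fS] by simp
      then have 1: "arcs {z} ?S = 1" using z(4) by simp
      have "arcs (?S \<union> {z}) (?S \<union> {z}) = arcs ?S ?S + arcs ?S {z} + arcs {z} ?S + arcs {z} {z}"
        using arcs_Un[of ?S "{z}" "?S \<union> {z}"] arcs_Un_right[of ?S "{z}" ?S] arcs_Un_right[of ?S "{z}" "{z}"]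
          fS d by simp
      then have "arcs ?S ?S + 2 \<le> arcs (insert z ?S) (insert z ?S)"
        using 1 arcs_sym[of ?S "{z}"] arcs_nonneg[of "{z}" "{z}"] by simp
      then show ?thesis unfolding gX using f(5) fX t by simp
    qed
    have 6: "good (?g ` insert t X) ?dm ?lb" unfolding gX by (rule z(5))
    show "P (insert t X)" by (rule PI[where f = ?g and lb = ?lb and dm = ?dm, OF 1 2 3 4 5 6])
  qed
  then obtain f lb where f: "emb (verts T) f" "sels (verts T) f lb" unfolding P_def by blast
  then show ?thesis unfolding emb_def sels_def by (intro exI[of _ f] exI[of _ "lb \<circ> f"]) auto
qed

end

section \<open>The host graph and the induced blow-up\<close>

text \<open>Delete all members with some key that occurs fewer than \<open>d\<close> times. Each deletion
  removes a key and fewer than \<open>d\<close> members, so the members cannot run out.\<close>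

lemma dense_keys_subset:
  fixes K :: "'a \<Rightarrow> 'k set" and d :: nat
  assumes "finite Q" "\<And>u. u \<in> Q \<Longrightarrow> finite (K u)" "d * card (\<Union>u\<in>Q. K u) < card Q"
  shows "\<exists>Q'\<subseteq>Q. Q' \<noteq> {} \<and> (\<forall>u\<in>Q'. \<forall>\<kappa>\<in>K u. d \<le> card {u' \<in> Q'. \<kappa> \<in> K u'})"
  using assms
proof (induction "card Q" arbitrary: Q rule: less_induct)
  case less
  show ?case
  proof (cases "\<forall>u\<in>Q. \<forall>\<kappa>\<in>K u. d \<le> card {u' \<in> Q. \<kappa> \<in> K u'}")
    case True
    moreover have "Q \<noteq> {}" using less.prems(3) by auto
    ultimately show ?thesis by (intro exI[of _ Q]) simp
  next
    case False
    then obtain u \<kappa> where u: "u \<in> Q" "\<kappa> \<in> K u" "card {u' \<in> Q. \<kappa> \<in> K u'} < d" by (auto simp: not_le)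
    define Q1 where "Q1 = {u' \<in> Q. \<kappa> \<notin> K u'}"
    have fin: "finite (\<Union>u\<in>Q. K u)" "finite Q1" using less.prems by (auto simp: Q1_def)
    have Q_split: "Q1 \<union> {u' \<in> Q. \<kappa> \<in> K u'} = Q" by (auto simp: Q1_def)
    have c1: "card Q \<le> card Q1 + card {u' \<in> Q. \<kappa> \<in> K u'}"
      using card_Un_le[of Q1 "{u' \<in> Q. \<kappa> \<in> K u'}"] unfolding Q_split .
    have "u \<notin> Q1" "Q1 \<subseteq> Q" using u by (auto simp: Q1_def)
    then have "Q1 \<subset> Q" using u by blast
    then have lt: "card Q1 < card Q" using less.prems(1) by (intro psubset_card_mono) auto
    have "(\<Union>u\<in>Q1. K u) \<subseteq> (\<Union>u\<in>Q. K u) - {\<kappa>}" by (auto simp: Q1_def)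
    then have "card (\<Union>u\<in>Q1. K u) \<le> card ((\<Union>u\<in>Q. K u) - {\<kappa>})" using fin by (intro card_mono) auto
    also have "\<dots> < card (\<Union>u\<in>Q. K u)" using fin u by (intro psubset_card_mono) auto
    finally have "Suc (card (\<Union>u\<in>Q1. K u)) \<le> card (\<Union>u\<in>Q. K u)" by simp
    then have "d * Suc (card (\<Union>u\<in>Q1. K u)) \<le> d * card (\<Union>u\<in>Q. K u)" by (rule mult_le_mono2)
    then have "d * card (\<Union>u\<in>Q1. K u) < card Q1" using less.prems(3) c1 u(3) by simp
    then have "\<exists>Q'\<subseteq>Q1. Q' \<noteq> {} \<and> (\<forall>u\<in>Q'. \<forall>\<kappa>\<in>K u. d \<le> card {u' \<in> Q'. \<kappa> \<in> K u'})"
      using less.prems(2) \<open>Q1 \<subseteq> Q\<close> by (intro less.hyps[OF lt fin(2)]) auto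
    then obtain Q' where Q': "Q' \<subseteq> Q1 \<and> Q' \<noteq> {} \<and> (\<forall>u\<in>Q'. \<forall>\<kappa>\<in>K u. d \<le> card {u' \<in> Q'. \<kappa> \<in> K u'})"
      by (elim exE)
    then show ?thesis using \<open>Q1 \<subseteq> Q\<close> by (intro exI[of _ Q']) auto
  qed
qed

text \<open>The points \<open>(r, p)\<close> become the vertices \<open>Inl (r, p, s)\<close> with \<open>s < t\<close>, the hubs \<open>u\<close> become the
  vertices \<open>Inr (u, \<beta>)\<close>, where \<open>\<beta>\<close> lists the neighbours by part and index.\<close>

definition incidence_host :: "nat \<Rightarrow> nat \<Rightarrow> nat \<Rightarrow> nat \<Rightarrow> (nat \<Rightarrow> nat \<Rightarrow> nat)
    \<Rightarrow> (nat \<times> nat \<times> nat + nat \<times> (nat \<times> nat) set) sgraph" where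
  "incidence_host R N t M F = \<lparr>
     verts = Inl ` ({..<R} \<times> {..<N} \<times> {..<t}) \<union> Inr ` ({..<M} \<times> Pow ({..<R} \<times> {..<t})),
     edges = {{Inl (r, F u r, s), Inr (u, \<beta>)} | r s u \<beta>. u < M \<and> \<beta> \<subseteq> {..<R} \<times> {..<t} \<and> (r, s) \<in> \<beta>}\<rparr>"

lemma incidence_host_edgeE:
  assumes "e \<in> edges (incidence_host R N t M F)"
  obtains r s u \<beta> where "e = {Inl (r, F u r, s), Inr (u, \<beta>)}" "u < M" "\<beta> \<subseteq> {..<R} \<times> {..<t}" "(r, s) \<in> \<beta>"
proof -
  have "\<exists>r s u \<beta>. e = {Inl (r, F u r, s), Inr (u, \<beta>)} \<and> u < M \<and> \<beta> \<subseteq> {..<R} \<times> {..<t} \<and> (r, s) \<in> \<beta>"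
    using assms unfolding incidence_host_def sgraph.simps mem_Collect_eq .
  then show ?thesis using that by blast
qed

lemma incidence_host_edge_iff:
  "{Inl (r, p, s), Inr (u, \<beta>)} \<in> edges (incidence_host R N t M F) \<longleftrightarrow>
     u < M \<and> \<beta> \<subseteq> {..<R} \<times> {..<t} \<and> (r, s) \<in> \<beta> \<and> p = F u r"
  (is "?l = ?r")
proof
  assume ?l
  then obtain r' s' u' \<beta>' where "{Inl (r, p, s), Inr (u, \<beta>)} = {Inl (r', F u' r', s'), Inr (u', \<beta>')}"
    "u' < M" "\<beta>' \<subseteq> {..<R} \<times> {..<t}" "(r', s') \<in> \<beta>'" by (rule incidence_host_edgeE)
  then show ?r by (simp add: doubleton_eq_iff)
next
  assume ?r
  then show ?l unfolding incidence_host_def sgraph.simps mem_Collect_eq by blast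
qed

lemma incidence_host_bipartite:
  "{Inl x, Inl y} \<notin> edges (incidence_host R N t M F)" "{Inr x', Inr y'} \<notin> edges (incidence_host R N t M F)"
proof -
  have split: "Inl ` UNIV \<inter> e \<noteq> {} \<and> Inr ` UNIV \<inter> e \<noteq> {}" if e: "e \<in> edges (incidence_host R N t M F)" for e
    using e by (rule incidence_host_edgeE) blast
  show "{Inl x, Inl y} \<notin> edges (incidence_host R N t M F)" using split by blast
  show "{Inr x', Inr y'} \<notin> edges (incidence_host R N t M F)" using split by blast
qed

lemma fin_incidence_host:
  assumes "\<And>u r. u < M \<Longrightarrow> r < R \<Longrightarrow> F u r < N"
  shows "fin_sgraph (incidence_host R N t M F)"
  unfolding fin_sgraph_def
proof (intro conjI ballI)
  show "finite (verts (incidence_host R N t M F))" by (simp add: incidence_host_def)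
  fix e assume "e \<in> edges (incidence_host R N t M F)"
  then obtain r s u \<beta> where e: "e = {Inl (r, F u r, s), Inr (u, \<beta>)}" "u < M" "\<beta> \<subseteq> {..<R} \<times> {..<t}" "(r, s) \<in> \<beta>"
    by (rule incidence_host_edgeE)
  have "r < R" "s < t" using e by auto
  then show "e \<subseteq> verts (incidence_host R N t M F)" "card e = 2"
    using e assms[of u r] by (auto simp: incidence_host_def)
qed

lemma card_incidence_host:
  shows "card (verts (incidence_host R N t M F)) \<le> R * N * t + M * 2 ^ (R * t)"
    and "card (edges (incidence_host R N t M F)) \<le> M * 2 ^ (R * t) * (R * t)"
proof -
  have "card (verts (incidence_host R N t M F))
    \<le> card (Inl ` ({..<R} \<times> {..<N} \<times> {..<t}) :: (nat \<times> nat \<times> nat + nat \<times> (nat \<times> nat) set) set)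
      + card (Inr ` ({..<M} \<times> Pow ({..<R} \<times> {..<t})) :: (nat \<times> nat \<times> nat + nat \<times> (nat \<times> nat) set) set)"
    unfolding incidence_host_def sgraph.simps by (rule card_Un_le)
  also have "\<dots> \<le> card ({..<R} \<times> {..<N} \<times> {..<t}) + card ({..<M} \<times> Pow ({..<R} \<times> {..<t}))"
    by (intro add_mono card_image_le) auto
  also have "\<dots> = R * N * t + M * 2 ^ (R * t)"
    by (simp add: card_cartesian_product card_Pow)
  finally show "card (verts (incidence_host R N t M F)) \<le> R * N * t + M * 2 ^ (R * t)" .
  let ?D = "{..<M} \<times> Pow ({..<R} \<times> {..<t}) \<times> ({..<R} \<times> {..<t})"
  let ?f = "\<lambda>(u, \<beta>, r, s). {Inl (r, F u r, s), Inr (u, \<beta>)}"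
  have "edges (incidence_host R N t M F) \<subseteq> ?f ` ?D"
  proof
    fix e assume "e \<in> edges (incidence_host R N t M F)"
    then obtain r s u \<beta> where e: "e = {Inl (r, F u r, s), Inr (u, \<beta>)}" "u < M" "\<beta> \<subseteq> {..<R} \<times> {..<t}" "(r, s) \<in> \<beta>"
      by (rule incidence_host_edgeE)
    then show "e \<in> ?f ` ?D" by (intro image_eqI[of _ _ "(u, \<beta>, r, s)"]) auto
  qed
  then have "card (edges (incidence_host R N t M F)) \<le> card (?f ` ?D)"
    by (intro card_mono) auto
  also have "\<dots> \<le> card ?D" by (intro card_image_le) auto
  also have "\<dots> = M * 2 ^ (R * t) * (R * t)" by (simp add: card_cartesian_product card_Pow)
  finally show "card (edges (incidence_host R N t M F)) \<le> M * 2 ^ (R * t) * (R * t)" .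
qed

lemma pigeonhole_colour:
  fixes i :: "nat \<Rightarrow> nat"
  assumes "\<And>u. u < M \<Longrightarrow> i u < q" "q * B < M"
  shows "\<exists>j<q. B < card {u. u < M \<and> i u = j}"
proof (rule ccontr)
  assume "\<not> ?thesis"
  then have le: "card {u. u < M \<and> i u = j} \<le> B" if "j < q" for j
    using that by (meson not_less)
  have "{..<M} \<subseteq> (\<Union>j<q. {u. u < M \<and> i u = j})" using assms(1) by auto
  then have "card {..<M} \<le> card (\<Union>j<q. {u. u < M \<and> i u = j})" by (intro card_mono) auto
  also have "\<dots> \<le> (\<Sum>j<q. card {u. u < M \<and> i u = j})" by (intro card_UN_le) auto
  also have "\<dots> \<le> (\<Sum>j<q. B)" using le by (intro sum_mono) auto
  finally show False using assms(2) by simp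
qed

text \<open>Identifies the slots \<open>b < card S\<close> of a blown-up vertex with the elements of \<open>S\<close>.\<close>

definition enum :: "nat set \<Rightarrow> nat \<Rightarrow> nat" where
  "enum S b = sorted_list_of_set S ! b"

lemma enum_in: "finite S \<Longrightarrow> b < card S \<Longrightarrow> enum S b \<in> S"
  unfolding enum_def using nth_mem[of b "sorted_list_of_set S"] by simp

lemma enum_eq_iff: "finite S \<Longrightarrow> b < card S \<Longrightarrow> b' < card S \<Longrightarrow> enum S b = enum S b' \<longleftrightarrow> b = b'"
  unfolding enum_def by (simp add: nth_eq_iff_index_eq)

text \<open>The embedding \<open>f\<close> is induced, uses only the hubs in \<open>Q\<close> with the parts in \<open>J\<close>, and all the hubs that it
  uses at a point agree on the set of indices \<open>lb x\<close> that belongs to this point.\<close>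

definition incidence_embedding :: "'t sgraph \<Rightarrow> nat \<Rightarrow> nat \<Rightarrow> (nat \<Rightarrow> nat \<Rightarrow> nat) \<Rightarrow> nat set \<Rightarrow> (nat \<Rightarrow> nat set)
    \<Rightarrow> (nat \<Rightarrow> nat \<Rightarrow> nat set) \<Rightarrow> ('t \<Rightarrow> nat \<times> nat + nat) \<Rightarrow> ('t \<Rightarrow> nat set) \<Rightarrow> bool" where
  "incidence_embedding T M R F Q J A f lb \<longleftrightarrow> inj_on f (verts T) \<and>
    (\<forall>x\<in>verts T. \<forall>y\<in>verts T. \<forall>u r. u < M \<longrightarrow> r < R \<longrightarrow> f x = Inr u \<longrightarrow> f y = Inl (r, F u r) \<longrightarrow>
       {x, y} \<in> edges T) \<and>
    (\<forall>x\<in>verts T. \<forall>y\<in>verts T. {x, y} \<in> edges T \<longrightarrow>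
      (\<exists>u\<in>Q. \<exists>r\<in>J u. f x = Inr u \<and> f y = Inl (r, F u r) \<and> lb y = A u r \<or>
                       f y = Inr u \<and> f x = Inl (r, F u r) \<and> lb x = A u r))"

text \<open>Applies the embedding theorem to the incidence graph, restricted to the hubs that survive the
  deletion. The label of an edge at a point is the set \<open>A u r\<close> of the hub; at a hub there is a
  single class.\<close>

lemma tree_in_incidence:
  fixes T :: "'t sgraph" and F :: "nat \<Rightarrow> nat \<Rightarrow> nat" and J :: "nat \<Rightarrow> nat set" and A :: "nat \<Rightarrow> nat \<Rightarrow> nat set"
  assumes T: "is_tree T" "card (verts T) \<le> n" "max_degree T \<le> k" and k: "k \<ge> 1"
    and d: "d = 18 * (k + 2)"
    and F: "sparse_incidence n R N M F"
    and Q: "Q \<subseteq> {..<M}" "d * (R * N * 2 ^ t) < card Q"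
    and J: "\<And>u. u \<in> Q \<Longrightarrow> J u \<subseteq> {..<R} \<and> card (J u) = d"
    and A: "\<And>u r. u \<in> Q \<Longrightarrow> A u r \<subseteq> {..<t}"
  shows "\<exists>f lb. incidence_embedding T M R F Q J A f lb"
proof -
  note FN = F[unfolded sparse_incidence_def, THEN conjunct1, rule_format]
    and sparse = F[unfolded sparse_incidence_def, THEN conjunct2, rule_format]
  define K where "K u = (\<lambda>r. (r, F u r, A u r)) ` J u" for u
  have finQ: "finite Q" using Q by (auto intro: finite_subset)
  have finJ: "finite (J u)" if "u \<in> Q" for u using J[OF that] by (auto intro: finite_subset)
  have "(\<Union>u\<in>Q. K u) \<subseteq> {..<R} \<times> {..<N} \<times> Pow {..<t}"
  proof -
    have "K u \<subseteq> {..<R} \<times> {..<N} \<times> Pow {..<t}" if u: "u \<in> Q" for u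
    proof -
      have "u < M" using u Q by auto
      moreover have "r < R" if "r \<in> J u" for r using J[OF u] that by auto
      moreover have "s < t" if "s \<in> A u r" for r s using A[OF u, of r] that by auto
      ultimately show ?thesis using FN by (auto simp: K_def)
    qed
    then show ?thesis by blast
  qed
  then have "card (\<Union>u\<in>Q. K u) \<le> card ({..<R} \<times> {..<N} \<times> Pow {..<t})" by (intro card_mono) auto
  also have "\<dots> = R * N * 2 ^ t" by (simp add: card_cartesian_product card_Pow)
  finally have "d * card (\<Union>u\<in>Q. K u) < card Q" using Q(2) by (meson le_less_trans mult_le_mono2)
  moreover have "finite (K u)" if "u \<in> Q" for u using finJ[OF that] by (simp add: K_def)
  ultimately obtain Q' where Q': "Q' \<subseteq> Q" "Q' \<noteq> {}"
    "\<And>u \<kappa>. u \<in> Q' \<Longrightarrow> \<kappa> \<in> K u \<Longrightarrow> d \<le> card {u' \<in> Q'. \<kappa> \<in> K u'}"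
    using dense_keys_subset[OF finQ, of K d] by blast
  define V :: "(nat \<times> nat + nat) set" where "V = Inl ` ({..<R} \<times> {..<N}) \<union> Inr ` {..<M}"
  define adj where "adj x y \<longleftrightarrow> (\<exists>u r. u < M \<and> r < R \<and>
     (x = Inr u \<and> y = Inl (r, F u r) \<or> x = Inl (r, F u r) \<and> y = Inr u))" for x y :: "nat \<times> nat + nat"
  define sel where "sel x y \<longleftrightarrow> (\<exists>u\<in>Q'. \<exists>r\<in>J u.
     (x = Inr u \<and> y = Inl (r, F u r) \<or> x = Inl (r, F u r) \<and> y = Inr u))" for x y :: "nat \<times> nat + nat"
  define lab :: "nat \<times> nat + nat \<Rightarrow> nat \<times> nat + nat \<Rightarrow> nat set" where
    "lab x y = (case x of Inl (r, p) \<Rightarrow> (case y of Inr u \<Rightarrow> A u r | _ \<Rightarrow> {}) | _ \<Rightarrow> {})" for x y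
  have Q'M: "u < M" "J u \<subseteq> {..<R}" "card (J u) = d" if "u \<in> Q'" for u
  proof -
    have "u \<in> Q" using that Q'(1) by blast
    then show "u < M" "J u \<subseteq> {..<R}" "card (J u) = d" using Q(1) J[of u] by auto
  qed
  have "card (verts T) > 0"
    using T(1) unfolding is_tree_def is_connected_def fin_sgraph_def card_gt_0_iff by blast
  then have n: "n \<ge> 1" using T(2) by linarith
  have selV: "y \<in> V" if sxy: "sel x y" for x y
  proof -
    obtain u r where ur: "u \<in> Q'" "r \<in> J u" "y = Inl (r, F u r) \<or> y = Inr u"
      using sxy unfolding sel_def by blast
    have "r < R" "u < M" using Q'M[OF ur(1)] ur(2) by auto
    then show ?thesis using ur(3) FN[of u r] by (auto simp: V_def)
  qed
  interpret split_host V adj sel lab n k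
  proof
    show "finite V" by (simp add: V_def)
    show "x \<in> V" if "adj x y" for x y using that FN by (auto simp: adj_def V_def)
    show "adj y x" if "adj x y" for x y using that by (auto simp: adj_def)
    show "\<not> adj x x" for x by (auto simp: adj_def)
    show "adj x y" if "sel x y" for x y using that Q'M unfolding sel_def adj_def by blast
    show "sel y x" if "sel x y" for x y using that by (auto simp: sel_def)
    show "1 \<le> n" by (rule n)
  next
    fix X assume X: "X \<subseteq> V" "card X \<le> 6 * n"
    have finX: "finite X" using X by (auto simp: V_def intro: finite_subset)
    define P where "P = {(u, r). r < R \<and> Inr u \<in> X \<and> Inl (r, F u r) \<in> X}"
    have finP: "finite P"
    proof -
      have "P \<subseteq> {..<M} \<times> {..<R}" using X by (auto simp: P_def V_def)
      then show ?thesis by (rule finite_subset) auto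
    qed
    let ?f = "\<lambda>(u, r). (Inr u, Inl (r, F u r)) :: (nat \<times> nat + nat) \<times> (nat \<times> nat + nat)"
    have "{p \<in> X \<times> X. adj (fst p) (snd p)} \<subseteq> ?f ` P \<union> (prod.swap \<circ> ?f) ` P"
    proof
      fix p assume "p \<in> {p \<in> X \<times> X. adj (fst p) (snd p)}"
      then have p: "fst p \<in> X" "snd p \<in> X" "adj (fst p) (snd p)" by auto
      then obtain u r where ur: "r < R" "p = (Inr u, Inl (r, F u r)) \<or> p = (Inl (r, F u r), Inr u)"
        unfolding adj_def by (metis prod.collapse)
      then have "(u, r) \<in> P" using p by (auto simp: P_def)
      moreover have "p = ?f (u, r) \<or> p = (prod.swap \<circ> ?f) (u, r)" using ur by simp
      ultimately show "p \<in> ?f ` P \<union> (prod.swap \<circ> ?f) ` P" by blast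
    qed
    then have "card {p \<in> X \<times> X. adj (fst p) (snd p)} \<le> card (?f ` P \<union> (prod.swap \<circ> ?f) ` P)"
      using finP by (intro card_mono) auto
    also have "\<dots> \<le> card (?f ` P) + card ((prod.swap \<circ> ?f) ` P)" by (rule card_Un_le)
    also have "\<dots> \<le> card P + card P" using finP by (intro add_mono card_image_le) auto
    finally have c: "card {p \<in> X \<times> X. adj (fst p) (snd p)} \<le> 2 * card P" by simp
    have "(\<Sum>x\<in>X. \<Sum>y\<in>X. of_bool (adj x y) :: int) = (\<Sum>p\<in>X \<times> X. of_bool (adj (fst p) (snd p)))"
      by (simp add: sum.cartesian_product case_prod_beta)
    also have "\<dots> = int (card {p \<in> X \<times> X. adj (fst p) (snd p)})"
      using finX by (simp add: Int_def)
    finally have "2 * (\<Sum>x\<in>X. \<Sum>y\<in>X. of_bool (adj x y) :: int) \<le> int (4 * card P)" using c by simp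
    also have "\<dots> \<le> int (5 * card X)" using sparse[OF X[unfolded V_def]] by (simp add: P_def)
    finally show "2 * (\<Sum>x\<in>X. \<Sum>y\<in>X. of_bool (adj x y) :: int) \<le> 5 * int (card X)" by simp
  next
    fix x y assume "sel x y"
    then obtain u r where ur: "u \<in> Q'" "r \<in> J u" and
      "x = Inr u \<and> y = Inl (r, F u r) \<or> x = Inl (r, F u r) \<and> y = Inr u" unfolding sel_def by blast
    then consider "x = Inr u" "y = Inl (r, F u r)" | "x = Inl (r, F u r)" "y = Inr u" by blast
    then show "18 * (k + 2) \<le> card {z. sel x z \<and> lab x z = lab x y}"
    proof cases
      case 1
      have "card (J u) = card ((\<lambda>r. Inl (r, F u r)) ` J u :: (nat \<times> nat + nat) set)"
        by (intro card_image[symmetric]) (auto simp: inj_on_def)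
      also have "\<dots> \<le> card {z. sel x z \<and> lab x z = lab x y}"
      proof (intro card_mono)
        have "{z. sel x z \<and> lab x z = lab x y} \<subseteq> V" using selV by blast
        then show "finite {z. sel x z \<and> lab x z = lab x y}" by (rule finite_subset) (simp add: V_def)
        show "(\<lambda>r. Inl (r, F u r)) ` J u \<subseteq> {z. sel x z \<and> lab x z = lab x y}"
        proof
          fix z :: "nat \<times> nat + nat" assume "z \<in> (\<lambda>r. Inl (r, F u r)) ` J u"
          then obtain r' where r': "z = Inl (r', F u r')" "r' \<in> J u" by blast
          have "sel x z" unfolding sel_def 1(1) r'(1) using ur(1) r'(2) by blast
          moreover have "lab x z = lab x y" unfolding lab_def 1 by simp
          ultimately show "z \<in> {z. sel x z \<and> lab x z = lab x y}" by simp
        qed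
      qed
      finally show ?thesis using Q'M(3)[OF ur(1)] d by simp
    next
      case 2
      have "d \<le> card {u' \<in> Q'. (r, F u r, A u r) \<in> K u'}"
        using ur by (intro Q'(3)[of u]) (auto simp: K_def)
      also have "\<dots> = card (Inr ` {u' \<in> Q'. (r, F u r, A u r) \<in> K u'} :: (nat \<times> nat + nat) set)"
        by (intro card_image[symmetric]) (auto simp: inj_on_def)
      also have "\<dots> \<le> card {z. sel x z \<and> lab x z = lab x y}"
      proof (intro card_mono)
        have "{z. sel x z \<and> lab x z = lab x y} \<subseteq> V" using selV by blast
        then show "finite {z. sel x z \<and> lab x z = lab x y}" by (rule finite_subset) (simp add: V_def)
        show "Inr ` {u' \<in> Q'. (r, F u r, A u r) \<in> K u'} \<subseteq> {z. sel x z \<and> lab x z = lab x y}"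
        proof
          fix z :: "nat \<times> nat + nat" assume "z \<in> Inr ` {u' \<in> Q'. (r, F u r, A u r) \<in> K u'}"
          then obtain u' where u': "z = Inr u'" "u' \<in> Q'" "(r, F u r, A u r) \<in> K u'" by blast
          then have eq: "r \<in> J u'" "F u r = F u' r" "A u r = A u' r" by (auto simp: K_def)
          have "sel x z" unfolding sel_def 2(1) u'(1) eq(2) using u'(2) eq(1) by blast
          moreover have "lab x z = lab x y" unfolding lab_def 2 u'(1) using eq(3) by simp
          ultimately show "z \<in> {z. sel x z \<and> lab x z = lab x y}" by simp
        qed
      qed
      finally show ?thesis using d by simp
    qed
  qed
  obtain u0 where u0: "u0 \<in> Q'" using Q' by blast
  have "J u0 \<noteq> {}" using Q'M(3)[OF u0] d by auto
  then obtain r0 where "r0 \<in> J u0" by blast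
  then have "sel (Inr u0) (Inl (r0, F u0 r0))" using u0 unfolding sel_def by blast
  from induced_tree_embedding[OF T k this]
  obtain f lb where f0: "inj_on f (verts T) \<and> f ` verts T \<subseteq> V \<and>
    (\<forall>x\<in>verts T. \<forall>y\<in>verts T. {x, y} \<in> edges T \<longleftrightarrow> adj (f x) (f y)) \<and>
    (\<forall>x\<in>verts T. \<forall>y\<in>verts T. {x, y} \<in> edges T \<longrightarrow> sel (f x) (f y) \<and> lab (f x) (f y) = lb x)"
    by (elim exE)
  note f = f0[THEN conjunct1] f0[THEN conjunct2, THEN conjunct1]
    f0[THEN conjunct2, THEN conjunct2, THEN conjunct1, rule_format]
    f0[THEN conjunct2, THEN conjunct2, THEN conjunct2, rule_format]
  show ?thesis
    unfolding incidence_embedding_def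
  proof (intro exI[of _ f] exI[of _ lb] conjI ballI impI allI)
    show "inj_on f (verts T)" by (rule f(1))
  next
    fix x y u r assume "x \<in> verts T" "y \<in> verts T" "u < M" "r < R" "f x = Inr u" "f y = Inl (r, F u r)"
    moreover from this have "adj (f x) (f y)" unfolding adj_def by blast
    ultimately show "{x, y} \<in> edges T" using f(3)[of x y] by blast
  next
    fix x y assume xy: "x \<in> verts T" "y \<in> verts T" "{x, y} \<in> edges T"
    have 1: "sel (f x) (f y)" "lab (f x) (f y) = lb x" using f(4)[OF xy] by auto
    have "{y, x} \<in> edges T" using xy by (simp add: insert_commute)
    then have 2: "lab (f y) (f x) = lb y" using f(4)[OF xy(2,1)] by auto
    obtain u r where ur: "u \<in> Q'" "r \<in> J u"
      "f x = Inr u \<and> f y = Inl (r, F u r) \<or> f x = Inl (r, F u r) \<and> f y = Inr u"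
      using 1(1) unfolding sel_def by blast
    show "\<exists>u\<in>Q. \<exists>r\<in>J u. f x = Inr u \<and> f y = Inl (r, F u r) \<and> lb y = A u r \<or>
                       f y = Inr u \<and> f x = Inl (r, F u r) \<and> lb x = A u r"
    proof (rule bexI[of _ u], rule bexI[of _ r])
      show "f x = Inr u \<and> f y = Inl (r, F u r) \<and> lb y = A u r \<or>
        f y = Inr u \<and> f x = Inl (r, F u r) \<and> lb x = A u r"
        using ur(3)
      proof
        assume e: "f x = Inr u \<and> f y = Inl (r, F u r)"
        have "lb y = A u r" unfolding 2[symmetric] lab_def by (simp add: e)
        then show ?thesis using e by blast
      next
        assume e: "f x = Inl (r, F u r) \<and> f y = Inr u"
        have "lb x = A u r" unfolding 1(2)[symmetric] lab_def by (simp add: e)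
        then show ?thesis using e by blast
      qed
      show "r \<in> J u" by (rule ur)
      show "u \<in> Q" using ur(1) Q'(1) by blast
    qed
  qed
qed

text \<open>Injective numberings of the fibres of the blow-up.\<close>

lemma blowup_slots:
  fixes H :: "'h sgraph" and T :: "'t sgraph"
  assumes "finite (verts H)" "\<forall>v\<in>verts T. card {h \<in> verts H. \<phi> h = v} \<le> w" "\<phi> ` verts H \<subseteq> verts T"
  obtains b :: "'h \<Rightarrow> nat" where "\<And>h. h \<in> verts H \<Longrightarrow> b h < w"
    "\<And>h h'. h \<in> verts H \<Longrightarrow> h' \<in> verts H \<Longrightarrow> \<phi> h = \<phi> h' \<Longrightarrow> b h = b h' \<Longrightarrow> h = h'"
proof -
  have "\<exists>g::'h \<Rightarrow> nat. inj_on g {h \<in> verts H. \<phi> h = v} \<and> (\<forall>h\<in>{h \<in> verts H. \<phi> h = v}. g h < card {h \<in> verts H. \<phi> h = v})" for v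
  proof -
    obtain f :: "'h \<Rightarrow> nat" and n where f: "f ` {h \<in> verts H. \<phi> h = v} = {i. i < n}" "inj_on f {h \<in> verts H. \<phi> h = v}"
      using finite_imp_inj_to_nat_seg[of "{h \<in> verts H. \<phi> h = v}"] assms(1) by auto
    have "n = card {h \<in> verts H. \<phi> h = v}" using card_image[OF f(2)] f(1) by simp
    then show ?thesis using f by (intro exI[of _ f]) blast
  qed
  then obtain g where g: "\<And>v. inj_on (g v) {h \<in> verts H. \<phi> h = v}"
    "\<And>v h. h \<in> {h \<in> verts H. \<phi> h = v} \<Longrightarrow> (g v h :: nat) < card {h \<in> verts H. \<phi> h = v}" by metis
  show ?thesis
  proof (rule that[of "\<lambda>h. g (\<phi> h) h"])
    fix h assume h: "h \<in> verts H"
    have "g (\<phi> h) h < card {h' \<in> verts H. \<phi> h' = \<phi> h}" using g(2) h by simp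
    also have "\<dots> \<le> w" using assms(2,3) h by blast
    finally show "g (\<phi> h) h < w" .
  next
    fix h h' assume "h \<in> verts H" "h' \<in> verts H" "\<phi> h = \<phi> h'" "g (\<phi> h) h = g (\<phi> h') h'"
    then show "h = h'" using g(1)[of "\<phi> h"] by (auto dest: inj_onD)
  qed
qed

text \<open>The embedding of \<open>T\<close> into the incidence graph decides where the fibres of \<open>H\<close> go, and the elements of the
  common set at a point serve as the fibre over it. A vertex \<open>h\<close> over a hub \<open>u\<close> is a subset \<open>\<beta>\<close> that cuts
  out the neighbourhood of \<open>h\<close> in the colour \<open>i0\<close>. Distinct vertices over the same hub may have the same neighbourhood; they
  are told apart by one more element of \<open>\<beta>\<close> in a part that \<open>T\<close> does not use at this
  hub. There is one because \<open>T\<close> uses at most \<open>k < d\<close> of the parts in \<open>J u\<close>. There are no further edges because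
  the copy of \<open>T\<close> is induced in the incidence graph.\<close>

lemma incidence_host_arrows:
  fixes T :: "'t sgraph" and H :: "'h sgraph" and F :: "nat \<Rightarrow> nat \<Rightarrow> nat"
  assumes T: "is_tree T" "card (verts T) \<le> n" "max_degree T \<le> k"
    and nbr: "\<And>x. x \<in> verts T \<Longrightarrow> \<exists>y\<in>verts T. {x, y} \<in> edges T"
    and pos: "q \<ge> 1" "w \<ge> 1" "l \<ge> 1" "k \<ge> 1" and ql: "q \<le> 2 ^ l"
    and d: "d = 18 * (k + 2)" and R: "R = 4 * d * q\<^sup>2" and t: "t = 32 * q\<^sup>2 * l * w"
    and M: "q * (d * (R * N * 2 ^ t)) < M"
    and F: "sparse_incidence n R N M F"
    and H: "fin_sgraph H" "is_blowup w H T"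
  shows "ind_arrows (incidence_host R N t M F) H q"
  unfolding ind_arrows_def
proof (intro allI impI)
  let ?G = "incidence_host R N t M F"
  let ?Y = "{..<R} \<times> {..<t}"
  note FN = F[unfolded sparse_incidence_def, THEN conjunct1, rule_format]
  fix c assume c: "c ` edges ?G \<subseteq> {..<q}"
  define col where "col u \<beta> = (\<lambda>(r, s). c {Inl (r, F u r, s), Inr (u, \<beta>)})" for u \<beta>
  have "\<exists>i J A. i < q \<and> J \<subseteq> {..<R} \<and> card J = d \<and> (\<forall>r. A r \<subseteq> {..<t}) \<and> (\<forall>r\<in>J. card (A r) = w) \<and>
      shattered (col u) i (Pow ?Y) (SIGMA r:J. A r)" if u: "u < M" for u
  proof -
    have "col u \<beta> y < q" if y: "\<beta> \<subseteq> ?Y" "y \<in> \<beta>" for \<beta> y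
    proof -
      obtain r s where rs: "y = (r, s)" by (cases y)
      have "{Inl (r, F u r, s), Inr (u, \<beta>)} \<in> edges ?G"
        using y u rs by (simp add: incidence_host_edge_iff)
      then show ?thesis using c rs by (auto simp: col_def)
    qed
    moreover have "d \<ge> 1" using d by simp
    ultimately show ?thesis
      using exists_joint_shattering[OF pos(1-3) _ ql R t, of "col u"] by blast
  qed
  then obtain i J A where iJA: "\<And>u. u < M \<Longrightarrow> i u < q"
    "\<And>u. u < M \<Longrightarrow> J u \<subseteq> {..<R} \<and> card (J u) = d"
    "\<And>u r. u < M \<Longrightarrow> A u r \<subseteq> {..<t}"
    "\<And>u r. u < M \<Longrightarrow> r \<in> J u \<Longrightarrow> card (A u r) = w"
    "\<And>u. u < M \<Longrightarrow> shattered (col u) (i u) (Pow ?Y) (SIGMA r:J u. A u r)"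
    by metis
  obtain i0 where i0: "d * (R * N * 2 ^ t) < card {u. u < M \<and> i u = i0}"
    using pigeonhole_colour[of M i q, OF iJA(1) M] by blast
  define Q where "Q = {u. u < M \<and> i u = i0}"
  have QM: "u < M" "i u = i0" if "u \<in> Q" for u using that by (auto simp: Q_def)
  have "Q \<subseteq> {..<M}" by (auto simp: Q_def)
  have JQ: "J u \<subseteq> {..<R} \<and> card (J u) = d" and AQ: "A u r \<subseteq> {..<t}" if "u \<in> Q" for u r
    using iJA(2,3) QM(1)[OF that] by auto
  have "\<exists>f lb. incidence_embedding T M R F Q J A f lb"
  proof (rule tree_in_incidence[OF T pos(4) d])
    show "sparse_incidence n R N M F" by (rule F)
    show "Q \<subseteq> {..<M}" by fact
    show "d * (R * N * 2 ^ t) < card Q" using i0 unfolding Q_def .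
    show "J u \<subseteq> {..<R} \<and> card (J u) = d" if "u \<in> Q" for u using that by (rule JQ)
    show "A u r \<subseteq> {..<t}" if "u \<in> Q" for u r using that by (rule AQ)
  qed
  then obtain f lb where emb: "incidence_embedding T M R F Q J A f lb" by blast
  note emb = emb[unfolded incidence_embedding_def]
  have f_inj: "inj_on f (verts T)" using emb by (rule conjunct1)
  note f_ind = emb[THEN conjunct2, THEN conjunct1, rule_format]
    and f_edge = emb[THEN conjunct2, THEN conjunct2, rule_format]
  have finT: "fin_sgraph T" using T(1) by (simp add: is_tree_def)
  have hub_edge: "u \<in> Q \<and> (\<exists>r\<in>J u. f y = Inl (r, F u r) \<and> lb y = A u r)"
    if e: "{x, y} \<in> edges T" and fx: "f x = Inr u" for x y u
  proof -
    have "x \<in> verts T" "y \<in> verts T" using fin_sgraph_edge_verts[OF finT e] by auto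
    then obtain u' r where "u' \<in> Q" "r \<in> J u'"
      and alt: "f x = Inr u' \<and> f y = Inl (r, F u' r) \<and> lb y = A u' r \<or>
                       f y = Inr u' \<and> f x = Inl (r, F u' r) \<and> lb x = A u' r"
      using f_edge[OF _ _ e] by blast
    have "f x = Inr u' \<and> f y = Inl (r, F u' r) \<and> lb y = A u' r" using alt fx by simp
    then show ?thesis using fx \<open>u' \<in> Q\<close> \<open>r \<in> J u'\<close> by auto
  qed
  have leaf_edge: "\<exists>u\<in>Q. f y = Inr u \<and> r \<in> J u \<and> p = F u r \<and> lb x = A u r"
    if e: "{x, y} \<in> edges T" and fx: "f x = Inl (r, p)" for x y r p
  proof -
    have "x \<in> verts T" "y \<in> verts T" using fin_sgraph_edge_verts[OF finT e] by auto
    then obtain u' r' where "u' \<in> Q" "r' \<in> J u'"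
      and alt: "f x = Inr u' \<and> f y = Inl (r', F u' r') \<and> lb y = A u' r' \<or>
                       f y = Inr u' \<and> f x = Inl (r', F u' r') \<and> lb x = A u' r'"
      using f_edge[OF _ _ e] by blast
    have "f y = Inr u' \<and> f x = Inl (r', F u' r') \<and> lb x = A u' r'" using alt fx by simp
    then show ?thesis using fx \<open>u' \<in> Q\<close> \<open>r' \<in> J u'\<close> by auto
  qed
  have leaf: "card (lb x) = w" "finite (lb x)" "lb x \<subseteq> {..<t}" if x: "x \<in> verts T" "f x = Inl rp" for x rp
  proof -
    obtain y where y: "{x, y} \<in> edges T" using nbr[OF x(1)] by blast
    obtain r p where "rp = (r, p)" by (cases rp)
    then obtain u where u: "u \<in> Q" "r \<in> J u" "lb x = A u r" using leaf_edge[OF y, of r p] x(2) by blast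
    show "card (lb x) = w" using iJA(4)[OF QM(1)[OF u(1)] u(2)] u(3) by simp
    show "lb x \<subseteq> {..<t}" using AQ[OF u(1)] u(3) by simp
    then show "finite (lb x)" by (rule finite_subset) simp
  qed
  have hub: "u \<in> Q" if x: "x \<in> verts T" "f x = Inr u" for x u
    using nbr[OF x(1)] hub_edge[OF _ x(2)] by blast
  obtain \<phi> where \<phi>: "\<phi> ` verts H \<subseteq> verts T" "\<forall>u v. {u, v} \<in> edges H \<longrightarrow> {\<phi> u, \<phi> v} \<in> edges T"
    "\<forall>v\<in>verts T. card {h \<in> verts H. \<phi> h = v} \<le> w" using H(2) unfolding is_blowup_def by blast
  have \<phi>V: "\<phi> h \<in> verts T" if "h \<in> verts H" for h using \<phi>(1) that by blast
  have \<phi>E: "{\<phi> h, \<phi> h'} \<in> edges T" if "{h, h'} \<in> edges H" for h h' using \<phi>(2) that by blast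
  have HV: "h \<in> verts H" "h' \<in> verts H" if "{h, h'} \<in> edges H" for h h'
    using fin_sgraph_edge_verts[OF H(1) that] by auto
  have "finite (verts H)" using H(1) by (simp add: fin_sgraph_def)
  then obtain b where b: "\<And>h. h \<in> verts H \<Longrightarrow> b h < w"
    "\<And>h h'. h \<in> verts H \<Longrightarrow> h' \<in> verts H \<Longrightarrow> \<phi> h = \<phi> h' \<Longrightarrow> b h = b h' \<Longrightarrow> h = h'"
    using blowup_slots[OF _ \<phi>(3,1)] by metis
  define slot where "slot h = enum (lb (\<phi> h)) (b h)" for h
  have slot_in: "slot h \<in> lb (\<phi> h)" if h: "h \<in> verts H" "f (\<phi> h) = Inl rp" for h rp
    unfolding slot_def using leaf[OF \<phi>V[OF h(1)] h(2)] b(1)[OF h(1)] by (intro enum_in) auto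
  have slot_eq: "h = h'" if h: "h \<in> verts H" "h' \<in> verts H" "f (\<phi> h) = Inl rp" "\<phi> h = \<phi> h'" "slot h = slot h'"
    for h h' rp
  proof -
    have "b h = b h'"
      using h(5) enum_eq_iff[of "lb (\<phi> h)" "b h" "b h'"] leaf[OF \<phi>V[OF h(1)] h(3)] b(1) h(1,2)
      unfolding slot_def h(4)[symmetric] by simp
    then show ?thesis using b(2) h by blast
  qed
  \<comment> \<open>The parts of the hub that carry neighbours of \<open>x\<close> in the tree.\<close>
  define Bl where "Bl x u = {r \<in> J u. \<exists>y\<in>verts T. {x, y} \<in> edges T \<and> f y = Inl (r, F u r)}" for x u
  have r0_ex: "\<exists>r. r \<in> J u \<and> r \<notin> Bl x u" if u: "u \<in> Q" for x u
  proof -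
    have fin: "finite {y \<in> verts T. {x, y} \<in> edges T}" using finT by (simp add: fin_sgraph_def)
    have "Bl x u \<subseteq> (\<lambda>y. fst (projl (f y))) ` {y \<in> verts T. {x, y} \<in> edges T}"
    proof
      fix r assume "r \<in> Bl x u"
      then obtain y where y: "y \<in> verts T" "{x, y} \<in> edges T" "f y = Inl (r, F u r)" unfolding Bl_def by blast
      then show "r \<in> (\<lambda>y. fst (projl (f y))) ` {y \<in> verts T. {x, y} \<in> edges T}"
        by (intro image_eqI[of _ _ y]) simp_all
    qed
    then have "card (Bl x u) \<le> card {y \<in> verts T. {x, y} \<in> edges T}"
      using fin by (meson surj_card_le)
    also have "\<dots> \<le> k" using card_neighbours_le_max_degree[OF finT, of x] T(3) by linarith
    also have "\<dots> < card (J u)" using JQ[OF u] d by simp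
    finally have "\<not> J u \<subseteq> Bl x u"
      using card_mono[of "Bl x u" "J u"] JQ[OF u] by (metis (no_types, lifting) Bl_def finite_Collect_conjI finite_lessThan finite_subset leD mem_Collect_eq subsetI)
    then show ?thesis by blast
  qed
  define r0 where "r0 x u = (SOME r. r \<in> J u \<and> r \<notin> Bl x u)" for x u
  have r0: "r0 x u \<in> J u \<and> r0 x u \<notin> Bl x u" if u: "u \<in> Q" for u x
    unfolding r0_def by (rule someI_ex[OF r0_ex[OF u]])
  \<comment> \<open>The neighbourhood to be cut out, and the element that identifies \<open>h\<close> among the vertices over its hub.\<close>
  define Z where "Z h u = {(r, slot h') | r h'. {h, h'} \<in> edges H \<and> f (\<phi> h') = Inl (r, F u r)}
     \<union> {(r0 (\<phi> h) u, enum (A u (r0 (\<phi> h) u)) (b h))}" for h u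
  have Z_sub: "Z h u \<subseteq> (SIGMA r:J u. A u r)" if h: "h \<in> verts H" "f (\<phi> h) = Inr u" for h u
  proof
    fix y assume "y \<in> Z h u"
    then consider r h' where "y = (r, slot h')" "{h, h'} \<in> edges H" "f (\<phi> h') = Inl (r, F u r)"
      | "y = (r0 (\<phi> h) u, enum (A u (r0 (\<phi> h) u)) (b h))" unfolding Z_def by blast
    then show "y \<in> (SIGMA r:J u. A u r)"
    proof cases
      case 1
      obtain r' where r': "r' \<in> J u" "f (\<phi> h') = Inl (r', F u r')" "lb (\<phi> h') = A u r'"
        using hub_edge[OF \<phi>E[OF 1(2)] h(2)] by blast
      have "slot h' \<in> lb (\<phi> h')" using slot_in[OF HV(2)[OF 1(2)] 1(3)] .
      then show ?thesis using 1 r' by simp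
    next
      case 2
      have u: "u \<in> Q" using hub[OF \<phi>V[OF h(1)] h(2)] .
      have "card (A u (r0 (\<phi> h) u)) = w" using iJA(4)[OF QM(1)[OF u]] r0[OF u] by blast
      moreover have "finite (A u (r0 (\<phi> h) u))" using AQ[OF u] by (rule finite_subset) simp
      ultimately have "enum (A u (r0 (\<phi> h) u)) (b h) \<in> A u (r0 (\<phi> h) u)"
        using b(1)[OF h(1)] by (intro enum_in) auto
      then show ?thesis using 2 r0[OF u] by simp
    qed
  qed
  have \<beta>_ex: "\<exists>\<beta>. \<beta> \<subseteq> ?Y \<and> \<beta> \<inter> (SIGMA r:J u. A u r) = Z h u \<and> (\<forall>y\<in>Z h u. col u \<beta> y = i0)"
    if h: "h \<in> verts H" "f (\<phi> h) = Inr u" for h u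
  proof -
    have u: "u \<in> Q" using hub[OF \<phi>V[OF h(1)] h(2)] .
    have "shattered (col u) i0 (Pow ?Y) (SIGMA r:J u. A u r)" using iJA(5)[OF QM(1)[OF u]] QM(2)[OF u] by simp
    then have "\<exists>\<beta>\<in>Pow ?Y. \<beta> \<inter> (SIGMA r:J u. A u r) = Z h u \<and> (\<forall>y\<in>Z h u. col u \<beta> y = i0)"
      unfolding shattered_def using Z_sub[OF h] by (elim allE[of _ "Z h u"] impE)
    then show ?thesis unfolding Bex_def Pow_iff .
  qed
  define \<beta> where "\<beta> h u = (SOME \<beta>. \<beta> \<subseteq> ?Y \<and> \<beta> \<inter> (SIGMA r:J u. A u r) = Z h u \<and>
     (\<forall>y\<in>Z h u. col u \<beta> y = i0))" for h u
  have \<beta>: "\<beta> h u \<subseteq> ?Y \<and> \<beta> h u \<inter> (SIGMA r:J u. A u r) = Z h u \<and> (\<forall>y\<in>Z h u. col u (\<beta> h u) y = i0)"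
    if h: "h \<in> verts H" "f (\<phi> h) = Inr u" for h u
    unfolding \<beta>_def by (rule someI_ex[OF \<beta>_ex[OF h]])
  define g where "g h = (case f (\<phi> h) of Inl (r, p) \<Rightarrow> Inl (r, p, slot h) | Inr u \<Rightarrow> Inr (u, \<beta> h u))" for h
  have g_leaf: "g h = Inl (r, p, slot h)" if "f (\<phi> h) = Inl (r, p)" for h r p using that by (simp add: g_def)
  have g_hub: "g h = Inr (u, \<beta> h u)" if "f (\<phi> h) = Inr u" for h u using that by (simp add: g_def)
  have \<phi>_eq: "\<phi> h = \<phi> h'" if "h \<in> verts H" "h' \<in> verts H" "f (\<phi> h) = f (\<phi> h')" for h h'
    using f_inj \<phi>V that by (meson inj_onD)
  have Z_block: "\<exists>h'. {h, h'} \<in> edges H \<and> f (\<phi> h') = Inl (r, F u r) \<and> slot h' = s"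
    if "(r, s) \<in> Z h u" "r \<noteq> r0 (\<phi> h) u" for r s h u
    using that unfolding Z_def by blast
  have r0_fresh: "r \<noteq> r0 (\<phi> h) u"
    if h: "{\<phi> h, y} \<in> edges T" "f (\<phi> h) = Inr u" "f y = Inl (r, F u r)" for h y u r
  proof -
    obtain r' where r': "u \<in> Q" "r' \<in> J u" "f y = Inl (r', F u r')" using hub_edge[OF h(1,2)] by blast
    then have "r \<in> Bl (\<phi> h) u"
      unfolding Bl_def using h fin_sgraph_edge_verts[OF finT h(1)] by auto
    then show ?thesis using r0[OF r'(1)] by blast
  qed
  have edge_hub: "({g h, g h'} \<in> edges ?G \<longleftrightarrow> {h, h'} \<in> edges H) \<and> ({h, h'} \<in> edges H \<longrightarrow> c {g h, g h'} = i0)"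
    if h: "h \<in> verts H" "h' \<in> verts H" "f (\<phi> h) = Inr u" "f (\<phi> h') = Inl (r, p)" for h h' u r p
  proof -
    have gg: "{g h, g h'} = {Inl (r, p, slot h'), Inr (u, \<beta> h u)}"
      unfolding g_hub[OF h(3)] g_leaf[OF h(4)] by (rule insert_commute)
    note \<beta>h = \<beta>[OF h(1,3)]
    have fwd: "{h, h'} \<in> edges H" if "{g h, g h'} \<in> edges ?G"
    proof -
      have e: "u < M" "\<beta> h u \<subseteq> ?Y" "(r, slot h') \<in> \<beta> h u" "p = F u r"
        using that unfolding gg incidence_host_edge_iff by auto
      have "r < R" using e(2,3) by auto
      have eT: "{\<phi> h, \<phi> h'} \<in> edges T"
        using f_ind[OF \<phi>V[OF h(1)] \<phi>V[OF h(2)] e(1) \<open>r < R\<close> h(3)] h(4) e(4) by simp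
      obtain r' where r': "r' \<in> J u" "f (\<phi> h') = Inl (r', F u r')" "lb (\<phi> h') = A u r'"
        using hub_edge[OF eT h(3)] by blast
      have rr: "r' = r" using r'(2) h(4) by simp
      have "slot h' \<in> A u r" using slot_in[OF h(2,4)] r'(3) rr by simp
      then have "(r, slot h') \<in> Z h u" using \<beta>h e(3) r'(1) rr by blast
      moreover have "r \<noteq> r0 (\<phi> h) u" using r0_fresh[OF eT h(3)] h(4) e(4) by simp
      ultimately obtain h'' where h'': "{h, h''} \<in> edges H" "f (\<phi> h'') = Inl (r, F u r)" "slot h'' = slot h'"
        using Z_block by blast
      have "\<phi> h'' = \<phi> h'" using \<phi>_eq[OF HV(2)[OF h''(1)] h(2)] h''(2) h(4) e(4) by simp
      then have "h'' = h'" using slot_eq[OF HV(2)[OF h''(1)] h(2) h''(2)] h''(3) by blast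
      then show ?thesis using h''(1) by simp
    qed
    have bwd: "{g h, g h'} \<in> edges ?G \<and> c {g h, g h'} = i0" if e: "{h, h'} \<in> edges H"
    proof -
      obtain r' where r': "u \<in> Q" "r' \<in> J u" "f (\<phi> h') = Inl (r', F u r')" "lb (\<phi> h') = A u r'"
        using hub_edge[OF \<phi>E[OF e] h(3)] by blast
      have rp: "r' = r" "p = F u r" using r'(3) h(4) by auto
      have "(r, slot h') \<in> Z h u" unfolding Z_def using e h(4) rp(2) by blast
      then have "(r, slot h') \<in> \<beta> h u" "col u (\<beta> h u) (r, slot h') = i0" using \<beta>h by blast+
      then show ?thesis
        unfolding gg incidence_host_edge_iff using \<beta>h QM(1)[OF r'(1)] rp(2) by (simp add: col_def)
    qed
    show ?thesis using fwd bwd by blast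
  qed
  have g_edge: "({g h, g h'} \<in> edges ?G \<longleftrightarrow> {h, h'} \<in> edges H) \<and> ({h, h'} \<in> edges H \<longrightarrow> c {g h, g h'} = i0)"
    if h: "h \<in> verts H" "h' \<in> verts H" for h h'
  proof -
    consider u rp where "f (\<phi> h) = Inr u" "f (\<phi> h') = Inl rp" | rp u where "f (\<phi> h) = Inl rp" "f (\<phi> h') = Inr u"
      | rp rp' where "f (\<phi> h) = Inl rp" "f (\<phi> h') = Inl rp'" | u u' where "f (\<phi> h) = Inr u" "f (\<phi> h') = Inr u'"
      by (metis sum.exhaust)
    then show ?thesis
    proof cases
      case 1
      then show ?thesis using edge_hub[OF h] by (cases rp) simp
    next
      case 2
      then show ?thesis using edge_hub[OF h(2,1)] by (cases rp) (simp add: insert_commute)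
    next
      case 3
      obtain r p r' p' where rp: "rp = (r, p)" "rp' = (r', p')" by (metis prod.exhaust)
      have "{g h, g h'} \<notin> edges ?G"
        using 3 g_leaf[of h r p] g_leaf[of h' r' p'] rp incidence_host_bipartite(1) by metis
      moreover have "{h, h'} \<notin> edges H"
      proof
        assume "{h, h'} \<in> edges H"
        then show False using leaf_edge[OF \<phi>E, of h h' r p] 3 rp by auto
      qed
      ultimately show ?thesis by blast
    next
      case 4
      have "{g h, g h'} \<notin> edges ?G"
        using 4 g_hub[of h u] g_hub[of h' u'] incidence_host_bipartite(2) by metis
      moreover have "{h, h'} \<notin> edges H"
      proof
        assume "{h, h'} \<in> edges H"
        then show False using hub_edge[OF \<phi>E, of h h' u] 4 by auto
      qed
      ultimately show ?thesis by blast
    qed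
  qed
  have g_inj: "h = h'" if h: "h \<in> verts H" "h' \<in> verts H" "g h = g h'" for h h'
  proof (cases "f (\<phi> h)")
    case (Inl rp)
    obtain r p where rp: "rp = (r, p)" by (cases rp)
    have "\<exists>rp'. f (\<phi> h') = Inl rp'"
      using h(3) g_leaf[of h r p] Inl rp g_hub[of h'] by (cases "f (\<phi> h')") auto
    then obtain r' p' where f': "f (\<phi> h') = Inl (r', p')" by auto
    have eq: "r' = r" "p' = p" "slot h' = slot h"
      using h(3) g_leaf[of h r p] g_leaf[OF f'] Inl rp by auto
    have "\<phi> h = \<phi> h'" using \<phi>_eq[OF h(1,2)] Inl rp f' eq by simp
    then show ?thesis using slot_eq[OF h(1,2) Inl] eq by simp
  next
    case (Inr u)
    have "\<exists>u'. f (\<phi> h') = Inr u'"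
    proof (cases "f (\<phi> h')")
      case (Inl rp')
      then show ?thesis using h(3) g_hub[OF Inr] g_leaf[of h' "fst rp'" "snd rp'"] by simp
    qed simp
    then obtain u' where f': "f (\<phi> h') = Inr u'" by blast
    have eq: "u' = u" "\<beta> h u = \<beta> h' u" using h(3) g_hub[OF Inr] g_hub[OF f'] by auto
    have f'u: "f (\<phi> h') = Inr u" using f' eq by simp
    have same: "\<phi> h = \<phi> h'" using \<phi>_eq[OF h(1,2)] Inr f'u by simp
    have u: "u \<in> Q" using hub[OF \<phi>V[OF h(1)] Inr] .
    let ?r = "r0 (\<phi> h) u"
    have "(?r, enum (A u ?r) (b h')) \<in> Z h' u" unfolding Z_def same by blast
    then have "(?r, enum (A u ?r) (b h')) \<in> Z h u"
      using \<beta>[OF h(1) Inr] \<beta>[OF h(2) f'u] eq(2) by simp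
    moreover have "\<not> (\<exists>h''. {h, h''} \<in> edges H \<and> f (\<phi> h'') = Inl (?r, F u ?r))"
      using r0_fresh[OF \<phi>E _] Inr by blast
    ultimately have "enum (A u ?r) (b h') = enum (A u ?r) (b h)" unfolding Z_def by blast
    moreover have "card (A u ?r) = w" using iJA(4)[OF QM(1)[OF u]] r0[OF u] by blast
    moreover have "finite (A u ?r)" using AQ[OF u] by (rule finite_subset) simp
    ultimately have "b h' = b h" using enum_eq_iff[of "A u ?r" "b h'" "b h"] b(1) h(1,2) by simp
    then show ?thesis using b(2)[OF h(1,2) same] by simp
  qed
  have g_verts: "g h \<in> verts ?G" if h: "h \<in> verts H" for h
  proof (cases "f (\<phi> h)")
    case (Inl rp)
    obtain r p where rp: "rp = (r, p)" by (cases rp)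
    obtain y where "{\<phi> h, y} \<in> edges T" using nbr[OF \<phi>V[OF h]] by blast
    then obtain u where u: "u \<in> Q" "r \<in> J u" "p = F u r" using leaf_edge[of "\<phi> h" y r p] Inl rp by blast
    have "r < R" using JQ[OF u(1)] u(2) by auto
    moreover have "p < N" using FN[OF QM(1)[OF u(1)] \<open>r < R\<close>] u(3) by simp
    moreover have "slot h < t" using slot_in[OF h Inl] leaf(3)[OF \<phi>V[OF h] Inl] by auto
    ultimately show ?thesis using g_leaf[of h r p] Inl rp by (simp add: incidence_host_def)
  next
    case (Inr u)
    have "u < M" using hub[OF \<phi>V[OF h] Inr] QM(1) by blast
    moreover have "\<beta> h u \<subseteq> ?Y" using \<beta>[OF h Inr] by blast
    ultimately show ?thesis unfolding g_hub[OF Inr] by (simp add: incidence_host_def)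
  qed
  show "\<exists>S\<subseteq>verts ?G. graph_iso H (induced_subgraph ?G S) \<and>
      (\<exists>i. \<forall>e\<in>edges (induced_subgraph ?G S). c e = i)"
  proof (intro exI[of _ "g ` verts H"] conjI)
    show "g ` verts H \<subseteq> verts ?G" using g_verts by blast
    show "graph_iso H (induced_subgraph ?G (g ` verts H))"
      unfolding graph_iso_def
    proof (intro exI[of _ g] conjI ballI)
      have "inj_on g (verts H)" using g_inj by (intro inj_onI)
      then show "bij_betw g (verts H) (verts (induced_subgraph ?G (g ` verts H)))"
        by (simp add: bij_betw_def induced_subgraph_def)
      fix h h' assume h: "h \<in> verts H" "h' \<in> verts H"
      then show "{h, h'} \<in> edges H \<longleftrightarrow> {g h, g h'} \<in> edges (induced_subgraph ?G (g ` verts H))"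
        using g_edge[OF h] by (simp add: induced_subgraph_def)
    qed
    show "\<exists>i. \<forall>e\<in>edges (induced_subgraph ?G (g ` verts H)). c e = i"
    proof (intro exI[of _ i0] ballI)
      fix e assume "e \<in> edges (induced_subgraph ?G (g ` verts H))"
      then have e: "e \<in> edges ?G" "e \<subseteq> g ` verts H" by (auto simp: induced_subgraph_def)
      obtain x y where xy: "e = {x, y}" using e(1) by (rule incidence_host_edgeE) blast
      then obtain h h' where h: "h \<in> verts H" "h' \<in> verts H" "e = {g h, g h'}" using e(2) by auto
      then show "c e = i0" using g_edge[OF h(1,2)] e(1) by simp
    qed
  qed
qed

section \<open>Bounds\<close>

text \<open>The hosts above have structured vertices, while the Ramsey numbers minimise over graphs on the natural
  numbers.\<close>

lemma graph_copy_into_nat: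
  fixes G :: "'a sgraph" and H :: "'b sgraph"
  assumes G: "fin_sgraph G" "ind_arrows G H q"
  obtains G' :: "nat sgraph" where "fin_sgraph G'" "ind_arrows G' H q"
    "card (verts G') \<le> card (verts G)" "card (edges G') \<le> card (edges G)"
proof -
  have finV: "finite (verts G)" using G(1) by (simp add: fin_sgraph_def)
  have finE: "finite (edges G)" by (rule fin_sgraph_finite_edges[OF G(1)])
  have edge: "e \<subseteq> verts G" "card e = 2" if "e \<in> edges G" for e
    using that G(1) by (auto simp: fin_sgraph_def)
  obtain f :: "'a \<Rightarrow> nat" where inj: "inj_on f (verts G)"
    using finite_imp_inj_to_nat_seg[OF finV] by blast
  define G' where "G' = \<lparr>verts = f ` verts G, edges = (`) f ` edges G\<rparr>"
  have vG': "verts G' = f ` verts G" and eG': "edges G' = (`) f ` edges G" by (simp_all add: G'_def)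
  have img_iff: "f ` e \<in> edges G' \<longleftrightarrow> e \<in> edges G" if e: "e \<subseteq> verts G" for e
  proof
    assume "f ` e \<in> edges G'"
    then obtain e' where "e' \<in> edges G" "f ` e = f ` e'" unfolding eG' by blast
    then show "e \<in> edges G" using inj_on_image_eq_iff[OF inj e edge(1)] by metis
  next
    assume "e \<in> edges G"
    then show "f ` e \<in> edges G'" unfolding eG' by (rule imageI)
  qed
  have fin: "fin_sgraph G'"
    unfolding fin_sgraph_def
  proof (intro conjI ballI)
    show "finite (verts G')" using finV by (simp add: vG')
    fix e assume "e \<in> edges G'"
    then obtain e' where e': "e' \<in> edges G" "e = f ` e'" unfolding eG' by blast
    show "e \<subseteq> verts G'" using edge(1)[OF e'(1)] e'(2) unfolding vG' by blast
    show "card e = 2" using edge[OF e'(1)] e'(2) card_image[OF inj_on_subset[OF inj]] by metis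
  qed
  have arrows: "ind_arrows G' H q"
    unfolding ind_arrows_def
  proof (intro allI impI)
    fix c assume c: "c ` edges G' \<subseteq> {..<q}"
    have "(\<lambda>e. c (f ` e)) ` edges G \<subseteq> {..<q}" using c unfolding eG' by (simp add: image_image)
    then have "\<exists>S\<subseteq>verts G. graph_iso H (induced_subgraph G S) \<and>
        (\<exists>i. \<forall>e\<in>edges (induced_subgraph G S). c (f ` e) = i)"
      by (rule G(2)[unfolded ind_arrows_def, rule_format])
    then obtain S i where S: "S \<subseteq> verts G" and iso: "graph_iso H (induced_subgraph G S)"
      and mono: "\<And>e. e \<in> edges (induced_subgraph G S) \<Longrightarrow> c (f ` e) = i" by blast
    obtain g where g: "bij_betw g (verts H) S"
      "\<And>u v. u \<in> verts H \<Longrightarrow> v \<in> verts H \<Longrightarrow> {u, v} \<in> edges H \<longleftrightarrow> {g u, g v} \<in> edges (induced_subgraph G S)"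
      using iso unfolding graph_iso_def induced_verts by blast
    have gS: "g u \<in> S" if "u \<in> verts H" for u using g(1) that by (rule bij_betw_apply)
    show "\<exists>S\<subseteq>verts G'. graph_iso H (induced_subgraph G' S) \<and> (\<exists>i. \<forall>e\<in>edges (induced_subgraph G' S). c e = i)"
    proof (rule exI[of _ "f ` S"], intro conjI)
      show "f ` S \<subseteq> verts G'" using S unfolding vG' by (rule image_mono)
      show "graph_iso H (induced_subgraph G' (f ` S))"
        unfolding graph_iso_def induced_verts
      proof (rule exI[of _ "f \<circ> g"], intro conjI ballI)
        have "bij_betw f S (f ` S)" using inj_on_subset[OF inj S] by (rule inj_on_imp_bij_betw)
        then show "bij_betw (f \<circ> g) (verts H) (f ` S)" using g(1) by (rule bij_betw_trans[rotated])
        fix u v assume uv: "u \<in> verts H" "v \<in> verts H"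
        have sub: "{g u, g v} \<subseteq> S" using gS uv by simp
        have "{g u, g v} \<subseteq> verts G" using sub S by (rule subset_trans)
        moreover have "{(f \<circ> g) u, (f \<circ> g) v} = f ` {g u, g v}" by simp
        ultimately show "{u, v} \<in> edges H \<longleftrightarrow> {(f \<circ> g) u, (f \<circ> g) v} \<in> edges (induced_subgraph G' (f ` S))"
          using g(2)[OF uv] img_iff[of "{g u, g v}"] sub by (simp add: induced_edges)
      qed
      show "\<exists>i. \<forall>e\<in>edges (induced_subgraph G' (f ` S)). c e = i"
      proof (rule exI[of _ i], rule ballI)
        fix e assume e: "e \<in> edges (induced_subgraph G' (f ` S))"
        then obtain e' where e': "e' \<in> edges G" "e = f ` e'" by (auto simp: induced_edges eG')
        have "f ` e' \<subseteq> f ` S" using e e'(2) by (simp add: induced_edges)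
        have "e' \<subseteq> S"
        proof
          fix x assume x: "x \<in> e'"
          then have "f x \<in> f ` S" using \<open>f ` e' \<subseteq> f ` S\<close> by blast
          moreover have "x \<in> verts G" using x edge(1)[OF e'(1)] by blast
          ultimately show "x \<in> S" using inj_on_image_mem_iff[OF inj _ S] by simp
        qed
        then show "c e = i" using mono[of e'] e' by (simp add: induced_edges)
      qed
    qed
  qed
  show ?thesis
  proof (rule that[OF fin arrows])
    show "card (verts G') \<le> card (verts G)" unfolding vG' using finV by (rule card_image_le)
    show "card (edges G') \<le> card (edges G)" unfolding eG' using finE by (rule card_image_le)
  qed
qed

lemma size_r_ind_le:
  assumes "fin_sgraph G" "ind_arrows G H q"
  shows "size_r_ind H q \<le> enat (card (edges G))" "r_ind H q \<le> enat (card (verts G))"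
proof -
  obtain G' :: "nat sgraph" where G': "fin_sgraph G'" "ind_arrows G' H q"
    "card (verts G') \<le> card (verts G)" "card (edges G') \<le> card (edges G)"
    using graph_copy_into_nat[OF assms] by blast
  have "size_r_ind H q \<le> enat (card (edges G'))"
    unfolding size_r_ind_def using G' by (intro INF_lower) simp
  also have "\<dots> \<le> enat (card (edges G))" using G'(4) by simp
  finally show "size_r_ind H q \<le> enat (card (edges G))" .
  have "r_ind H q \<le> enat (card (verts G'))"
    unfolding r_ind_def using G' by (intro INF_lower) simp
  also have "\<dots> \<le> enat (card (verts G))" using G'(3) by simp
  finally show "r_ind H q \<le> enat (card (verts G))" .
qed

lemma self_host:
  assumes "fin_sgraph H" "q \<le> 1 \<or> edges H = {}"
  shows "ind_arrows H H q"
  unfolding ind_arrows_def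
proof (intro allI impI)
  fix c assume c: "c ` edges H \<subseteq> {..<q}"
  have "graph_iso H H" unfolding graph_iso_def by (rule exI[of _ id]) auto
  moreover have "c e = 0" if "e \<in> edges H" for e
  proof -
    have "c e < q" using c that by blast
    then show ?thesis using assms(2) that by auto
  qed
  ultimately show "\<exists>S\<subseteq>verts H. graph_iso H (induced_subgraph H S) \<and> (\<exists>i. \<forall>e\<in>edges (induced_subgraph H S). c e = i)"
    by (intro exI[of _ "verts H"]) (auto simp: induced_all[OF assms(1)])
qed

lemma card_edges_le_degree:
  assumes "fin_sgraph G"
  shows "card (edges G) \<le> max_degree G * card (verts G)"
proof -
  have fin: "finite (edges G)" "finite (verts G)"
    using fin_sgraph_finite_edges[OF assms] assms by (auto simp: fin_sgraph_def)
  have "edges G \<subseteq> (\<Union>v\<in>verts G. {e \<in> edges G. v \<in> e})"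
  proof
    fix e assume e: "e \<in> edges G"
    then have "e \<noteq> {}" "e \<subseteq> verts G" using assms by (auto simp: fin_sgraph_def)
    then show "e \<in> (\<Union>v\<in>verts G. {e \<in> edges G. v \<in> e})" using e by blast
  qed
  then have "card (edges G) \<le> card (\<Union>v\<in>verts G. {e \<in> edges G. v \<in> e})"
    using fin by (intro card_mono) auto
  also have "\<dots> \<le> (\<Sum>v\<in>verts G. degree G v)" unfolding degree_def using fin by (intro card_UN_le) auto
  also have "\<dots> \<le> (\<Sum>v\<in>verts G. max_degree G)"
    unfolding max_degree_def using fin by (intro sum_mono Max_ge) auto
  finally show ?thesis by (simp add: mult.commute)
qed

lemma exists_log2_bound:
  fixes q :: nat
  assumes "q \<ge> 1"
  obtains l where "l \<ge> 1" "q \<le> 2 ^ l" "2 ^ l \<le> 2 * q"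
proof -
  have "\<exists>l\<ge>1. q \<le> 2 ^ l \<and> 2 ^ l \<le> 2 * q" using assms
  proof (induction q rule: dec_induct)
    case base
    show ?case by (intro exI[of _ 1]) simp
  next
    case (step q)
    then obtain l where l: "l \<ge> 1" "q \<le> 2 ^ l" "2 ^ l \<le> 2 * q" by blast
    show ?case
    proof (cases "Suc q \<le> 2 ^ l")
      case True
      then show ?thesis using l by (intro exI[of _ l]) auto
    next
      case False
      then have "2 ^ l = q" using l(2) by linarith
      then show ?thesis using l(1) step.hyps(1) by (intro exI[of _ "Suc l"]) auto
    qed
  qed
  then show ?thesis using that by blast
qed

text \<open>All parameters are at most \<open>2\<close> to the power of a multiple of \<open>R * t\<close>, apart from the factor \<open>n\<close>, and
  \<open>R * t\<close> is at most a multiple of \<open>k * q ^ 4 * w * l\<close> with \<open>2 ^ l \<le> 2 * q\<close>.\<close>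

lemma host_size_bound:
  fixes n k q w l :: nat
  assumes pos: "n \<ge> 1" "k \<ge> 1" "q \<ge> 1" "w \<ge> 1" "l \<ge> 1" and kq: "k * q \<ge> 2" and l: "2 ^ l \<le> 2 * q"
  defines "d \<equiv> 18 * (k + 2)"
  defines "R \<equiv> 4 * d * q\<^sup>2" and "t \<equiv> 32 * q\<^sup>2 * l * w"
  defines "c \<equiv> q * d * R * 2 ^ t + 1"
  defines "N \<equiv> 6 * n * (9 * (R + c) * 2 ^ R) ^ 4"
  defines "B \<equiv> (k * q) ^ (746496 * q ^ 4 * k ^ 3 * w) * n"
  shows "R * N * t + c * N * 2 ^ (R * t) \<le> B" "c * N * 2 ^ (R * t) * (R * t) \<le> B"
proof -
  define m where "m = R * t"
  have R1: "R \<ge> 1" and t1: "t \<ge> 1" and d1: "d \<ge> 1" using pos by (auto simp: R_def d_def t_def)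
  have Rm: "R \<le> m" and tm: "t \<le> m" and m1: "m \<ge> 1" using R1 t1 by (auto simp: m_def)
  have m2: "x \<le> 2 ^ m" if "x \<le> m" for x using that less_exp[of m] by linarith
  have "d * 1 \<le> d * (4 * q\<^sup>2)" using pos by (intro mult_left_mono) auto
  then have "d \<le> R" by (simp add: R_def mult_ac)
  then have d2: "d \<le> 2 ^ m" using Rm by (intro m2) linarith
  have "1 * q \<le> (4 * d * q) * q" using pos d1 by (intro mult_right_mono) auto
  then have "q \<le> R" by (simp add: R_def power2_eq_square mult_ac)
  then have q2: "q \<le> 2 ^ m" using Rm by (intro m2) linarith
  have R2: "R \<le> 2 ^ m" using Rm by (rule m2)
  have tt: "(2::nat) ^ t \<le> 2 ^ m" using tm by (intro power_increasing) auto
  have RR: "(2::nat) ^ R \<le> 2 ^ m" using Rm by (intro power_increasing) auto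
  have e: "(2::nat) ^ i \<le> 2 ^ j" if "i \<le> j" for i j using that by (intro power_increasing) auto
  have "q * d * R * 2 ^ t \<le> 2 ^ m * 2 ^ m * 2 ^ m * 2 ^ m"
    by (intro mult_mono q2 d2 R2 tt) auto
  also have "\<dots> = 2 ^ (4 * m)" by (simp add: power_add[symmetric])
  finally have "c \<le> 2 ^ (4 * m) + 2 ^ (4 * m)" unfolding c_def by (intro add_mono) auto
  also have "\<dots> = 2 ^ (4 * m + 1)" by simp
  also have "\<dots> \<le> 2 ^ (5 * m)" using m1 by (intro e) linarith
  finally have c2: "c \<le> 2 ^ (5 * m)" .
  have "R + c \<le> 2 ^ (5 * m) + 2 ^ (5 * m)" using order_trans[OF R2 e[of m "5 * m"]] c2 by (intro add_mono) auto
  also have "\<dots> = 2 ^ (5 * m + 1)" by simp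
  also have "\<dots> \<le> 2 ^ (6 * m)" using m1 by (intro e) linarith
  finally have Rc: "R + c \<le> 2 ^ (6 * m)" .
  have nine: "9 \<le> (2::nat) ^ (4 * m)" using e[of 4 "4 * m"] m1 by simp
  have six: "6 \<le> (2::nat) ^ (3 * m)" using e[of 3 "3 * m"] m1 by simp
  have "9 * (R + c) * 2 ^ R \<le> 2 ^ (4 * m) * 2 ^ (6 * m) * 2 ^ m"
    by (intro mult_mono nine Rc RR) auto
  also have "\<dots> = 2 ^ (11 * m)" by (simp add: power_add[symmetric])
  finally have "(9 * (R + c) * 2 ^ R) ^ 4 \<le> (2 ^ (11 * m)) ^ 4" by (rule power_mono) simp
  also have "\<dots> = 2 ^ (44 * m)" by (simp add: power_mult[symmetric])
  finally have "N \<le> 2 ^ (3 * m) * n * 2 ^ (44 * m)"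
    unfolding N_def by (intro mult_mono six) auto
  also have "\<dots> = 2 ^ (47 * m) * n" by (simp add: power_add[symmetric])
  finally have N2: "N \<le> 2 ^ (47 * m) * n" .
  have "c * N \<le> 2 ^ (5 * m) * (2 ^ (47 * m) * n)" by (intro mult_mono c2 N2) auto
  also have "\<dots> = 2 ^ (52 * m) * n" by (simp add: power_add[symmetric] mult.assoc[symmetric])
  finally have M2: "c * N \<le> 2 ^ (52 * m) * n" .
  have top: "2 ^ (54 * m) * n \<le> B"
  proof -
    have "m = 2304 * ((k + 2) * q ^ 4 * w) * l"
      by (simp add: m_def R_def t_def d_def power2_eq_square power4_eq_xxxx algebra_simps)
    also have "\<dots> \<le> 2304 * ((3 * k) * q ^ 4 * w) * l"
      using pos by (intro mult_right_mono mult_left_mono) auto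
    also have "\<dots> = l * (6912 * (k * q ^ 4 * w))" by simp
    finally have "54 * m \<le> 54 * (l * (6912 * (k * q ^ 4 * w)))" by (rule mult_left_mono) simp
    also have "\<dots> = l * (373248 * (k * q ^ 4 * w))" by (simp add: algebra_simps)
    finally have "54 * m \<le> l * (373248 * (k * q ^ 4 * w))" .
    then have "(2::nat) ^ (54 * m) \<le> 2 ^ (l * (373248 * (k * q ^ 4 * w)))" by (rule e)
    also have "\<dots> = (2 ^ l) ^ (373248 * (k * q ^ 4 * w))" by (rule power_mult)
    also have "\<dots> \<le> ((k * q)\<^sup>2) ^ (373248 * (k * q ^ 4 * w))"
    proof (rule power_mono)
      have "1 * q \<le> k * q" using pos by (intro mult_right_mono) auto
      then have "2 * q \<le> (k * q) * (k * q)" using kq by (intro mult_mono) auto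
      then show "2 ^ l \<le> (k * q)\<^sup>2" using l by (simp only: power2_eq_square)
    qed simp
    also have "\<dots> = (k * q) ^ (2 * (373248 * (k * q ^ 4 * w)))" by (rule power_mult[symmetric])
    also have "\<dots> \<le> (k * q) ^ (746496 * q ^ 4 * k ^ 3 * w)"
    proof (rule power_increasing)
      have "k ^ 1 \<le> k ^ 3" using pos by (intro power_increasing) auto
      then have "746496 * q ^ 4 * w * k \<le> 746496 * q ^ 4 * w * k ^ 3" by (intro mult_left_mono) auto
      then show "2 * (373248 * (k * q ^ 4 * w)) \<le> 746496 * q ^ 4 * k ^ 3 * w" by (simp add: mult_ac)
      show "1 \<le> k * q" using kq by linarith
    qed
    finally show ?thesis unfolding B_def by (rule mult_right_mono) simp
  qed
  have "R * N * t = m * N" by (simp add: m_def)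
  also have "\<dots> \<le> 2 ^ m * (2 ^ (47 * m) * n)" by (intro mult_mono N2 m2) auto
  also have "\<dots> = 2 ^ (48 * m) * n" by (simp add: power_add[symmetric] mult.assoc[symmetric])
  also have "\<dots> \<le> 2 ^ (53 * m) * n" by (intro mult_right_mono e) auto
  finally have v1: "R * N * t \<le> 2 ^ (53 * m) * n" .
  have "c * N * 2 ^ (R * t) \<le> 2 ^ (52 * m) * n * 2 ^ m"
    unfolding m_def[symmetric] by (intro mult_mono M2) auto
  also have "\<dots> = 2 ^ (53 * m) * n" by (simp add: power_add[symmetric])
  finally have v2: "c * N * 2 ^ (R * t) \<le> 2 ^ (53 * m) * n" .
  have "R * N * t + c * N * 2 ^ (R * t) \<le> 2 ^ (53 * m) * n + 2 ^ (53 * m) * n" by (rule add_mono[OF v1 v2])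
  also have "\<dots> = 2 ^ (53 * m + 1) * n" by simp
  also have "\<dots> \<le> 2 ^ (54 * m) * n" using m1 by (intro mult_right_mono e) auto
  finally show "R * N * t + c * N * 2 ^ (R * t) \<le> B" using top by (rule order_trans)
  have "c * N * 2 ^ (R * t) * (R * t) \<le> 2 ^ (53 * m) * n * 2 ^ m"
    by (rule mult_le_mono[OF v2]) (use m2[of m] in \<open>simp add: m_def\<close>)
  also have "\<dots> = 2 ^ (54 * m) * n" by (simp add: power_add[symmetric])
  finally show "c * N * 2 ^ (R * t) * (R * t) \<le> B" using top by (rule order_trans)
qed

lemma induced_ramsey_blowup_bound:
  fixes T :: "'t sgraph" and H :: "'h sgraph"
  assumes T: "is_tree T" "max_degree T = k" and k: "k \<ge> 1" and q: "q \<ge> 1" and w: "w \<ge> 1" and kq: "k * q \<ge> 2"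
    and H: "fin_sgraph H" "is_blowup w H T"
  defines "B \<equiv> (k * q) ^ (746496 * q ^ 4 * k ^ 3 * w) * card (verts T)"
  shows "r_ind H q \<le> enat B" "size_r_ind H q \<le> enat B"
proof -
  have finT: "fin_sgraph T" and conn: "is_connected T" using T(1) by (auto simp: is_tree_def)
  have finV: "finite (verts T)" using finT by (simp add: fin_sgraph_def)
  have neV: "verts T \<noteq> {}" using conn by (simp add: is_connected_def)
  have n1: "card (verts T) \<ge> 1" using finV neV by (simp add: Suc_le_eq card_gt_0_iff)
  have nbr: "\<exists>y\<in>verts T. {x, y} \<in> edges T" if x: "x \<in> verts T" for x
  proof -
    have "verts T \<noteq> {x}"
    proof
      assume eq: "verts T = {x}"
      have "edges T = {}"
      proof (rule ccontr)
        assume "edges T \<noteq> {}"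
        then obtain e where e: "e \<in> edges T" by blast
        then have "e \<subseteq> {x}" "card e = 2" using finT eq by (auto simp: fin_sgraph_def)
        then show False using card_mono[of "{x}" e] by simp
      qed
      then have "max_degree T = 0" by (simp add: max_degree_def degree_def eq)
      then show False using T(2) k by simp
    qed
    then have "{x} \<subset> verts T" using x by blast
    then have "\<exists>x'\<in>{x}. \<exists>y\<in>verts T - {x}. {x', y} \<in> edges T"
      using connected_cut_free[OF conn, unfolded cut_free_def, rule_format, of "{x}"] by simp
    then show ?thesis by blast
  qed
  obtain l where l: "l \<ge> 1" "q \<le> 2 ^ l" "2 ^ l \<le> 2 * q" using exists_log2_bound[OF q] .
  define n where "n = card (verts T)"
  define d where "d = 18 * (k + 2)"
  define R where "R = 4 * d * q\<^sup>2"
  define t where "t = 32 * q\<^sup>2 * l * w"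
  \<comment> \<open>There are \<open>c * N\<close> hubs; this exceeds \<open>q * d\<close> times the number of points with a set.\<close>
  define c where "c = q * d * R * 2 ^ t + 1"
  define N where "N = 6 * n * (9 * (R + c) * 2 ^ R) ^ 4"
  have R1: "R \<ge> 1" using q by (simp add: R_def d_def)
  obtain F where F: "sparse_incidence n R N (c * N) F"
    using sparse_incidence_exists[OF n1 R1, of c] unfolding N_def n_def by blast
  have N1: "N > 0"
  proof -
    have "9 * (R + c) * 2 ^ R > 0" using R1 by simp
    then show ?thesis using n1 by (simp add: N_def n_def)
  qed
  have M: "q * (d * (R * N * 2 ^ t)) < c * N"
  proof -
    have "q * (d * (R * N * 2 ^ t)) = (q * d * R * 2 ^ t) * N" by simp
    also have "\<dots> < c * N" using N1 by (intro mult_strict_right_mono) (auto simp: c_def)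
    finally show ?thesis .
  qed
  let ?G = "incidence_host R N t (c * N) F"
  have fin: "fin_sgraph ?G"
    using F by (intro fin_incidence_host) (simp add: sparse_incidence_def)
  have arrows: "ind_arrows ?G H q"
  proof (rule incidence_host_arrows[OF T(1) _ _ nbr q w l(1) k l(2) d_def R_def t_def M])
    show "card (verts T) \<le> n" by (simp add: n_def)
    show "max_degree T \<le> k" by (simp add: T(2))
    show "sparse_incidence n R N (c * N) F" by (rule F)
    show "fin_sgraph H" "is_blowup w H T" by (rule H)+
  qed
  note bound = host_size_bound[OF n1 k q w l(1) kq l(3), folded n_def, folded d_def, folded R_def t_def,
      folded c_def, folded N_def]
  have "r_ind H q \<le> enat (card (verts ?G))" by (rule size_r_ind_le(2)[OF fin arrows])
  also have "card (verts ?G) \<le> B"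
    using card_incidence_host(1)[of R N t "c * N" F] bound(1) unfolding B_def n_def by (rule order_trans)
  finally show "r_ind H q \<le> enat B" by simp
  have "size_r_ind H q \<le> enat (card (edges ?G))" by (rule size_r_ind_le(1)[OF fin arrows])
  also have "card (edges ?G) \<le> B"
    using card_incidence_host(2)[of R N t "c * N" F] bound(2) unfolding B_def n_def by (rule order_trans)
  finally show "size_r_ind H q \<le> enat B" by simp
qed

lemma blowup_one_self: "is_blowup 1 T T"
  unfolding is_blowup_def
proof (rule exI[of _ id], intro conjI ballI allI impI)
  fix v assume "v \<in> verts T"
  then have eq: "{u \<in> verts T. id u = v} = {v}" by auto
  show "card {u \<in> verts T. id u = v} \<le> 1" unfolding eq by simp
qed auto

lemma blowup_one_edges:
  assumes "fin_sgraph H" "is_blowup w H T" "w \<le> 1" "fin_sgraph T"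
  shows "card (edges H) \<le> card (edges T)"
proof -
  obtain \<phi> where \<phi>: "\<phi> ` verts H \<subseteq> verts T" "\<And>u v. {u, v} \<in> edges H \<Longrightarrow> {\<phi> u, \<phi> v} \<in> edges T"
    "\<And>v. v \<in> verts T \<Longrightarrow> card {u \<in> verts H. \<phi> u = v} \<le> w" using assms(2) unfolding is_blowup_def by blast
  have finH: "finite (verts H)" using assms(1) by (simp add: fin_sgraph_def)
  have inj: "inj_on \<phi> (verts H)"
  proof (rule inj_onI)
    fix x y assume xy: "x \<in> verts H" "y \<in> verts H" "\<phi> x = \<phi> y"
    have "\<phi> x \<in> verts T" using \<phi>(1) xy(1) by blast
    then have "card {u \<in> verts H. \<phi> u = \<phi> x} \<le> Suc 0" using \<phi>(3) assms(3) by fastforce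
    then have "\<forall>a\<in>{u \<in> verts H. \<phi> u = \<phi> x}. \<forall>b\<in>{u \<in> verts H. \<phi> u = \<phi> x}. a = b"
      using finH card_le_Suc0_iff_eq[of "{u \<in> verts H. \<phi> u = \<phi> x}"] by simp
    then show "x = y" using xy by simp
  qed
  have sub: "e \<subseteq> verts H" "card e = 2" if "e \<in> edges H" for e using assms(1) that by (auto simp: fin_sgraph_def)
  show ?thesis
  proof (rule card_inj_on_le[of "(`) \<phi>"])
    show "inj_on ((`) \<phi>) (edges H)"
      using sub inj_on_image_eq_iff[OF inj] by (intro inj_onI) simp
    show "(`) \<phi> ` edges H \<subseteq> edges T"
    proof
      fix e' assume "e' \<in> (`) \<phi> ` edges H"
      then obtain e where e: "e \<in> edges H" "e' = \<phi> ` e" by blast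
      obtain x y where "e = {x, y}" using sub(2)[OF e(1)] by (meson card_2_iff)
      then show "e' \<in> edges T" using \<phi>(2)[of x y] e by simp
    qed
    show "finite (edges T)" by (rule fin_sgraph_finite_edges[OF assms(4)])
  qed
qed

lemma blowup_zero_verts:
  assumes "fin_sgraph H" "is_blowup 0 H T"
  shows "verts H = {}"
proof (rule ccontr)
  assume "verts H \<noteq> {}"
  then obtain h where h: "h \<in> verts H" by blast
  obtain \<phi> where \<phi>: "\<phi> ` verts H \<subseteq> verts T" "\<forall>v\<in>verts T. card {u \<in> verts H. \<phi> u = v} \<le> 0"
    using assms(2) unfolding is_blowup_def by blast
  have "\<phi> h \<in> verts T" using \<phi>(1) h by blast
  then have "card {u \<in> verts H. \<phi> u = \<phi> h} = 0" using \<phi>(2) by simp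
  moreover have "finite {u \<in> verts H. \<phi> u = \<phi> h}" using assms(1) by (simp add: fin_sgraph_def)
  ultimately have "{u \<in> verts H. \<phi> u = \<phi> h} = {}" by simp
  then show False using h by blast
qed

text \<open>Three degenerate cases are left besides \<open>induced_ramsey_blowup_bound\<close>. If \<open>k = 0\<close>, or \<open>k * q = 1\<close>, or
  \<open>w = 0\<close>, the graph itself is a small enough host.\<close>

theorem theorem2:
  shows "\<exists>C::nat. \<forall>(n::nat) (k::nat) (q::nat) (T::nat sgraph).
    is_tree T \<and> card (verts T) = n \<and> max_degree T = k \<and> q \<ge> 1 \<longrightarrow>
      (q \<ge> 2 \<and> \<not> is_star T \<longrightarrow> r_ind T q \<le> size_r_ind T q) \<and>
      r_ind T q \<le> enat ((k * q) ^ (C * q ^ 4 * k ^ 3) * n) \<and>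
      size_r_ind T q \<le> enat ((k * q) ^ (C * q ^ 4 * k ^ 3) * n) \<and>
      (\<forall>(w::nat) (H::nat sgraph).
         fin_sgraph H \<and> is_blowup w H T \<and> (k * q = 1 \<longrightarrow> w \<le> 1) \<longrightarrow>
           size_r_ind H q \<le> enat ((k * q) ^ (C * q ^ 4 * k ^ 3 * w) * n))"
proof (intro exI[of _ 746496] allI impI, elim conjE)
  fix n k q :: nat and T :: "nat sgraph"
  assume T: "is_tree T" and n: "card (verts T) = n" and k: "max_degree T = k" and q: "q \<ge> 1"
  have finT: "fin_sgraph T" and conn: "is_connected T" using T by (auto simp: is_tree_def)
  have edges_T: "card (edges T) \<le> k * n" using card_edges_le_degree[OF finT] n k by simp
  let ?B = "\<lambda>w. (k * q) ^ (746496 * q ^ 4 * k ^ 3 * w) * n"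
  have self: "r_ind H q \<le> enat (card (verts H))" "size_r_ind H q \<le> enat (card (edges H))"
    if "fin_sgraph H" "q \<le> 1 \<or> edges H = {}" for H :: "nat sgraph"
    using size_r_ind_le[OF that(1) self_host[OF that]] by auto
  have "k = 0 \<or> k * q = 1 \<or> k \<ge> 1 \<and> k * q \<ge> 2" using q by (cases "k * q") (auto simp: Suc_le_eq)
  then consider "k = 0" | "k * q = 1" | "k \<ge> 1" "k * q \<ge> 2" by blast
  then have bounds: "r_ind T q \<le> enat (?B 1) \<and> size_r_ind T q \<le> enat (?B 1) \<and>
      (\<forall>(w::nat) (H::nat sgraph). fin_sgraph H \<and> is_blowup w H T \<and> (k * q = 1 \<longrightarrow> w \<le> 1) \<longrightarrow>
           size_r_ind H q \<le> enat (?B w))"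
  proof cases
    case 1
    have B: "?B w = n" for w using 1 by simp
    have noE: "edges T = {}" using edges_T 1 fin_sgraph_finite_edges[OF finT] by simp
    have "r_ind T q \<le> enat n" "size_r_ind T q \<le> enat n"
      using self[OF finT] noE n by (auto intro: order_trans)
    moreover have "size_r_ind H q \<le> enat n" if H: "fin_sgraph H" "is_blowup w H T" for w and H :: "nat sgraph"
    proof -
      obtain \<phi> where \<phi>: "\<forall>u v. {u, v} \<in> edges H \<longrightarrow> {\<phi> u, \<phi> v} \<in> edges T"
        using H(2) unfolding is_blowup_def by blast
      have "edges H = {}"
      proof (rule ccontr)
        assume "edges H \<noteq> {}"
        then obtain e where e: "e \<in> edges H" by blast
        then have "card e = 2" using H(1) by (simp add: fin_sgraph_def)
        then obtain x y where "e = {x, y}" by (meson card_2_iff)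
        then show False using \<phi> e noE by simp
      qed
      then show ?thesis using self(2)[OF H(1)] by (auto intro: order_trans)
    qed
    ultimately show ?thesis unfolding B by blast
  next
    case 2
    then have kq: "k = 1" "q = 1" by simp_all
    have B: "?B w = n" for w using kq by simp
    have "r_ind T q \<le> enat n" using self(1)[OF finT] kq n by simp
    moreover have "size_r_ind H q \<le> enat n"
      if H: "fin_sgraph H" "is_blowup w H T" "w \<le> 1" for w and H :: "nat sgraph"
    proof -
      have "card (edges H) \<le> n" using blowup_one_edges[OF H finT] edges_T kq by simp
      moreover have "size_r_ind H q \<le> enat (card (edges H))" using self(2)[OF H(1)] kq by simp
      ultimately show ?thesis by (meson enat_ord_simps(1) order_trans)
    qed
    ultimately show ?thesis unfolding B using finT blowup_one_self[of T] 2 by auto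
  next
    case 3
    have T_bounds: "r_ind T q \<le> enat (?B 1)" "size_r_ind T q \<le> enat (?B 1)"
      using induced_ramsey_blowup_bound[OF T k 3(1) q _ 3(2) finT blowup_one_self] n by simp_all
    have "size_r_ind H q \<le> enat (?B w)" if H: "fin_sgraph H" "is_blowup w H T" for w and H :: "nat sgraph"
    proof (cases "w = 0")
      case True
      have "verts H = {}" using H True by (intro blowup_zero_verts[of H T]) simp_all
      then have "edges H = {}" using H(1) by (auto simp: fin_sgraph_def)
      then have "size_r_ind H q \<le> enat 0" using self(2)[OF H(1)] by simp
      also have "\<dots> \<le> enat (?B w)" by simp
      finally show ?thesis .
    next
      case False
      then show ?thesis using induced_ramsey_blowup_bound(2)[OF T k 3(1) q _ 3(2) H] n by simp
    qed
    then show ?thesis using T_bounds by blast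
  qed
  show "(q \<ge> 2 \<and> \<not> is_star T \<longrightarrow> r_ind T q \<le> size_r_ind T q) \<and>
      r_ind T q \<le> enat ((k * q) ^ (746496 * q ^ 4 * k ^ 3) * n) \<and>
      size_r_ind T q \<le> enat ((k * q) ^ (746496 * q ^ 4 * k ^ 3) * n) \<and>
      (\<forall>(w::nat) (H::nat sgraph).
         fin_sgraph H \<and> is_blowup w H T \<and> (k * q = 1 \<longrightarrow> w \<le> 1) \<longrightarrow>
           size_r_ind H q \<le> enat ((k * q) ^ (746496 * q ^ 4 * k ^ 3 * w) * n))"
    using bounds r_ind_le_size_r_ind[OF finT conn, of q] by simp
qed

end
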